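(* Let $\mathcal{G}=(\mathsf V,\mathsf E)$ be a finite, connected, compact metric graph without loops, let $q\in L^\infty(\mathcal G)\cap\bigoplus_{\mathsf e\in\mathsf E}C^\infty(0,\ell_{\mathsf e})$ be real-valued and let $\sigma=(\sigma_{\mathsf v})_{\mathsf v\in\mathsf V}\in\mathbb R^{|\mathsf V|}$. Assume that the Schrödinger operator $H_{\mathcal G}^{q,\sigma}$ satisfies $$\lambda_n^{q,\sigma}=\lambda_n^0,\qquad n=0,1,\dots,$$ where $\lambda_n^0$ are the eigenvalues of $H_{\mathcal G}^0$. Then, whenever one of the following assertions is satisfied, \begin{itemize} \item[(i)] $\sum_{\mathsf v\in\mathsf V}\sigma_{\mathsf v}\Big(1-\frac{2}{\deg(\mathsf v)}\Big)\le 0$, \item[(ii)] $\int_{\mathcal G}q\,\mathrm dx\ge 0$ and $\sigma\in[0,\infty)^{|\mathsf V|}$, \item[(iii)] $\Big(\frac{\Delta_{\min}}{2}-1\Big)\int_{\mathcal G}q\,\mathrm dx\ge 0$ and $\sigma\in(-\infty,0]^{|\mathsf V|}$, where $\Delta_{\min}:=\min_{\mathsf v\in\mathsf V}\deg(\mathsf v)$ denotes the minimal degree of the graph $\mathcal G$, \end{itemize} one has $q=0$ and $\sigma=0$.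
   Context: $\mathcal G=(\mathsf V,\mathsf E)$ is a finite, connected, compact metric graph with vertex set $\mathsf V$ and edge set $\mathsf E$; each edge $\mathsf e\in\mathsf E$ is identified with an interval of length $\ell_{\mathsf e}\in(0,\infty)$. The graph is assumed to have no loops (no edge joining a vertex to itself). $\deg(\mathsf v)$ is the degree of the vertex $\mathsf v$ (the number of edges incident to $\mathsf v$). The Hilbert space is $L^2(\mathcal G)=\bigoplus_{\mathsf e\in\mathsf E}L^2(0,\ell_{\mathsf e})$, and $\int_{\mathcal G}$ denotes the sum of the integrals over all edges. $C(\mathcal G)$ is the space of continuous functions on $\mathcal G$ (in particular continuous across vertices), and $H^1(\mathcal G):=\bigoplus_{\mathsf e\in\mathsf E}H^1(0,\ell_{\mathsf e})\cap C(\mathcal G)$. For real-valued $q=(q_{\mathsf e})_{\mathsf e\in\mathsf E}\in L^\infty(\mathcal G)\cap\bigoplus_{\mathsf e\in\mathsf E}C^\infty(0,\ell_{\mathsf e})$ and $\sigma=(\sigma_{\mathsf v})_{\mathsf v\in\mathsf V}\in\mathbb R^{|\mathsf V|}$, $H_{\mathcal G}^{q,\sigma}=-\frac{\mathrm d^2}{\mathrm dx^2}+q(x)$ is the self-adjoint operator on $L^2(\mathcal G)$ associated with the quadratic form $$h_{\mathcal G}^{q,\sigma}(f)=\int_{\mathcal G}|f'|^2\,\mathrm dx+\int_{\mathcal G}q|f|^2\,\mathrm dx+\sum_{\mathsf v\in\mathsf V}\sigma_{\mathsf v}|f(\mathsf v)|^2$$ with form domain $H^1(\mathcal G)$. It has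 compact resolvent, hence purely discrete spectrum, with eigenvalues (counted with multiplicity) $\lambda_0^{q,\sigma}<\lambda_1^{q,\sigma}\le\lambda_2^{q,\sigma}\le\dots\to+\infty$. $H_{\mathcal G}^0:=H_{\mathcal G}^{q=0,\sigma=0}$ denotes the operator with zero potential and $\sigma=0$, and $(\lambda_n^0)_{n\in\mathbb N_0}$ denotes its eigenvalues, ordered in the same way. *)

theory Defs
  imports
    "Graph_Theory.Digraph_Component"
    "HOL-Analysis.Analysis"
    "HOL-Library.Function_Algebras"
begin

section \<open>Compact metric graphs\<close>

text \<open>
  The edge \<open>e\<close> is identified with \<open>{0..len e}\<close>, where \<open>0\<close> corresponds to \<open>tail G e\<close> and \<open>len e\<close>
  to \<open>head G e\<close>; the orientation of the underlying multigraph serves no other purpose, and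
  connectedness and degrees disregard it. The graph without edges, whose \<open>L\<^sup>2\<close> space is trivial,
  is excluded.
\<close>

locale metric_graph = fin_digraph G
  for G :: "('v, 'e) pre_digraph" (structure) +
  fixes len :: "'e \<Rightarrow> real"
  assumes connected: "Digraph_Component.connected G"
    and arcs_nonempty: "arcs G \<noteq> {}"
    and len_pos: "e \<in> arcs G \<Longrightarrow> 0 < len e"

definition vertex_degree :: "('v, 'e) pre_digraph \<Rightarrow> 'v \<Rightarrow> nat" where
  "vertex_degree G v = in_degree G v + out_degree G v"

definition min_degree :: "('v, 'e) pre_digraph \<Rightarrow> nat" where
  "min_degree G = Min (vertex_degree G ` verts G)"

definition graph_integral ::
    "('v, 'e) pre_digraph \<Rightarrow> ('e \<Rightarrow> real) \<Rightarrow> ('e \<Rightarrow> real \<Rightarrow> 'b)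
      \<Rightarrow> 'b::{banach, second_countable_topology}" where
  "graph_integral G len f = (\<Sum>e\<in>arcs G. integral\<^sup>L (lebesgue_on {0<..<len e}) (f e))"


section \<open>Function spaces\<close>

definition smooth_on :: "real set \<Rightarrow> (real \<Rightarrow> real) \<Rightarrow> bool" where
  "smooth_on S f \<longleftrightarrow> (\<forall>n. \<forall>x\<in>S. (deriv ^^ n) f differentiable at x)"

definition L2_interval :: "real \<Rightarrow> (real \<Rightarrow> complex) set" where
  "L2_interval l = {f. f \<in> borel_measurable (lebesgue_on {0<..<l}) \<and>
     integrable (lebesgue_on {0<..<l}) (\<lambda>x. (cmod (f x))\<^sup>2)}"

definition Linf_interval :: "real \<Rightarrow> (real \<Rightarrow> real) set" where
  "Linf_interval l = {f. f \<in> borel_measurable (lebesgue_on {0<..<l}) \<and>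
     (\<exists>C. AE x in lebesgue_on {0<..<l}. \<bar>f x\<bar> \<le> C)}"

definition test_function :: "real \<Rightarrow> (real \<Rightarrow> real) \<Rightarrow> bool" where
  "test_function l \<phi> \<longleftrightarrow> smooth_on UNIV \<phi> \<and> closure {x. \<phi> x \<noteq> 0} \<subseteq> {0<..<l}"

definition has_weak_derivative :: "real \<Rightarrow> (real \<Rightarrow> complex) \<Rightarrow> (real \<Rightarrow> complex) \<Rightarrow> bool" where
  "has_weak_derivative l f g \<longleftrightarrow> f \<in> L2_interval l \<and> g \<in> L2_interval l \<and>
     (\<forall>\<phi>. test_function l \<phi> \<longrightarrow>
        (LINT x|lebesgue_on {0<..<l}. f x * of_real (deriv \<phi> x)) =
        - (LINT x|lebesgue_on {0<..<l}. g x * of_real (\<phi> x)))"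

definition H1_interval :: "real \<Rightarrow> (real \<Rightarrow> complex) set" where
  "H1_interval l = {f. \<exists>g. has_weak_derivative l f g}"

text \<open>The weak derivative is unique up to null sets, and it only ever occurs under integrals.\<close>

definition weak_derivative :: "real \<Rightarrow> (real \<Rightarrow> complex) \<Rightarrow> real \<Rightarrow> complex" where
  "weak_derivative l f = (SOME g. has_weak_derivative l f g)"

definition graph_L2 ::
    "('v, 'e) pre_digraph \<Rightarrow> ('e \<Rightarrow> real) \<Rightarrow> ('e \<Rightarrow> real \<Rightarrow> complex) set" where
  "graph_L2 G len = {f. \<forall>e\<in>arcs G. f e \<in> L2_interval (len e)}"

text \<open>
  Continuous functions on the graph are normalised to vanish off the graph, so that each of them
  is represented by exactly one HOL function. This makes dimensions of spaces of such functions
  meaningful.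
\<close>

definition graph_C ::
    "('v, 'e) pre_digraph \<Rightarrow> ('e \<Rightarrow> real) \<Rightarrow> ('e \<Rightarrow> real \<Rightarrow> complex) set" where
  "graph_C G len = {f.
     (\<forall>e\<in>arcs G. continuous_on {0..len e} (f e)) \<and>
     (\<forall>v\<in>verts G. \<exists>z. \<forall>e\<in>arcs G.
        (tail G e = v \<longrightarrow> f e 0 = z) \<and> (head G e = v \<longrightarrow> f e (len e) = z)) \<and>
     (\<forall>e x. e \<notin> arcs G \<or> x \<notin> {0..len e} \<longrightarrow> f e x = 0)}"

definition vertex_value ::
    "('v, 'e) pre_digraph \<Rightarrow> ('e \<Rightarrow> real) \<Rightarrow> ('e \<Rightarrow> real \<Rightarrow> complex) \<Rightarrow> 'v \<Rightarrow> complex" where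
  "vertex_value G len f v = (THE z. \<forall>e\<in>arcs G.
     (tail G e = v \<longrightarrow> f e 0 = z) \<and> (head G e = v \<longrightarrow> f e (len e) = z))"

definition graph_H1 ::
    "('v, 'e) pre_digraph \<Rightarrow> ('e \<Rightarrow> real) \<Rightarrow> ('e \<Rightarrow> real \<Rightarrow> complex) set" where
  "graph_H1 G len = {f \<in> graph_C G len. \<forall>e\<in>arcs G. f e \<in> H1_interval (len e)}"

definition graph_inner ::
    "('v, 'e) pre_digraph \<Rightarrow> ('e \<Rightarrow> real) \<Rightarrow>
      ('e \<Rightarrow> real \<Rightarrow> complex) \<Rightarrow> ('e \<Rightarrow> real \<Rightarrow> complex) \<Rightarrow> complex" where
  "graph_inner G len f g = graph_integral G len (\<lambda>e x. f e x * cnj (g e x))"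

definition admissible_potential ::
    "('v, 'e) pre_digraph \<Rightarrow> ('e \<Rightarrow> real) \<Rightarrow> ('e \<Rightarrow> real \<Rightarrow> real) \<Rightarrow> bool" where
  "admissible_potential G len q \<longleftrightarrow>
     (\<forall>e\<in>arcs G. q e \<in> Linf_interval (len e) \<and> smooth_on {0<..<len e} (q e))"


section \<open>Schroedinger operators\<close>

text \<open>The sesquilinear form whose diagonal is the quadratic form of the operator.\<close>

definition schroedinger_form ::
    "('v, 'e) pre_digraph \<Rightarrow> ('e \<Rightarrow> real) \<Rightarrow> ('e \<Rightarrow> real \<Rightarrow> real) \<Rightarrow> ('v \<Rightarrow> real) \<Rightarrow>
      ('e \<Rightarrow> real \<Rightarrow> complex) \<Rightarrow> ('e \<Rightarrow> real \<Rightarrow> complex) \<Rightarrow> complex" where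
  "schroedinger_form G len q \<sigma> f g =
     graph_integral G len
       (\<lambda>e x. weak_derivative (len e) (f e) x * cnj (weak_derivative (len e) (g e) x)) +
     graph_integral G len (\<lambda>e x. of_real (q e x) * (f e x * cnj (g e x))) +
     (\<Sum>v\<in>verts G. of_real (\<sigma> v) * (vertex_value G len f v * cnj (vertex_value G len g v)))"

lemma schroedinger_form_diagonal:
  "schroedinger_form G len q \<sigma> f f = of_real
     (graph_integral G len (\<lambda>e x. (cmod (weak_derivative (len e) (f e) x))\<^sup>2) +
      graph_integral G len (\<lambda>e x. q e x * (cmod (f e x))\<^sup>2) +
      (\<Sum>v\<in>verts G. \<sigma> v * (cmod (vertex_value G len f v))\<^sup>2))"
proof -
  have *: "graph_integral G len (\<lambda>e x. complex_of_real (h e x)) =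
      of_real (graph_integral G len h)" for h :: "'b \<Rightarrow> real \<Rightarrow> real"
    by (simp add: graph_integral_def)
  show ?thesis
    by (simp add: schroedinger_form_def complex_norm_square [symmetric] flip: * of_real_power of_real_mult)
qed

text \<open>
  The graph of the operator associated with the form: \<open>f\<close> is in the operator domain and is mapped
  to \<open>g\<close> (a representative modulo null sets).
\<close>

definition schroedinger_operator ::
    "('v, 'e) pre_digraph \<Rightarrow> ('e \<Rightarrow> real) \<Rightarrow> ('e \<Rightarrow> real \<Rightarrow> real) \<Rightarrow> ('v \<Rightarrow> real) \<Rightarrow>
      (('e \<Rightarrow> real \<Rightarrow> complex) \<times> ('e \<Rightarrow> real \<Rightarrow> complex)) set" where
  "schroedinger_operator G len q \<sigma> = {(f, g). f \<in> graph_H1 G len \<and> g \<in> graph_L2 G len \<and>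
     (\<forall>\<phi>\<in>graph_H1 G len. schroedinger_form G len q \<sigma> f \<phi> = graph_inner G len g \<phi>)}"

definition eigenspace ::
    "('v, 'e) pre_digraph \<Rightarrow> ('e \<Rightarrow> real) \<Rightarrow> ('e \<Rightarrow> real \<Rightarrow> real) \<Rightarrow> ('v \<Rightarrow> real) \<Rightarrow> real \<Rightarrow>
      ('e \<Rightarrow> real \<Rightarrow> complex) set" where
  "eigenspace G len q \<sigma> t =
     {f. (f, \<lambda>e x. of_real t * f e x) \<in> schroedinger_operator G len q \<sigma>}"

global_interpretation graph_fun:
  vector_space "\<lambda>(c::complex) (f::'e \<Rightarrow> real \<Rightarrow> complex) e x. c * f e x"
  defines graph_fun_dim = graph_fun.dim
  by unfold_locales (auto simp: fun_eq_iff algebra_simps)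

text \<open>
  Eigenvalues listed in nondecreasing order, each one as often as its multiplicity. Divergence
  makes all the sets \<open>{n. \<lambda> n = t}\<close> finite, so that their cardinalities are not spuriously zero.
\<close>

definition eigenvalue_enumeration ::
    "('v, 'e) pre_digraph \<Rightarrow> ('e \<Rightarrow> real) \<Rightarrow> ('e \<Rightarrow> real \<Rightarrow> real) \<Rightarrow> ('v \<Rightarrow> real) \<Rightarrow>
      (nat \<Rightarrow> real) \<Rightarrow> bool" where
  "eigenvalue_enumeration G len q \<sigma> ev \<longleftrightarrow>
     mono ev \<and> filterlim ev at_top sequentially \<and>
     (\<forall>t. card {n. ev n = t} = graph_fun_dim (eigenspace G len q \<sigma> t))"

lemma eigenvalue_enumeration_unique:
  assumes "eigenvalue_enumeration G len q \<sigma> ev" "eigenvalue_enumeration G len q \<sigma> ev'"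
  shows "ev = ev'"
proof (rule ccontr)
  have less: False
    if 1: "eigenvalue_enumeration G len q \<sigma> a" and 2: "eigenvalue_enumeration G len q \<sigma> b"
      and eq: "\<And>k. k < n \<Longrightarrow> a k = b k" and lt: "a n < b n" for a b n
  proof -
    have "b k \<noteq> a n" if "n \<le> k" for k
      using 2 lt that unfolding eigenvalue_enumeration_def by (metis leD monoD)
    then have "{k. b k = a n} \<subset> {k. a k = a n}"
      using eq by (auto simp: psubset_eq set_eq_iff) (metis not_le)
    moreover have "finite {k. a k = a n}"
    proof -
      have "eventually (\<lambda>k. a n < a k) sequentially"
        using 1 unfolding eigenvalue_enumeration_def filterlim_at_top_dense by blast
      then obtain N where "\<And>k. k \<ge> N \<Longrightarrow> a n < a k"
        unfolding eventually_sequentially by blast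
      then have "{k. a k = a n} \<subseteq> {..<N}"
        by (metis (mono_tags, lifting) lessThan_iff less_irrefl mem_Collect_eq not_le subsetI)
      then show ?thesis
        by (rule finite_subset) simp
    qed
    ultimately have "card {k. b k = a n} < card {k. a k = a n}"
      by (metis psubset_card_mono)
    then show False
      using 1 2 unfolding eigenvalue_enumeration_def by simp
  qed
  assume "ev \<noteq> ev'"
  then obtain n where n: "ev n \<noteq> ev' n" "\<And>k. k < n \<Longrightarrow> ev k = ev' k"
    using exists_least_iff [of "\<lambda>n. ev n \<noteq> ev' n"] by (auto simp: fun_eq_iff)
  show False
  proof (cases "ev n < ev' n")
    case True
    then show False
      using less [of ev ev' n] assms n by blast
  next
    case False
    then show False
      using less [of ev' ev n] assms n by force
  qed
qed

definition eigenvalue ::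
    "('v, 'e) pre_digraph \<Rightarrow> ('e \<Rightarrow> real) \<Rightarrow> ('e \<Rightarrow> real \<Rightarrow> real) \<Rightarrow> ('v \<Rightarrow> real) \<Rightarrow>
      nat \<Rightarrow> real" where
  "eigenvalue G len q \<sigma> = (THE ev. eigenvalue_enumeration G len q \<sigma> ev)"

end

theory Submission
  imports
    Defs
    "HOL-Complex_Analysis.Great_Picard"
    "HOL-Real_Asymp.Real_Asymp"
begin

text \<open>
  Isospectrality implies the inequality \<open>\<integral>q + 2 \<Sum>\<sigma>\<^sub>v / deg v \<le> 0\<close>. Together with any one of (i),
  (ii), (iii) it gives \<open>h(1) \<le> 0\<close> for the form \<open>h\<close> of the perturbed operator. Since the lowest
  eigenvalue is \<open>0\<close>, as for the unperturbed operator, \<open>h\<close> is nonnegative, so \<open>h(1, \<phi>) = 0\<close> for every \<open>\<phi>\<close> by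
  Cauchy-Schwarz, and suitable \<open>\<phi>\<close> show that \<open>q\<close> and \<open>\<sigma>\<close> vanish.

  For the inequality, let \<open>\<psi>\<^sub>n\<close> be the eigenfunctions of the perturbed operator and \<open>\<lambda>\<^sub>n\<close> the common
  eigenvalues. Ky Fan's principle for the unperturbed operator gives
  \<open>\<Sum>\<^sub>n\<^sub><\<^sub>N (\<lambda>\<^sub>n - \<parallel>\<psi>\<^sub>n'\<parallel>\<^sup>2) \<le> 0\<close> for every \<open>N\<close>, and by Abel summation this survives the decreasing
  weights \<open>(\<lambda>\<^sub>n + \<kappa>\<^sup>2)\<^sup>-\<^sup>2\<close>. Each summand is the integral of \<open>|\<psi>\<^sub>n|\<^sup>2\<close> against \<open>q\<close> plus the vertex
  terms, so it remains to find the behaviour of \<open>\<Sum>|\<psi>\<^sub>n(x)|\<^sup>2 / (\<lambda>\<^sub>n + \<kappa>\<^sup>2)\<^sup>2\<close> as \<open>\<kappa> \<rightarrow> \<infinity>\<close>: it is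
  asymptotic to \<open>\<kappa>\<^sup>-\<^sup>3 / 4\<close> inside the edges and to \<open>\<kappa>\<^sup>-\<^sup>3 / (2 deg v)\<close> at the vertices. To see this,
  the sequence \<open>\<psi>\<^sub>n(x) / (\<lambda>\<^sub>n + \<kappa>\<^sup>2)\<close> is compared in \<open>\<ell>\<^sup>2\<close> with the coefficients of explicit
  approximate Green functions built from hyperbolic sines, whose norms are known by Parseval.
\<close>

section \<open>Closed forms with compact resolvent\<close>

text \<open>\<open>eigenvalue\<close> is a definite description, so the hypothesis says nothing
  until an enumeration of the spectrum is exhibited. Hence a spectral theorem for abstract closed
  forms, applied to the perturbed and the unperturbed form on the same domain
  \<open>graph_H1\<close>. The weight is an inverse square because of the test with
  \<open>u\<close>, which is \<open>\<kappa>\<close> times a Green function of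
  \<open>-d^2/dx^2 + \<kappa>^2\<close> at \<open>x\<close>: it turns the eigenvalue equation into
  \<open>(\<lambda>_n + \<kappa>^2) <\<psi>_n, u> = \<kappa> \<psi>_n(x) + error\<close>. Up to the
  error, the weighted sum is \<open>\<kappa>^-2\<close> times the squared norm of \<open>u\<close>,
  an elementary integral. No resolvent kernel of the perturbed operator is built: \<open>q\<close>
  costs a relative error of order \<open>\<kappa>^-2\<close>, and the vertex conditions enter only
  through the values of \<open>\<psi>_n\<close> at the vertices. These are bounded by the same
  estimate, in which they reappear with a small factor and can be absorbed. Inside an edge the limit
  is not uniform near the end points; a separate uniform bound permits dominated convergence
  there.\<close>

locale hermitian_form = vector_space scale
  for scale :: "complex \<Rightarrow> 'a::ab_group_add \<Rightarrow> 'a" +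
  fixes U :: "'a set" and B :: "'a \<Rightarrow> 'a \<Rightarrow> complex"
  assumes subspace_dom: "subspace U"
    and add_left: "\<lbrakk>x \<in> U; y \<in> U; z \<in> U\<rbrakk> \<Longrightarrow> B (x + y) z = B x z + B y z"
    and scale_left: "\<lbrakk>x \<in> U; y \<in> U\<rbrakk> \<Longrightarrow> B (scale c x) y = c * B x y"
    and hermitian: "\<lbrakk>x \<in> U; y \<in> U\<rbrakk> \<Longrightarrow> B y x = cnj (B x y)"
begin

abbreviation Q :: "'a \<Rightarrow> real" where "Q x \<equiv> Re (B x x)"

lemma dom_closed [simp, intro]:
  "0 \<in> U" "x \<in> U \<Longrightarrow> y \<in> U \<Longrightarrow> x + y \<in> U" "x \<in> U \<Longrightarrow> y \<in> U \<Longrightarrow> x - y \<in> U"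
  "x \<in> U \<Longrightarrow> scale c x \<in> U" "x \<in> U \<Longrightarrow> - x \<in> U"
  using subspace_dom by (auto intro: subspace_0 subspace_add subspace_diff subspace_scale subspace_neg)

lemma sum_dom [intro]: "(\<And>i. i \<in> A \<Longrightarrow> f i \<in> U) \<Longrightarrow> sum f A \<in> U"
  using subspace_dom by (rule subspace_sum)

lemma minus_left: "\<lbrakk>x \<in> U; y \<in> U\<rbrakk> \<Longrightarrow> B (- x) y = - B x y"
  using scale_left [of x y "-1"] by simp

lemma diff_left: "\<lbrakk>x \<in> U; y \<in> U; z \<in> U\<rbrakk> \<Longrightarrow> B (x - y) z = B x z - B y z"
  using add_left [of x "- y" z] minus_left [of y z] by simp

lemma zero_left [simp]: "y \<in> U \<Longrightarrow> B 0 y = 0"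
  using scale_left [of 0 y 0] by simp

lemma zero_right [simp]: "y \<in> U \<Longrightarrow> B y 0 = 0"
  using hermitian [of 0 y] by simp

lemma add_right: "\<lbrakk>x \<in> U; y \<in> U; z \<in> U\<rbrakk> \<Longrightarrow> B x (y + z) = B x y + B x z"
  using hermitian [of "y + z" x] hermitian [of y x] hermitian [of z x] add_left [of y z x] by simp

lemma diff_right: "\<lbrakk>x \<in> U; y \<in> U; z \<in> U\<rbrakk> \<Longrightarrow> B x (y - z) = B x y - B x z"
  using hermitian [of "y - z" x] hermitian [of y x] hermitian [of z x] diff_left [of y z x] by simp

lemma scale_right: "\<lbrakk>x \<in> U; y \<in> U\<rbrakk> \<Longrightarrow> B x (scale c y) = cnj c * B x y"
  using hermitian [of "scale c y" x] hermitian [of y x] scale_left [of y x c] by simp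

lemma sum_left: "\<lbrakk>\<And>i. i \<in> A \<Longrightarrow> f i \<in> U; y \<in> U\<rbrakk> \<Longrightarrow> B (sum f A) y = (\<Sum>i\<in>A. B (f i) y)"
proof (induction A rule: infinite_finite_induct)
  case (insert a A)
  then have "sum f A \<in> U" by blast
  with insert show ?case by (simp add: add_left)
qed auto

lemma sum_right: "\<lbrakk>\<And>i. i \<in> A \<Longrightarrow> f i \<in> U; y \<in> U\<rbrakk> \<Longrightarrow> B y (sum f A) = (\<Sum>i\<in>A. B y (f i))"
proof (induction A rule: infinite_finite_induct)
  case (insert a A)
  then have "sum f A \<in> U" by blast
  with insert show ?case by (simp add: add_right)
qed auto

lemma self_eqI: "\<lbrakk>x \<in> U; Q x = r\<rbrakk> \<Longrightarrow> B x x = of_real r"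
  using hermitian [of x x] by (simp add: complex_eq_iff)

lemma Q_add: "\<lbrakk>x \<in> U; y \<in> U\<rbrakk> \<Longrightarrow> Q (x + y) = Q x + Q y + 2 * Re (B x y)"
  using hermitian [of x y] by (simp add: add_left add_right)

lemma Q_diff: "\<lbrakk>x \<in> U; y \<in> U\<rbrakk> \<Longrightarrow> Q (x - y) = Q x + Q y - 2 * Re (B x y)"
  using hermitian [of x y] by (simp add: diff_left diff_right)

lemma Q_scale: "x \<in> U \<Longrightarrow> Q (scale c x) = (cmod c)\<^sup>2 * Q x"
proof -
  assume x: "x \<in> U"
  have "B (scale c x) (scale c x) = (c * cnj c) * B x x"
    using x by (simp add: scale_left scale_right)
  also have "\<dots> = of_real ((cmod c)\<^sup>2 * Q x)"
    using self_eqI [OF x refl] complex_norm_square [of c] by (metis of_real_mult)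
  finally show ?thesis by (metis Re_complex_of_real)
qed

lemma parallelogram: "\<lbrakk>x \<in> U; y \<in> U\<rbrakk> \<Longrightarrow> Q (x + y) + Q (x - y) = 2 * Q x + 2 * Q y"
  by (simp add: Q_add Q_diff)

text \<open>Only semidefiniteness is assumed. A form that vanishes at a nonzero \<open>x\<close>
  then satisfies \<open>B x y = 0\<close> for every \<open>y\<close>; this is how the lemma is used
  for \<open>h - \<mu> ip\<close> at a minimizer and for \<open>h\<close> at the constant
  function.\<close>

lemma Cauchy_Schwarz:
  assumes nonneg: "\<And>x. x \<in> U \<Longrightarrow> 0 \<le> Q x" and x: "x \<in> U" and y: "y \<in> U"
  shows "(cmod (B x y))\<^sup>2 \<le> Q x * Q y"
proof -
  \<comment> \<open>Positivity at \<open>x - t B(x,y) y\<close>. The factor \<open>B x y\<close>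
    aligns the phases, so a real parameter \<open>t\<close> is enough.\<close>
  have key: "0 \<le> Q x - 2 * t * (cmod (B x y))\<^sup>2 + t\<^sup>2 * (cmod (B x y))\<^sup>2 * Q y" for t :: real
  proof -
    have "0 \<le> Q (x - scale (of_real t * B x y) y)"
      using x y by (intro nonneg) auto
    also have "\<dots> = Q x + (cmod (of_real t * B x y))\<^sup>2 * Q y - 2 * Re (cnj (of_real t * B x y) * B x y)"
      using x y Q_scale [OF y, of "of_real t * B x y"] by (simp only: Q_diff dom_closed scale_right)
    also have "cnj (of_real t * B x y) * B x y = of_real (t * (cmod (B x y))\<^sup>2)"
      using complex_norm_square [of "B x y"] by (simp add: mult_ac)
    also have "Re \<dots> = t * (cmod (B x y))\<^sup>2"
      by (rule Re_complex_of_real)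
    finally show ?thesis
      by (simp add: norm_mult power_mult_distrib mult_ac)
  qed
  show ?thesis
  proof (cases "Q y = 0")
    case True
    show ?thesis
    proof (rule ccontr)
      assume "\<not> ?thesis"
      with True have "(cmod (B x y))\<^sup>2 > 0" by simp
      \<comment> \<open>With \<open>Q y = 0\<close> the bound \<open>key\<close> is affine in
        \<open>t\<close>; for the chosen \<open>t\<close> it reads
        \<open>0 \<le> -1\<close>.\<close>
      then show False
        using key [of "(Q x + 1) / (2 * (cmod (B x y))\<^sup>2)"] True by simp
    qed
  next
    case False
    then have "Q y > 0" using nonneg [OF y] by simp
    with key [of "1 / Q y"] show ?thesis
      by (simp add: field_simps power2_eq_square)
  qed
qed

text \<open>The shifted form \<open>h - \<mu> ip\<close> is nonnegative only on an orthogonal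
  complement, so Cauchy-Schwarz is needed for the restricted form.\<close>

lemma hermitian_form_restrict:
  assumes "subspace U'" "U' \<subseteq> U"
  shows "hermitian_form scale U' B"
  using assms by unfold_locales (auto intro: add_left scale_left hermitian)

end

text \<open>
  \<open>W\<close> plays the role of \<open>L\<^sup>2\<close> and \<open>V\<close> that of the form domain. Only \<open>V\<close> has to be complete, and
  only for the form norm.
\<close>

locale closed_form = vector_space scale + ip: hermitian_form scale W ip + h: hermitian_form scale V h
  for scale :: "complex \<Rightarrow> 'a::ab_group_add \<Rightarrow> 'a" and W ip V h +
  fixes C :: real
  assumes V_W: "V \<subseteq> W"
    and ip_nonneg: "x \<in> W \<Longrightarrow> 0 \<le> Re (ip x x)"
    and ip_definite: "x \<in> V \<Longrightarrow> Re (ip x x) = 0 \<Longrightarrow> x = 0"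
    and lower_bound: "x \<in> V \<Longrightarrow> - C * Re (ip x x) \<le> Re (h x x)"
    and compact_embedding: "\<lbrakk>\<And>n. f n \<in> V; \<And>n. Re (ip (f n) (f n)) \<le> K; \<And>n. Re (h (f n) (f n)) \<le> K\<rbrakk> \<Longrightarrow>
      \<exists>r::nat \<Rightarrow> nat. strict_mono r \<and> (\<forall>e>0. \<exists>N. \<forall>m\<ge>N. \<forall>n\<ge>N.
        Re (ip (f (r m) - f (r n)) (f (r m) - f (r n))) < e)"
    and closed: "\<lbrakk>\<And>n. f n \<in> V;
      \<And>e. e > 0 \<Longrightarrow> \<exists>N. \<forall>m\<ge>N. \<forall>n\<ge>N. Re (ip (f m - f n) (f m - f n)) < e \<and> Re (h (f m - f n) (f m - f n)) < e\<rbrakk> \<Longrightarrow>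
      \<exists>x\<in>V. (\<lambda>n. Re (ip (f n - x) (f n - x))) \<longlonglongrightarrow> 0 \<and> (\<lambda>n. Re (h (f n - x) (f n - x))) \<longlonglongrightarrow> 0"
    and unbounded: "\<exists>x\<in>V. K * Re (ip x x) < Re (h x x)"
begin

lemma V_in_W [simp, intro]: "x \<in> V \<Longrightarrow> x \<in> W"
  using V_W by blast

section \<open>Minimizers of the Rayleigh quotient on orthogonal complements\<close>

definition orth :: "'a set \<Rightarrow> 'a set" where
  "orth F = {y \<in> V. \<forall>z\<in>F. ip y z = 0}"

lemma orth_V: "y \<in> orth F \<Longrightarrow> y \<in> V"
  by (simp add: orth_def)

lemma subspace_orth: "F \<subseteq> V \<Longrightarrow> subspace (orth F)"
  unfolding orth_def subspace_def by (auto simp: ip.add_left ip.scale_left subset_iff)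

lemma hermitian_shift: "hermitian_form scale V (\<lambda>x y. h x y - of_real t * ip x y)"
proof unfold_locales
  show "h y x - of_real t * ip y x = cnj (h x y - of_real t * ip x y)" if "x \<in> V" "y \<in> V" for x y
    using h.hermitian [OF that] ip.hermitian [of x y] that by simp
qed (use h.subspace_dom in \<open>auto simp: h.add_left ip.add_left h.scale_left ip.scale_left algebra_simps\<close>)

lemma Re_shift: "x \<in> V \<Longrightarrow> Re (h x x - of_real t * ip x x) = Re (h x x) - t * Re (ip x x)"
  by simp

definition minimizer :: "'a set \<Rightarrow> 'a \<Rightarrow> bool" where
  "minimizer F x \<longleftrightarrow> x \<in> orth F \<and> ip x x = 1 \<and>
     (\<forall>y\<in>orth F. Re (h x x) * Re (ip y y) \<le> Re (h y y))"

text \<open>Direct method. A minimizing sequence on the unit sphere has an \<open>ip\<close>-Cauchy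
  subsequence by compactness. The parallelogram identity upgrades it to a Cauchy sequence for the
  form norm, so completeness of \<open>V\<close> yields a strong limit and weak convergence never
  appears.\<close>

lemma minimizer_exists:
  assumes F: "F \<subseteq> V" and y: "y \<in> orth F" "y \<noteq> 0"
  shows "\<exists>x. minimizer F x"
proof -
  define X where "X = {x \<in> orth F. ip x x = 1}"
  define \<mu> where "\<mu> = Inf ((\<lambda>x. Re (h x x)) ` X)"
  interpret B: hermitian_form scale V "\<lambda>x y. h x y - of_real \<mu> * ip x y"
    by (rule hermitian_shift)
  have O: "subspace (orth F)" using F by (rule subspace_orth)
  have normalize: "scale (of_real (1 / sqrt (Re (ip z z)))) z \<in> X" if "z \<in> orth F" "z \<noteq> 0" for z
  proof -
    have zV: "z \<in> V" using that orth_V by blast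
    then have "Re (ip z z) > 0"
      using ip_nonneg [of z] ip_definite [of z] that by force
    then have "Re (ip (scale (of_real (1 / sqrt (Re (ip z z)))) z) (scale (of_real (1 / sqrt (Re (ip z z)))) z)) = 1"
      using zV by (subst ip.Q_scale) (auto simp: norm_divide power_divide)
    moreover have "scale (of_real (1 / sqrt (Re (ip z z)))) z \<in> orth F"
      using O that by (simp add: subspace_scale)
    ultimately show ?thesis
      unfolding X_def using ip.self_eqI [of "scale (of_real (1 / sqrt (Re (ip z z)))) z" 1] orth_V by auto
  qed
  have X: "x \<in> X \<Longrightarrow> x \<in> V" "x \<in> X \<Longrightarrow> x \<in> orth F" "x \<in> X \<Longrightarrow> Re (ip x x) = 1" for x
    by (auto simp: X_def orth_V)
  have "X \<noteq> {}" using normalize [OF y] by blast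
  have bdd: "bdd_below ((\<lambda>x. Re (h x x)) ` X)"
    using lower_bound [OF X(1)] X(3) by (intro bdd_belowI2 [of _ "- C"]) simp
  have inf: "\<mu> \<le> Re (h x x)" if "x \<in> X" for x
    unfolding \<mu>_def using bdd that by (intro cInf_lower) auto
  have below: "\<mu> * Re (ip z z) \<le> Re (h z z)" if z: "z \<in> orth F" for z
  proof (cases "z = 0")
    case True then show ?thesis by simp
  next
    case False
    have zV: "z \<in> V" using z orth_V by blast
    have pos: "Re (ip z z) > 0"
      using ip_nonneg [of z] ip_definite [of z] zV False by force
    have "\<mu> \<le> Re (h z z) / Re (ip z z)"
      using inf [OF normalize [OF z False]] pos zV by (simp add: h.Q_scale norm_divide power_divide)
    then show ?thesis using pos by (simp add: field_simps)
  qed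
  have "\<exists>x\<in>X. Re (h x x) < \<mu> + 1 / Suc n" for n
  proof -
    have "Inf ((\<lambda>x. Re (h x x)) ` X) < \<mu> + 1 / Suc n"
      unfolding \<mu>_def by simp
    then show ?thesis
      using cInf_lessD [of "(\<lambda>x. Re (h x x)) ` X"] \<open>X \<noteq> {}\<close> by blast
  qed
  then obtain g where g: "\<And>n. g n \<in> X" "\<And>n. Re (h (g n) (g n)) < \<mu> + 1 / Suc n"
    by metis
  have gb: "Re (ip (g n) (g n)) \<le> max 1 (\<mu> + 1)" "Re (h (g n) (g n)) \<le> max 1 (\<mu> + 1)" for n
  proof -
    have "1 / real (Suc n) \<le> 1" by simp
    then show "Re (h (g n) (g n)) \<le> max 1 (\<mu> + 1)" using g(2) [of n] by linarith
  qed (use g(1) X in auto)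
  obtain r :: "nat \<Rightarrow> nat" where r: "strict_mono r"
    and rC: "\<And>e. e > 0 \<Longrightarrow> \<exists>N. \<forall>m\<ge>N. \<forall>n\<ge>N. Re (ip (g (r m) - g (r n)) (g (r m) - g (r n))) < e"
    using compact_embedding [where f = g, OF X(1) [OF g(1)] gb] by blast
  define f where "f n = g (r n)" for n
  have fX: "f n \<in> X" for n using g by (simp add: f_def)
  have fV: "f n \<in> V" for n using fX X by blast
  have hf: "Re (h (f n) (f n)) < \<mu> + 1 / Suc n" for n
  proof -
    have "1 / real (Suc (r n)) \<le> 1 / Suc n"
      using seq_suble [OF r, of n] by (simp add: frac_le)
    then show ?thesis using g(2) [of "r n"] by (simp add: f_def)
  qed
  (* parallelogram identity for the nonnegative form h - \<mu> ip on the orthogonal complement *)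
  have dist_h: "Re (h (f m - f n) (f m - f n)) \<le> 2 / Suc m + 2 / Suc n + \<mu> * Re (ip (f m - f n) (f m - f n))" for m n
  proof -
    have sum: "f m + f n \<in> orth F" using O fX X by (simp add: subspace_add)
    have "B.Q (f m - f n) \<le> 2 * B.Q (f m) + 2 * B.Q (f n)"
      using B.parallelogram [of "f m" "f n"] below [OF sum] fV by (simp add: Re_shift)
    then show ?thesis
      using hf [of m] hf [of n] X(3) [OF fX] fV by (simp add: Re_shift)
  qed
  have "\<exists>N. \<forall>m\<ge>N. \<forall>n\<ge>N. Re (ip (f m - f n) (f m - f n)) < e \<and> Re (h (f m - f n) (f m - f n)) < e" if "e > 0" for e
  proof -
    \<comment> \<open>Each of the three summands in \<open>dist_h\<close> receives a budget of
      \<open>e / 4\<close>; the \<open>+ 1\<close> keeps the denominator positive when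
      \<open>\<mu> = 0\<close>.\<close>
    obtain N1 where N1: "\<And>m n. m \<ge> N1 \<Longrightarrow> n \<ge> N1 \<Longrightarrow> Re (ip (f m - f n) (f m - f n)) < min e (e / (4 * (\<bar>\<mu>\<bar> + 1)))"
    proof -
      have "0 < e / (4 * (\<bar>\<mu>\<bar> + 1))"
        using \<open>e > 0\<close> by (intro divide_pos_pos mult_pos_pos add_nonneg_pos) auto
      then have "0 < min e (e / (4 * (\<bar>\<mu>\<bar> + 1)))" using \<open>e > 0\<close> by simp
      from rC [OF this] show ?thesis using that unfolding f_def by metis
    qed
    obtain N2 :: nat where N2: "N2 > 8 / e" using reals_Archimedean2 by blast
    have "Re (h (f m - f n) (f m - f n)) < e" if mn: "m \<ge> max N1 N2" "n \<ge> max N1 N2" for m n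
    proof -
      have small: "2 / Suc k < e / 4" if "k \<ge> N2" for k
      proof -
        have "8 / e < Suc k" using N2 that by linarith
        then show ?thesis using \<open>e > 0\<close> by (simp add: field_simps)
      qed
      have "\<mu> * Re (ip (f m - f n) (f m - f n)) \<le> (\<bar>\<mu>\<bar> + 1) * Re (ip (f m - f n) (f m - f n))"
        using fV by (intro mult_right_mono ip_nonneg) auto
      also have "\<dots> \<le> (\<bar>\<mu>\<bar> + 1) * (e / (4 * (\<bar>\<mu>\<bar> + 1)))"
        using N1 [of m n] mn by (intro mult_left_mono) auto
      also have "\<dots> = e / 4" by (simp add: field_simps)
      finally show ?thesis
        using dist_h [of m n] small [of m] small [of n] mn \<open>e > 0\<close> by simp
    qed
    then show ?thesis
      using N1 by (intro exI [of _ "max N1 N2"]) auto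
  qed
  then obtain x where x: "x \<in> V" "(\<lambda>n. Re (ip (f n - x) (f n - x))) \<longlonglongrightarrow> 0" "(\<lambda>n. Re (h (f n - x) (f n - x))) \<longlonglongrightarrow> 0"
    using closed [of f, OF fV] by blast
  have ip_lim: "(\<lambda>n. ip (f n) z) \<longlonglongrightarrow> ip x z" if "z \<in> V" for z
  proof -
    have "(\<lambda>n. sqrt (Re (ip (f n - x) (f n - x)) * Re (ip z z))) \<longlonglongrightarrow> sqrt (0 * Re (ip z z))"
      by (intro tendsto_intros x)
    then have 1: "(\<lambda>n. sqrt (Re (ip (f n - x) (f n - x)) * Re (ip z z))) \<longlonglongrightarrow> 0" by simp
    have 2: "cmod (ip (f n) z - ip x z) \<le> sqrt (Re (ip (f n - x) (f n - x)) * Re (ip z z))" for n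
      using ip.Cauchy_Schwarz [OF ip_nonneg, of "f n - x" z] fV x that
      by (intro real_le_rsqrt) (simp add: ip.diff_left)
    have "(\<lambda>n. ip (f n) z - ip x z) \<longlonglongrightarrow> 0"
      using 2 by (intro Lim_null_comparison [OF always_eventually 1] allI)
    then show ?thesis by (simp add: LIM_zero_iff)
  qed
  have xO: "x \<in> orth F"
  proof -
    have "ip x z = 0" if "z \<in> F" for z
    proof -
      have "ip (f n) z = 0" for n using X(2) [OF fX] that by (auto simp: orth_def)
      then show ?thesis using ip_lim [of z] F that by (simp add: LIMSEQ_const_iff subset_iff)
    qed
    then show ?thesis using x by (simp add: orth_def)
  qed
  have "(\<lambda>n. Re (ip (f n - x) (f n - x))) \<longlonglongrightarrow> 1 + Re (ip x x) - 2 * Re (ip x x)"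
  proof -
    have eq: "Re (ip (f n - x) (f n - x)) = 1 + Re (ip x x) - 2 * Re (ip (f n) x)" for n
      using ip.Q_diff [of "f n" x] fV X(3) [OF fX] x by simp
    show ?thesis unfolding eq by (intro tendsto_intros ip_lim x)
  qed
  then have ipx: "Re (ip x x) = 1"
    using LIMSEQ_unique [OF x(2)] by fastforce
  then have xX: "x \<in> X" unfolding X_def using xO ip.self_eqI [of x 1] ipx x by simp
  (* Cauchy-Schwarz for h - \<mu> ip *)
  have "Re (h x x) \<le> \<mu>"
  proof -
    have le: "B.Q x \<le> 2 * (1 / Suc n) + 2 * B.Q (f n - x)" for n
    proof -
      have 1: "f n + (f n - x) \<in> orth F" and 2: "f n - x \<in> V"
        using subspace_add [OF O X(2) [OF fX] subspace_diff [OF O X(2) [OF fX] xO]] fV x by auto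
      have "B.Q (f n - (f n - x)) \<le> 2 * B.Q (f n) + 2 * B.Q (f n - x)"
        using B.parallelogram [OF fV [of n] 2] below [OF 1] fV x by (simp add: Re_shift)
      then show ?thesis using hf [of n] X(3) [OF fX] fV by (simp add: Re_shift)
    qed
    have "(\<lambda>n. 2 * (1 / real (Suc n)) + 2 * (Re (h (f n - x) (f n - x)) - \<mu> * Re (ip (f n - x) (f n - x)))) \<longlonglongrightarrow> 2 * 0 + 2 * (0 - \<mu> * 0)"
      by (intro tendsto_intros x LIMSEQ_Suc [OF lim_1_over_n])
    then have "B.Q x \<le> 2 * 0 + 2 * (0 - \<mu> * 0)"
      by (rule LIMSEQ_le_const) (use le fV x in \<open>auto simp: Re_shift\<close>)
    then show ?thesis using ipx x by (simp add: Re_shift)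
  qed
  then have "Re (h x x) = \<mu>" using inf [OF xX] by simp
  then have "minimizer F x" unfolding minimizer_def using xX below by (auto simp: X_def)
  then show ?thesis ..
qed

text \<open>The Euler-Lagrange equation without differentiation: \<open>h - \<mu> ip\<close> is
  semidefinite on the complement and vanishes at \<open>x\<close>, so Cauchy-Schwarz makes it vanish
  at every pair \<open>x\<close>, \<open>y\<close>.\<close>

lemma minimizer_orth_eq:
  assumes F: "F \<subseteq> V" and x: "minimizer F x" and y: "y \<in> orth F"
  shows "h x y = of_real (Re (h x x)) * ip x y"
proof -
  define \<mu> where "\<mu> = Re (h x x)"
  interpret B: hermitian_form scale V "\<lambda>x y. h x y - of_real \<mu> * ip x y"
    by (rule hermitian_shift)
  interpret B': hermitian_form scale "orth F" "\<lambda>x y. h x y - of_real \<mu> * ip x y"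
    using F by (intro B.hermitian_form_restrict subspace_orth) (auto simp: orth_def)
  have xx: "x \<in> orth F" "ip x x = 1" and min: "\<And>z. z \<in> orth F \<Longrightarrow> \<mu> * Re (ip z z) \<le> Re (h z z)"
    using x by (auto simp: minimizer_def \<mu>_def)
  have "(cmod (h x y - of_real \<mu> * ip x y))\<^sup>2 \<le> B.Q x * B.Q y"
    by (rule B'.Cauchy_Schwarz) (use min xx y orth_V Re_shift in auto)
  also have "B.Q x = 0" using xx orth_V by (auto simp: Re_shift \<mu>_def)
  finally show ?thesis by (simp add: \<mu>_def)
qed

lemma projection_orth:
  assumes F: "finite F" "F \<subseteq> V" and on: "\<And>z z'. z \<in> F \<Longrightarrow> z' \<in> F \<Longrightarrow> ip z z' = (if z = z' then 1 else 0)"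
    and y: "y \<in> V"
  shows "y - (\<Sum>z\<in>F. scale (ip y z) z) \<in> orth F"
proof -
  define p where "p = (\<Sum>z\<in>F. scale (ip y z) z)"
  have FV: "z \<in> F \<Longrightarrow> z \<in> V" for z using F by blast
  have p: "p \<in> V" unfolding p_def using FV by auto
  have "ip p z = ip y z" if "z \<in> F" for z
  proof -
    have "ip p z = (\<Sum>z'\<in>F. ip y z' * ip z' z)"
      unfolding p_def using FV that by (subst ip.sum_left) (auto simp: ip.scale_left)
    also have "\<dots> = (\<Sum>z'\<in>F. if z' = z then ip y z' else 0)"
      by (intro sum.cong refl) (use on that in auto)
    also have "\<dots> = ip y z" using F that by simp
    finally show ?thesis .
  qed
  then show ?thesis
    unfolding orth_def p_def [symmetric] using y p FV by (auto simp: ip.diff_left)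
qed

text \<open>The equation extends from the complement to \<open>V\<close>, since on the earlier
  eigenvectors both sides vanish: \<open>ip x z = 0\<close> by construction, and
  \<open>h x z\<close> is conjugate to a multiple of \<open>ip z x\<close>.\<close>

lemma minimizer_eigen:
  assumes F: "finite F" "F \<subseteq> V" and on: "\<And>z z'. z \<in> F \<Longrightarrow> z' \<in> F \<Longrightarrow> ip z z' = (if z = z' then 1 else 0)"
    and eig: "\<And>z y. z \<in> F \<Longrightarrow> y \<in> V \<Longrightarrow> h z y = of_real (l z) * ip z y"
    and x: "minimizer F x" and y: "y \<in> V"
  shows "h x y = of_real (Re (h x x)) * ip x y"
proof -
  define p where "p = (\<Sum>z\<in>F. scale (ip y z) z)"
  have FV: "z \<in> F \<Longrightarrow> z \<in> V" for z using F by blast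
  have p: "p \<in> V" unfolding p_def using FV by auto
  have r: "y - p \<in> orth F" unfolding p_def by (rule projection_orth [OF F on y])
  have xV: "x \<in> V" and xz: "\<And>z. z \<in> F \<Longrightarrow> ip x z = 0"
    using x by (auto simp: minimizer_def orth_def)
  have ipp: "ip x p = 0"
    unfolding p_def using FV xV xz by (subst ip.sum_right) (auto simp: ip.scale_right)
  have "h x z = 0" if "z \<in> F" for z
    using h.hermitian [of z x] ip.hermitian [of x z] eig [of z x] that FV xV xz by simp
  then have hp: "h x p = 0"
    unfolding p_def using FV xV by (subst h.sum_right) (auto simp: h.scale_right)
  have "h x y = h x (y - p) + h x p" "ip x y = ip x (y - p) + ip x p"
    using xV y p by (auto simp: h.diff_right ip.diff_right)
  then show ?thesis using minimizer_orth_eq [OF F(2) x r] ipp hp by simp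
qed

text \<open>If the eigenvectors found so far spanned \<open>V\<close>, then \<open>h\<close> would be bounded.\<close>

lemma orth_nontrivial:
  assumes F: "finite F" "F \<subseteq> V" and on: "\<And>z z'. z \<in> F \<Longrightarrow> z' \<in> F \<Longrightarrow> ip z z' = (if z = z' then 1 else 0)"
    and eig: "\<And>z y. z \<in> F \<Longrightarrow> y \<in> V \<Longrightarrow> h z y = of_real (l z) * ip z y"
  shows "\<exists>y\<in>orth F. y \<noteq> 0"
proof (rule ccontr)
  assume triv: "\<not> ?thesis"
  \<comment> \<open>Any bound for the finitely many \<open>l z\<close> would serve; the sum also
    covers the empty set.\<close>
  define K where "K = (\<Sum>z\<in>F. \<bar>l z\<bar>)"
  obtain y where y: "y \<in> V" "K * Re (ip y y) < Re (h y y)" using unbounded by blast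
  define p where "p = (\<Sum>z\<in>F. scale (ip y z) z)"
  have FV: "z \<in> F \<Longrightarrow> z \<in> V" for z using F by blast
  have p: "p \<in> V" unfolding p_def using FV by auto
  have "y - p \<in> orth F" unfolding p_def by (rule projection_orth [OF F on y(1)])
  then have yp: "y = p" using triv by auto
  have sq: "ip y z * ip z y = of_real ((cmod (ip y z))\<^sup>2)" if "z \<in> F" for z
    using ip.hermitian [of y z] complex_norm_square [of "ip y z"] FV that y by simp
  have "ip p y = (\<Sum>z\<in>F. ip y z * ip z y)"
    unfolding p_def using FV y by (subst ip.sum_left) (auto simp: ip.scale_left)
  then have ipy: "Re (ip y y) = (\<Sum>z\<in>F. (cmod (ip y z))\<^sup>2)"
    using sq yp by (simp flip: of_real_sum)
  have "h p y = (\<Sum>z\<in>F. ip y z * (of_real (l z) * ip z y))"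
    unfolding p_def using FV y eig by (subst h.sum_left) (auto simp: h.scale_left)
  also have "\<dots> = (\<Sum>z\<in>F. of_real (l z * (cmod (ip y z))\<^sup>2))"
    using sq by (intro sum.cong refl) (auto simp: algebra_simps)
  finally have "Re (h y y) = (\<Sum>z\<in>F. l z * (cmod (ip y z))\<^sup>2)"
    using yp by (simp flip: of_real_sum)
  also have "\<dots> \<le> (\<Sum>z\<in>F. K * (cmod (ip y z))\<^sup>2)"
  proof (intro sum_mono mult_right_mono)
    fix z assume "z \<in> F"
    then have "\<bar>l z\<bar> \<le> K" unfolding K_def using F by (intro member_le_sum) auto
    then show "l z \<le> K" by linarith
  qed auto
  also have "\<dots> = K * Re (ip y y)" by (simp add: ipy sum_distrib_left)
  finally show False using y by simp
qed

section \<open>Successive choice of the eigenvectors\<close>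

primrec eigset :: "nat \<Rightarrow> 'a set" where
  "eigset 0 = {}"
| "eigset (Suc n) = insert (SOME x. minimizer (eigset n) x) (eigset n)"

definition eigvec :: "nat \<Rightarrow> 'a" where
  "eigvec n = (SOME x. minimizer (eigset n) x)"

definition eigval :: "nat \<Rightarrow> real" where
  "eigval n = Re (h (eigvec n) (eigvec n))"

lemma eigset_eq: "eigset n = eigvec ` {..<n}"
  by (induction n) (auto simp: eigvec_def lessThan_Suc)

text \<open>The facts must be carried through the induction together: the next minimizer exists only
  because the previous ones are orthonormal eigenvectors, which cannot span the domain of an
  unbounded form.\<close>

lemma eigset_props:
  "eigset n \<subseteq> V \<and> (\<forall>z\<in>eigset n. \<forall>z'\<in>eigset n. ip z z' = (if z = z' then 1 else 0)) \<and>
   (\<forall>z\<in>eigset n. \<forall>y\<in>V. h z y = of_real (Re (h z z)) * ip z y) \<and> minimizer (eigset n) (eigvec n)"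
proof (induction n)
  case 0
  have "\<exists>y\<in>orth {}. y \<noteq> 0" by (rule orth_nontrivial [where l = "\<lambda>_. 0"]) auto
  then show ?case using minimizer_exists [of "{}"] unfolding eigvec_def by (auto intro: someI_ex)
next
  case (Suc n)
  let ?F = "eigset n" and ?x = "eigvec n"
  have Suc_eq: "eigset (Suc n) = insert ?x ?F" by (simp add: eigvec_def)
  have fin: "finite ?F" by (simp add: eigset_eq)
  have min: "minimizer ?F ?x" and FV: "?F \<subseteq> V"
    and on: "\<And>z z'. z \<in> ?F \<Longrightarrow> z' \<in> ?F \<Longrightarrow> ip z z' = (if z = z' then 1 else 0)"
    and eig: "\<And>z y. z \<in> ?F \<Longrightarrow> y \<in> V \<Longrightarrow> h z y = of_real (Re (h z z)) * ip z y"
    using Suc by blast+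
  have x: "?x \<in> V" "ip ?x ?x = 1" "\<And>z. z \<in> ?F \<Longrightarrow> ip ?x z = 0"
    using min by (auto simp: minimizer_def orth_def)
  have FV': "eigset (Suc n) \<subseteq> V" using FV x Suc_eq by auto
  have x': "ip z ?x = 0" if "z \<in> ?F" for z
    using ip.hermitian [of ?x z] x that FV by auto
  have on': "ip z z' = (if z = z' then 1 else 0)" if "z \<in> eigset (Suc n)" "z' \<in> eigset (Suc n)" for z z'
    using that x x' on unfolding Suc_eq by auto
  have eig': "h z y = of_real (Re (h z z)) * ip z y" if "z \<in> eigset (Suc n)" "y \<in> V" for z y
    using that minimizer_eigen [OF fin FV on eig min] eig unfolding Suc_eq by auto
  have "\<exists>y\<in>orth (eigset (Suc n)). y \<noteq> 0"
    using fin FV' on' eig' by (intro orth_nontrivial [where l = "\<lambda>z. Re (h z z)"]) (auto simp: Suc_eq simp del: eigset.simps)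
  then have "minimizer (eigset (Suc n)) (eigvec (Suc n))"
    using minimizer_exists [OF FV'] unfolding eigvec_def by (auto intro: someI_ex simp del: eigset.simps)
  then show ?case using FV' on' eig' by blast
qed

lemma eigvec_V [simp, intro]: "eigvec n \<in> V"
  using eigset_props [of n] by (auto simp: minimizer_def orth_def)

lemma eigvec_min: "\<lbrakk>y \<in> V; \<And>k. k < n \<Longrightarrow> ip y (eigvec k) = 0\<rbrakk> \<Longrightarrow> eigval n * Re (ip y y) \<le> Re (h y y)"
  using eigset_props [of n] by (auto simp: minimizer_def orth_def eigset_eq eigval_def)

lemma eigvec_orthonormal: "ip (eigvec m) (eigvec n) = (if m = n then 1 else 0)"
proof -
  have lt: "ip (eigvec m) (eigvec n) = 0" if "n < m" for m n
    using eigset_props [of m] that by (auto simp: minimizer_def orth_def eigset_eq)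
  moreover have "ip (eigvec n) (eigvec n) = 1"
    using eigset_props [of n] by (auto simp: minimizer_def)
  ultimately show ?thesis
    using ip.hermitian [of "eigvec n" "eigvec m"] lt [of n m] lt [of m n] by (cases m n rule: linorder_cases) auto
qed

lemma eigvec_eigen: "y \<in> V \<Longrightarrow> h (eigvec n) y = of_real (eigval n) * ip (eigvec n) y"
  using eigset_props [of "Suc n"] unfolding eigset_eq eigval_def by blast

lemma eigval_mono: "mono eigval"
proof (rule incseq_SucI)
  fix n
  show "eigval n \<le> eigval (Suc n)"
    using eigvec_min [of "eigvec (Suc n)" n] by (simp add: eigvec_orthonormal eigval_def)
qed

text \<open>Along a bounded sequence of eigenvalues the compact embedding would provide an
  \<open>ip\<close>-Cauchy subsequence of eigenvectors, but distinct orthonormal vectors have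
  squared distance 2.\<close>

lemma eigval_at_top: "filterlim eigval at_top sequentially"
proof -
  have "\<exists>n. K < eigval n" for K
  proof (rule ccontr)
    assume "\<not> ?thesis"
    then have b: "Re (h (eigvec n) (eigvec n)) \<le> max 1 K" for n
      by (simp add: not_less eigval_def le_max_iff_disj)
    have "\<exists>r::nat \<Rightarrow> nat. strict_mono r \<and> (\<forall>e>0. \<exists>N. \<forall>m\<ge>N. \<forall>n\<ge>N.
        Re (ip (eigvec (r m) - eigvec (r n)) (eigvec (r m) - eigvec (r n))) < e)"
      by (rule compact_embedding [where f = eigvec and K = "max 1 K"]) (use b in \<open>auto simp: eigvec_orthonormal\<close>)
    then obtain r N where r: "strict_mono (r :: nat \<Rightarrow> nat)"
      "\<forall>m\<ge>N. \<forall>n\<ge>N. Re (ip (eigvec (r m) - eigvec (r n)) (eigvec (r m) - eigvec (r n))) < 1"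
      by (metis zero_less_one)
    then have "Re (ip (eigvec (r N) - eigvec (r (Suc N))) (eigvec (r N) - eigvec (r (Suc N)))) < 1" by simp
    moreover have "r N \<noteq> r (Suc N)" using r(1) by (simp add: strict_mono_eq)
    ultimately show False
      by (simp add: ip.Q_diff eigvec_orthonormal)
  qed
  then show ?thesis
    unfolding filterlim_at_top_dense eventually_sequentially
    by (meson eigval_mono less_le_trans monoD)
qed

lemma cmod_ip_square: "\<lbrakk>x \<in> W; y \<in> W\<rbrakk> \<Longrightarrow> ip x y * ip y x = of_real ((cmod (ip x y))\<^sup>2)"
  using ip.hermitian [of x y] complex_norm_square [of "ip x y"] by simp

section \<open>Expansion in eigenvectors: Bessel, Parseval and Ky Fan\<close>

definition proj :: "nat \<Rightarrow> 'a \<Rightarrow> 'a" where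
  "proj N x = (\<Sum>n<N. scale (ip x (eigvec n)) (eigvec n))"

lemma proj_V [simp, intro]: "proj N x \<in> V"
  unfolding proj_def by auto

lemma ip_proj_eigvec: "ip (proj N x) (eigvec k) = (if k < N then ip x (eigvec k) else 0)"
proof -
  have "ip (proj N x) (eigvec k) = (\<Sum>n<N. ip x (eigvec n) * ip (eigvec n) (eigvec k))"
    unfolding proj_def by (subst ip.sum_left) (auto simp: ip.scale_left)
  also have "\<dots> = (\<Sum>n<N. if n = k then ip x (eigvec n) else 0)"
    by (intro sum.cong) (auto simp: eigvec_orthonormal)
  finally show ?thesis by simp
qed

lemma ip_proj: "x \<in> W \<Longrightarrow> ip (proj N x) x = of_real (\<Sum>n<N. (cmod (ip x (eigvec n)))\<^sup>2)"
  unfolding proj_def of_real_sum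
  by (subst ip.sum_left) (auto simp: ip.scale_left cmod_ip_square intro!: sum.cong)

lemma Q_proj: "x \<in> W \<Longrightarrow> Re (ip (proj N x) (proj N x)) = (\<Sum>n<N. (cmod (ip x (eigvec n)))\<^sup>2)"
proof -
  assume x: "x \<in> W"
  have "ip (proj N x) (proj N x) = (\<Sum>n<N. ip x (eigvec n) * ip (eigvec n) (proj N x))"
    by (subst (1) proj_def, subst ip.sum_left) (auto simp: ip.scale_left)
  also have "\<dots> = (\<Sum>n<N. ip x (eigvec n) * ip (eigvec n) x)"
    using x ip.hermitian [of "proj N x" "eigvec _"] ip.hermitian [of x "eigvec _"]
    by (intro sum.cong refl) (auto simp: ip_proj_eigvec)
  also have "\<dots> = of_real (\<Sum>n<N. (cmod (ip x (eigvec n)))\<^sup>2)"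
    using x by (simp add: cmod_ip_square)
  finally show ?thesis by simp
qed

lemma Q_diff_proj: "x \<in> W \<Longrightarrow> Re (ip (x - proj N x) (x - proj N x)) = Re (ip x x) - (\<Sum>n<N. (cmod (ip x (eigvec n)))\<^sup>2)"
  using ip.hermitian [of "proj N x" x] by (simp add: ip.Q_diff Q_proj ip_proj)

lemma bessel: "x \<in> W \<Longrightarrow> (\<Sum>n<N. (cmod (ip x (eigvec n)))\<^sup>2) \<le> Re (ip x x)"
  using Q_diff_proj [of x N] ip_nonneg [of "x - proj N x"] by auto

lemma h_proj: "x \<in> V \<Longrightarrow> h (proj N x) x = of_real (\<Sum>n<N. eigval n * (cmod (ip x (eigvec n)))\<^sup>2)"
proof -
  assume x: "x \<in> V"
  have "h (proj N x) x = (\<Sum>n<N. ip x (eigvec n) * (of_real (eigval n) * ip (eigvec n) x))"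
    unfolding proj_def using x by (subst h.sum_left) (auto simp: h.scale_left eigvec_eigen)
  also have "\<dots> = (\<Sum>n<N. of_real (eigval n) * (ip x (eigvec n) * ip (eigvec n) x))"
    by (simp add: mult_ac)
  finally show ?thesis using x by (simp add: cmod_ip_square)
qed

lemma h_diff_proj:
  assumes x: "x \<in> V"
  shows "Re (h (x - proj N x) (x - proj N x)) = Re (h x x) - (\<Sum>n<N. eigval n * (cmod (ip x (eigvec n)))\<^sup>2)"
proof -
  have "h (proj N x) (x - proj N x) = (\<Sum>n<N. ip x (eigvec n) * (of_real (eigval n) * ip (eigvec n) (x - proj N x)))"
    using x by (subst (1) proj_def, subst h.sum_left) (auto simp: h.scale_left eigvec_eigen)
  also have "\<dots> = 0"
  proof (intro sum.neutral ballI)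
    fix n assume "n \<in> {..<N}"
    then have "ip (x - proj N x) (eigvec n) = 0"
      using x by (simp add: ip.diff_left ip_proj_eigvec)
    then show "ip x (eigvec n) * (of_real (eigval n) * ip (eigvec n) (x - proj N x)) = 0"
      using x ip.hermitian [of "x - proj N x" "eigvec n"] by simp
  qed
  finally have "h (x - proj N x) (x - proj N x) = h x x - cnj (h (proj N x) x)"
    using x h.hermitian [of "proj N x" x] by (simp add: h.diff_left h.diff_right)
  then show ?thesis using x by (simp add: h_proj)
qed

text \<open>The remainder \<open>x - proj N x\<close> competes in the minimization that defines
  \<open>eigvec N\<close>, and both forms split orthogonally along the projection.\<close>

lemma eigval_tail:
  assumes x: "x \<in> V"
  shows "eigval N * (Re (ip x x) - (\<Sum>n<N. (cmod (ip x (eigvec n)))\<^sup>2))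
      \<le> Re (h x x) - (\<Sum>n<N. eigval n * (cmod (ip x (eigvec n)))\<^sup>2)"
proof -
  have "ip (x - proj N x) (eigvec k) = 0" if "k < N" for k
    using x that by (simp add: ip.diff_left ip_proj_eigvec)
  then have "eigval N * Re (ip (x - proj N x) (x - proj N x)) \<le> Re (h (x - proj N x) (x - proj N x))"
    using x by (intro eigvec_min) auto
  then show ?thesis by (simp only: h_diff_proj Q_diff_proj x V_in_W)
qed

lemma eigval_0_le: "x \<in> V \<Longrightarrow> eigval 0 * Re (ip x x) \<le> Re (h x x)"
  using eigval_tail [of x 0] by simp

lemma eigval_ge: "- C \<le> eigval n"
  using lower_bound [of "eigvec n"] by (simp add: eigvec_orthonormal eigval_def)

text \<open>By \<open>eigval_tail\<close> the missing mass times \<open>eigval N\<close> stays below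
  a constant depending only on \<open>x\<close>, while \<open>eigval N\<close> diverges. The
  constant contains \<open>h x x\<close>, so the argument is tied to the form domain; Bessel's
  inequality is available on all of \<open>W\<close>.\<close>

theorem parseval:
  assumes x: "x \<in> V"
  shows "(\<lambda>n. (cmod (ip x (eigvec n)))\<^sup>2) sums Re (ip x x)"
proof -
  define S where "S N = (\<Sum>n<N. (cmod (ip x (eigvec n)))\<^sup>2)" for N
  define K where "K = Re (h x x) + \<bar>C\<bar> * Re (ip x x)"
  have gap: "eigval N * (Re (ip x x) - S N) \<le> K" for N
  proof -
    have "- \<bar>C\<bar> * S N \<le> (\<Sum>n<N. eigval n * (cmod (ip x (eigvec n)))\<^sup>2)"
      unfolding S_def sum_distrib_left
    proof (intro sum_mono mult_right_mono)
      fix n show "- \<bar>C\<bar> \<le> eigval n" using eigval_ge [of n] by linarith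
    qed auto
    moreover have "\<bar>C\<bar> * S N \<le> \<bar>C\<bar> * Re (ip x x)"
      unfolding S_def using bessel x by (intro mult_left_mono) auto
    ultimately show ?thesis using eigval_tail [OF x, of N] unfolding K_def S_def by linarith
  qed
  have "(\<lambda>N. Re (ip x x) - S N) \<longlonglongrightarrow> 0"
  proof (rule tendsto_sandwich)
    show "\<forall>\<^sub>F N in sequentially. 0 \<le> Re (ip x x) - S N"
      using bessel x by (simp add: S_def)
    have "\<forall>\<^sub>F N in sequentially. eigval N > 0"
      using eigval_at_top unfolding filterlim_at_top_dense by blast
    then show "\<forall>\<^sub>F N in sequentially. Re (ip x x) - S N \<le> K / eigval N"
    proof eventually_elim
      case (elim N)
      then show ?case using gap [of N] by (simp add: field_simps)
    qed
    show "(\<lambda>N. K / eigval N) \<longlonglongrightarrow> 0"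
      by (rule tendsto_divide_0 [OF tendsto_const]) (rule filterlim_at_top_imp_at_infinity [OF eigval_at_top])
  qed auto
  then have "(\<lambda>N. Re (ip x x) - (Re (ip x x) - S N)) \<longlonglongrightarrow> Re (ip x x) - 0"
    by (intro tendsto_intros)
  then show ?thesis by (simp add: sums_def S_def)
qed

text \<open>The numbers \<open>|<\<phi>_i, e_n>|^2\<close> sum over \<open>i\<close> to at most 1.
  After subtracting \<open>eigval N\<close> the coefficients of the first \<open>N\<close>
  eigenvalues are nonpositive, so replacing 1 by such a sum can only raise the value; what results
  is bounded for each \<open>i\<close> by \<open>eigval_tail\<close>.\<close>

theorem ky_fan:
  assumes \<phi>: "\<And>i. i < N \<Longrightarrow> \<phi> i \<in> V"
    and on: "\<And>i j. i < N \<Longrightarrow> j < N \<Longrightarrow> ip (\<phi> i) (\<phi> j) = (if i = j then 1 else 0)"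
  shows "(\<Sum>n<N. eigval n) \<le> (\<Sum>i<N. Re (h (\<phi> i) (\<phi> i)))"
proof -
  have b: "(\<Sum>i<N. (cmod (ip (\<phi> i) (eigvec n)))\<^sup>2) \<le> 1" for n
  proof -
    \<comment> \<open>The projection of \<open>eigvec n\<close> onto the span of the
      \<open>\<phi> i\<close>. With \<open>s\<close> the sum to be bounded,
      \<open>p - eigvec n\<close> has squared norm \<open>s + 1 - 2 s\<close>.\<close>
    define p where "p = (\<Sum>i<N. scale (ip (eigvec n) (\<phi> i)) (\<phi> i))"
    have p: "p \<in> V" unfolding p_def using \<phi> by auto
    have c: "ip p (\<phi> k) = ip (eigvec n) (\<phi> k)" if "k < N" for k
    proof -
      have "ip p (\<phi> k) = (\<Sum>i<N. ip (eigvec n) (\<phi> i) * ip (\<phi> i) (\<phi> k))"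
        unfolding p_def using \<phi> that by (subst ip.sum_left) (auto simp: ip.scale_left)
      also have "\<dots> = (\<Sum>i<N. if i = k then ip (eigvec n) (\<phi> i) else 0)"
        using that on by (intro sum.cong) auto
      finally show ?thesis using that by simp
    qed
    have sq: "ip (eigvec n) (\<phi> i) * ip (\<phi> i) (eigvec n) = of_real ((cmod (ip (\<phi> i) (eigvec n)))\<^sup>2)" if "i < N" for i
      using cmod_ip_square [of "\<phi> i" "eigvec n"] \<phi> that by (simp add: mult.commute)
    have 1: "ip p (eigvec n) = of_real (\<Sum>i<N. (cmod (ip (\<phi> i) (eigvec n)))\<^sup>2)"
      unfolding p_def using \<phi> sq by (subst ip.sum_left) (auto simp: ip.scale_left)
    have "ip p p = (\<Sum>i<N. ip (eigvec n) (\<phi> i) * ip (\<phi> i) p)"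
      using \<phi> p by (subst (1) p_def, subst ip.sum_left) (auto simp: ip.scale_left)
    also have "\<dots> = (\<Sum>i<N. ip (eigvec n) (\<phi> i) * ip (\<phi> i) (eigvec n))"
    proof (intro sum.cong refl)
      fix i assume "i \<in> {..<N}"
      then show "ip (eigvec n) (\<phi> i) * ip (\<phi> i) p = ip (eigvec n) (\<phi> i) * ip (\<phi> i) (eigvec n)"
        using c [of i] ip.hermitian [of p "\<phi> i"] ip.hermitian [of "eigvec n" "\<phi> i"] \<phi> p by simp
    qed
    also have "\<dots> = of_real (\<Sum>i<N. (cmod (ip (\<phi> i) (eigvec n)))\<^sup>2)"
      using sq by simp
    finally have 2: "ip p p = of_real (\<Sum>i<N. (cmod (ip (\<phi> i) (eigvec n)))\<^sup>2)" .
    show ?thesis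
      using ip_nonneg [of "p - eigvec n"] p ip.Q_diff [of p "eigvec n"] 1 2 by (simp add: eigvec_orthonormal)
  qed
  have "(\<Sum>n<N. eigval n) = N * eigval N + (\<Sum>n<N. (eigval n - eigval N) * 1)"
    by (simp add: sum_subtractf)
  also have "\<dots> \<le> N * eigval N + (\<Sum>n<N. (eigval n - eigval N) * (\<Sum>i<N. (cmod (ip (\<phi> i) (eigvec n)))\<^sup>2))"
    by (intro add_mono sum_mono mult_left_mono_neg b order_refl) (auto intro!: monoD [OF eigval_mono])
  also have "(\<Sum>n<N. (eigval n - eigval N) * (\<Sum>i<N. (cmod (ip (\<phi> i) (eigvec n)))\<^sup>2)) =
      (\<Sum>i<N. \<Sum>n<N. (eigval n - eigval N) * (cmod (ip (\<phi> i) (eigvec n)))\<^sup>2)"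
    unfolding sum_distrib_left by (rule sum.swap)
  also have "real N * eigval N + \<dots> = (\<Sum>i<N. eigval N + (\<Sum>n<N. (eigval n - eigval N) * (cmod (ip (\<phi> i) (eigvec n)))\<^sup>2))"
    by (simp add: sum.distrib)
  also have "\<dots> \<le> (\<Sum>i<N. Re (h (\<phi> i) (\<phi> i)))"
  proof (rule sum_mono)
    fix i assume i: "i \<in> {..<N}"
    then show "eigval N + (\<Sum>n<N. (eigval n - eigval N) * (cmod (ip (\<phi> i) (eigvec n)))\<^sup>2) \<le> Re (h (\<phi> i) (\<phi> i))"
      using eigval_tail [OF \<phi>, of i N] on [of i i]
      by (simp add: left_diff_distrib right_diff_distrib sum_subtractf sum_distrib_left)
  qed
  finally show ?thesis .
qed

section \<open>Multiplicities of the eigenvalues\<close>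

definition eigspace :: "real \<Rightarrow> 'a set" where
  "eigspace t = {x \<in> V. \<forall>y\<in>V. h x y = of_real t * ip x y}"

lemma finite_eigval_eq: "finite {n. eigval n = t}"
proof -
  have "\<forall>\<^sub>F n in sequentially. t < eigval n"
    using eigval_at_top unfolding filterlim_at_top_dense by blast
  then obtain N where "\<And>n. n \<ge> N \<Longrightarrow> t < eigval n" unfolding eventually_sequentially by blast
  then have "{n. eigval n = t} \<subseteq> {..<N}" by (metis (mono_tags) lessThan_iff less_irrefl mem_Collect_eq not_le subsetI)
  then show ?thesis by (rule finite_subset) simp
qed

lemma inj_eigvec: "inj eigvec"
  by (rule injI) (metis eigvec_orthonormal zero_neq_one)

lemma independent_eigvec: "independent (eigvec ` A)"
proof -
  have "\<not> dependent (eigvec ` A)"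
    unfolding dependent_explicit
  proof (safe)
    fix T u w
    assume T: "finite T" "T \<subseteq> eigvec ` A" and 0: "(\<Sum>v\<in>T. scale (u v) v) = 0"
      and w: "w \<in> T" "u w \<noteq> 0"
    then obtain n where n: "eigvec n \<in> T" "u (eigvec n) \<noteq> 0" by blast
    have TV: "v \<in> T \<Longrightarrow> v \<in> V" for v using T by auto
    have "ip (\<Sum>v\<in>T. scale (u v) v) (eigvec n) = (\<Sum>v\<in>T. u v * ip v (eigvec n))"
      using TV by (subst ip.sum_left) (auto simp: ip.scale_left)
    also have "(\<Sum>v\<in>T. u v * ip v (eigvec n)) = (\<Sum>v\<in>T. if v = eigvec n then u v else 0)"
    proof (intro sum.cong refl)
      fix v assume "v \<in> T"
      then obtain m where "v = eigvec m" using T by blast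
      then show "u v * ip v (eigvec n) = (if v = eigvec n then u v else 0)"
        using inj_eigvec by (auto simp: eigvec_orthonormal inj_eq)
    qed
    also have "\<dots> = u (eigvec n)" using T n by simp
    finally show False using 0 n by simp
  qed
  then show ?thesis by simp
qed

text \<open>A solution for \<open>t\<close> is orthogonal to every \<open>eigvec n\<close> with a
  different eigenvalue. Subtracting its components along the finitely many others leaves a vector
  all of whose coefficients vanish, and Parseval makes it zero: the construction has missed no
  eigenvalue.\<close>

theorem dim_eigspace: "dim (eigspace t) = card {n. eigval n = t}"
proof -
  let ?A = "{n. eigval n = t}"
  have "dim (eigspace t) = card (eigvec ` ?A)"
  proof (rule dim_unique)
    show "eigvec ` ?A \<subseteq> eigspace t"
      by (auto simp: eigspace_def eigvec_eigen)
    show "eigspace t \<subseteq> span (eigvec ` ?A)"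
    proof
      fix x assume x: "x \<in> eigspace t"
      then have xV: "x \<in> V" and xe: "\<And>y. y \<in> V \<Longrightarrow> h x y = of_real t * ip x y" by (auto simp: eigspace_def)
      have z: "ip x (eigvec n) = 0" if "eigval n \<noteq> t" for n
      proof -
        have "of_real t * ip x (eigvec n) = of_real (eigval n) * ip x (eigvec n)"
        proof -
          have "h x (eigvec n) = cnj (of_real (eigval n) * ip (eigvec n) x)"
            using h.hermitian [of "eigvec n" x] xV by (simp add: eigvec_eigen)
          also have "\<dots> = of_real (eigval n) * ip x (eigvec n)"
            using ip.hermitian [of "eigvec n" x] xV by simp
          finally show ?thesis using xe [of "eigvec n"] by simp
        qed
        then show ?thesis using that by simp
      qed
      define y where "y = (\<Sum>n\<in>?A. scale (ip x (eigvec n)) (eigvec n))"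
      have y: "y \<in> V" "y \<in> span (eigvec ` ?A)"
        unfolding y_def by (intro ip.sum_dom h.sum_dom h.dom_closed eigvec_V span_sum span_scale span_base imageI; assumption)+
      have "ip y (eigvec k) = ip x (eigvec k)" for k
      proof -
        have "ip y (eigvec k) = (\<Sum>n\<in>?A. ip x (eigvec n) * ip (eigvec n) (eigvec k))"
          unfolding y_def by (subst ip.sum_left) (auto simp: ip.scale_left)
        also have "\<dots> = (\<Sum>n\<in>?A. if n = k then ip x (eigvec n) else 0)"
          by (intro sum.cong) (auto simp: eigvec_orthonormal)
        finally show ?thesis using finite_eigval_eq z by simp
      qed
      then have "ip (x - y) (eigvec k) = 0" for k
        using xV y by (simp add: ip.diff_left)
      then have "(\<lambda>k. 0) sums Re (ip (x - y) (x - y))"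
        using parseval [of "x - y"] xV y by simp
      then have "Re (ip (x - y) (x - y)) = 0"
        using sums_unique2 [OF _ sums_zero] by blast
      then have "x - y = 0" using ip_definite xV y by blast
      then show "x \<in> span (eigvec ` ?A)" using y by simp
    qed
  qed (use independent_eigvec in auto)
  then show ?thesis using inj_eigvec by (simp add: card_image inj_on_def inj_def)
qed

end

section \<open>Smooth bump functions\<close>

text \<open>Unlike \<^const>\<open>smooth_on\<close>, this notion is closed under products by a direct induction.\<close>

fun differentiable_times :: "nat \<Rightarrow> (real \<Rightarrow> real) \<Rightarrow> bool" where
  "differentiable_times 0 f \<longleftrightarrow> True"
| "differentiable_times (Suc n) f \<longleftrightarrow>
     (\<exists>f'. (\<forall>x. (f has_real_derivative f' x) (at x)) \<and> differentiable_times n f')"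

lemma differentiable_times_SucD: "differentiable_times (Suc n) f \<Longrightarrow> differentiable_times n f"
  by (induction n arbitrary: f) auto

lemma differentiable_times_add:
  "differentiable_times n f \<Longrightarrow> differentiable_times n g \<Longrightarrow> differentiable_times n (\<lambda>x. f x + g x)"
proof (induction n arbitrary: f g)
  case (Suc n)
  then obtain f' g' where "\<forall>x. (f has_real_derivative f' x) (at x)" "differentiable_times n f'"
    "\<forall>x. (g has_real_derivative g' x) (at x)" "differentiable_times n g'" by auto
  then show ?case using Suc.IH [of f' g'] by (auto intro!: exI [of _ "\<lambda>x. f' x + g' x"] DERIV_add)
qed auto

lemma differentiable_times_mult:
  "differentiable_times n f \<Longrightarrow> differentiable_times n g \<Longrightarrow> differentiable_times n (\<lambda>x. f x * g x)"
proof (induction n arbitrary: f g)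
  case (Suc n)
  then obtain f' g' where *: "\<forall>x. (f has_real_derivative f' x) (at x)" "differentiable_times n f'"
    "\<forall>x. (g has_real_derivative g' x) (at x)" "differentiable_times n g'" by auto
  have "differentiable_times n (\<lambda>x. f' x * g x + g' x * f x)"
    using Suc * differentiable_times_SucD by (intro differentiable_times_add Suc.IH) auto
  then show ?case using * by (auto intro!: exI [of _ "\<lambda>x. f' x * g x + g' x * f x"] DERIV_mult)
qed auto

lemma differentiable_times_affine:
  "differentiable_times n f \<Longrightarrow> differentiable_times n (\<lambda>x. c * f (a * x + b))"
proof (induction n arbitrary: f c)
  case (Suc n)
  then obtain f' where *: "\<And>x. (f has_real_derivative f' x) (at x)" "differentiable_times n f'" by auto
  have "((\<lambda>x. c * f (a * x + b)) has_real_derivative (c * a) * f' (a * x + b)) (at x)" for x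
    by (auto intro!: derivative_eq_intros DERIV_chain' [OF _ *(1)])
  then show ?case
    using Suc.IH [OF *(2), of "c * a"] by (auto intro!: exI [of _ "\<lambda>x. c * a * f' (a * x + b)"])
qed auto

text \<open>\<open>smooth_on\<close> concerns iterates of the operator \<open>deriv\<close>.
  Derivatives are unique, so the witnesses hidden in \<open>differentiable_times\<close> are these
  iterates.\<close>

lemma smooth_on_UNIV_I:
  assumes "\<And>n. differentiable_times n f"
  shows "smooth_on UNIV f"
proof -
  have "\<exists>g. (deriv ^^ n) f = g \<and> (\<forall>k. differentiable_times k g)" for n
  proof (induction n)
    case (Suc n)
    then obtain g where g: "(deriv ^^ n) f = g" "\<And>k. differentiable_times k g" by auto
    have "differentiable_times k (deriv g)" for k
    proof -
      obtain g' where g': "\<forall>x. (g has_real_derivative g' x) (at x)" "differentiable_times k g'"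
        using g(2) [of "Suc k"] by auto
      then have "deriv g = g'" by (auto simp: fun_eq_iff intro: DERIV_imp_deriv)
      then show ?thesis using g' by simp
    qed
    then show ?case using g by simp
  qed (use assms in auto)
  then have "\<exists>g'. \<forall>x. ((deriv ^^ n) f has_real_derivative g' x) (at x)" for n
    by (metis differentiable_times.simps(2))
  then show ?thesis
    unfolding smooth_on_def using real_differentiable_def by blast
qed

text \<open>The polynomial factor makes this family of functions closed under differentiation.\<close>

definition flat :: "real poly \<Rightarrow> real \<Rightarrow> real" where
  "flat p x = (if x \<le> 0 then 0 else poly p (inverse x) * exp (- inverse x))"

lemma poly_over_exp_tendsto_0: "((\<lambda>y::real. poly p y * exp (- y)) \<longlongrightarrow> 0) at_top"
proof -
  have "((\<lambda>y::real. \<Sum>i\<le>degree p. coeff p i * (y ^ i / exp y)) \<longlongrightarrow> (\<Sum>i\<le>degree p. coeff p i * 0)) at_top"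
    by (intro tendsto_intros tendsto_power_div_exp_0)
  then show ?thesis by (simp add: poly_altdef sum_divide_distrib exp_minus divide_inverse mult.assoc sum_distrib_right)
qed

text \<open>With \<open>y = 1/x\<close> one has \<open>d/dx = - y^2 d/dy\<close>, and
  \<open>- y^2 (p e^-y)' = y^2 (p - p') e^-y\<close>. At \<open>0\<close> the exponential beats
  every polynomial in \<open>y\<close>.\<close>

lemma flat_derivative: "(flat p has_real_derivative flat ([:0, 0, 1:] * (p - pderiv p)) x) (at x)"
proof (cases x "0 :: real" rule: linorder_cases)
  case less
  have "((\<lambda>_. 0) has_real_derivative 0) (at x)" by simp
  then have "(flat p has_real_derivative 0) (at x)"
    by (rule has_field_derivative_transform_within_open [where S = "{..<0}"]) (use less in \<open>auto simp: flat_def\<close>)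
  then show ?thesis using less by (simp add: flat_def)
next
  case greater
  have "((\<lambda>x. poly p (inverse x) * exp (- inverse x)) has_real_derivative flat ([:0, 0, 1:] * (p - pderiv p)) x) (at x)"
    using greater by (auto intro!: derivative_eq_intros poly_DERIV DERIV_chain' [where f = inverse]
      simp: flat_def power2_eq_square algebra_simps)
  then show ?thesis
    by (rule has_field_derivative_transform_within_open [where S = "{0<..}"]) (use greater in \<open>auto simp: flat_def\<close>)
next
  case equal
  have "((\<lambda>h. (flat p h - flat p 0) / (h - 0)) \<longlongrightarrow> 0) (at 0)"
  proof (rule filterlim_split_at)
    have "\<forall>\<^sub>F h in at_left (0::real). (flat p h - flat p 0) / (h - 0) = 0"
      by (auto simp: eventually_at_left_field flat_def intro!: exI [of _ "-1"])
    then show "((\<lambda>h. (flat p h - flat p 0) / (h - 0)) \<longlongrightarrow> 0) (at_left 0)"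
      by (rule tendsto_eventually)
    \<comment> \<open>The factor \<open>[:0, 1:]\<close> is the \<open>1/h\<close> of the difference
      quotient, absorbed into the polynomial.\<close>
    have "((\<lambda>h. poly ([:0, 1:] * p) (inverse h) * exp (- inverse h)) \<longlongrightarrow> 0) (at_right (0::real))"
      by (rule filterlim_compose [OF poly_over_exp_tendsto_0 filterlim_inverse_at_top_right])
    moreover have "\<forall>\<^sub>F h in at_right (0::real). poly ([:0, 1:] * p) (inverse h) * exp (- inverse h) = (flat p h - flat p 0) / (h - 0)"
      by (auto simp: eventually_at_right_field flat_def field_simps intro!: exI [of _ "1"])
    ultimately show "((\<lambda>h. (flat p h - flat p 0) / (h - 0)) \<longlongrightarrow> 0) (at_right 0)"
      by (rule Lim_transform_eventually)
  qed
  then show ?thesis using equal by (simp add: has_field_derivative_iff flat_def)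
qed

lemma differentiable_times_flat: "differentiable_times n (flat p)"
  by (induction n arbitrary: p) (auto intro: flat_derivative)

section \<open>Bumps, their primitives and mollifiers\<close>

definition bump :: "real \<Rightarrow> real \<Rightarrow> real \<Rightarrow> real" where
  "bump a \<epsilon> x = flat 1 (x - (a - \<epsilon>)) * flat 1 ((a + \<epsilon>) - x)"

lemma differentiable_times_bump: "differentiable_times n (bump a \<epsilon>)"
  using differentiable_times_affine [OF differentiable_times_flat, of n 1 1 1 "- (a - \<epsilon>)"]
    differentiable_times_affine [OF differentiable_times_flat, of n 1 1 "-1" "a + \<epsilon>"]
  unfolding bump_def by (intro differentiable_times_mult) (simp_all add: algebra_simps)

lemma bump_pos: "\<bar>x - a\<bar> < \<epsilon> \<Longrightarrow> 0 < bump a \<epsilon> x"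
  by (auto simp: bump_def flat_def)

lemma bump_zero: "\<epsilon> \<le> \<bar>x - a\<bar> \<Longrightarrow> bump a \<epsilon> x = 0"
  by (auto simp: bump_def flat_def abs_real_def split: if_splits)

lemma bump_nonneg: "0 \<le> bump a \<epsilon> x"
  by (auto simp: bump_def flat_def)

lemma continuous_bump: "continuous_on S (bump a \<epsilon>)"
proof -
  obtain f' where "\<And>x. (bump a \<epsilon> has_real_derivative f' x) (at x)"
    using differentiable_times_bump [of 1 a \<epsilon>] by auto
  then show ?thesis
    by (intro continuous_at_imp_continuous_on) (auto intro: DERIV_isCont)
qed

text \<open>The lower limit lies strictly left of the support, so every point of the support is
  interior to the interval on which the fundamental theorem is applied. Still further left the
  interval is empty and the integral has its default value 0.\<close>

definition bump_prim :: "real \<Rightarrow> real \<Rightarrow> real \<Rightarrow> real" where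
  "bump_prim a \<epsilon> x = integral {a - \<epsilon> - 1..x} (bump a \<epsilon>)"

lemma bump_prim_derivative: "(bump_prim a \<epsilon> has_real_derivative bump a \<epsilon> x) (at x)" if "\<epsilon> > 0"
proof (cases "x < a - \<epsilon>")
  case True
  have "((\<lambda>_. 0) has_real_derivative 0) (at x)" by simp
  then have "(bump_prim a \<epsilon> has_real_derivative 0) (at x)"
  proof (rule has_field_derivative_transform_within_open [where S = "{..<a - \<epsilon>}"])
    fix y assume "y \<in> {..<a - \<epsilon>}"
    then have "integral {a - \<epsilon> - 1..y} (bump a \<epsilon>) = integral {a - \<epsilon> - 1..y} (\<lambda>_. 0)"
      by (intro integral_cong) (auto intro!: bump_zero)
    then show "0 = bump_prim a \<epsilon> y" by (simp add: bump_prim_def)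
  qed (use True in auto)
  then show ?thesis using True by (simp add: bump_zero)
next
  case False
  then have x: "x \<in> {a - \<epsilon> - 1<..<x + 1}" by auto
  have "(bump_prim a \<epsilon> has_real_derivative bump a \<epsilon> x) (at x within {a - \<epsilon> - 1..x + 1})"
    unfolding bump_prim_def using x by (intro integral_has_real_derivative continuous_bump) auto
  then have "(bump_prim a \<epsilon> has_real_derivative bump a \<epsilon> x) (at x within {a - \<epsilon> - 1<..<x + 1})"
    by (rule has_field_derivative_subset) auto
  then show ?thesis using x at_within_open [of x "{a - \<epsilon> - 1<..<x + 1}"] by simp
qed

lemma bump_prim_left: "\<epsilon> > 0 \<Longrightarrow> x \<le> a - \<epsilon> \<Longrightarrow> bump_prim a \<epsilon> x = 0"
  using integral_cong [of "{a - \<epsilon> - 1..x}" "bump a \<epsilon>" "\<lambda>_. 0"] by (auto simp: bump_prim_def bump_zero)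

lemma bump_prim_right: "\<epsilon> > 0 \<Longrightarrow> a + \<epsilon> \<le> x \<Longrightarrow> bump_prim a \<epsilon> x = bump_prim a \<epsilon> (a + \<epsilon>)"
proof -
  assume *: "\<epsilon> > 0" "a + \<epsilon> \<le> x"
  have "integral {a - \<epsilon> - 1..a + \<epsilon>} (bump a \<epsilon>) + integral {a + \<epsilon>..x} (bump a \<epsilon>) = integral {a - \<epsilon> - 1..x} (bump a \<epsilon>)"
    using * by (intro Henstock_Kurzweil_Integration.integral_combine integrable_continuous_real continuous_bump) auto
  moreover have "integral {a + \<epsilon>..x} (bump a \<epsilon>) = integral {a + \<epsilon>..x} (\<lambda>_. 0)"
    using * by (intro integral_cong) (auto intro!: bump_zero)
  ultimately show ?thesis by (simp add: bump_prim_def)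
qed

lemma bump_prim_pos: "\<epsilon> > 0 \<Longrightarrow> bump_prim a \<epsilon> (a + \<epsilon>) > 0"
proof -
  assume "\<epsilon> > 0"
  have "bump_prim a \<epsilon> (a + \<epsilon>) \<noteq> 0"
  proof
    assume "bump_prim a \<epsilon> (a + \<epsilon>) = 0"
    moreover have "(bump a \<epsilon> has_integral bump_prim a \<epsilon> (a + \<epsilon>)) (cbox (a - \<epsilon> - 1) (a + \<epsilon>))"
      unfolding bump_prim_def by (simp add: integrable_integral integrable_continuous_real continuous_bump)
    ultimately have "bump a \<epsilon> a = 0"
      using \<open>\<epsilon> > 0\<close> by (intro has_integral_0_cbox_imp_0 [of "a - \<epsilon> - 1" "a + \<epsilon>"]) (auto simp: bump_nonneg continuous_bump box_ne_empty)
    then show False using bump_pos [of a a \<epsilon>] \<open>\<epsilon> > 0\<close> by simp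
  qed
  moreover have "bump_prim a \<epsilon> (a + \<epsilon>) \<ge> 0"
    unfolding bump_prim_def by (intro integral_nonneg integrable_continuous_real continuous_bump) (simp add: bump_nonneg)
  ultimately show ?thesis by linarith
qed

text \<open>The divisor is the total mass of the bump.\<close>

definition mollifier :: "real \<Rightarrow> real \<Rightarrow> real \<Rightarrow> real" where
  "mollifier a \<epsilon> x = bump a \<epsilon> x / bump_prim a \<epsilon> (a + \<epsilon>)"

lemma test_function_I:
  assumes "\<And>n. differentiable_times n f" "0 < c" "d < l" "\<And>x. x \<notin> {c..d} \<Longrightarrow> f x = 0"
  shows "test_function l f"
proof -
  have "closure {x. f x \<noteq> 0} \<subseteq> {c..d}"
    using assms(4) by (intro closure_minimal) blast+
  then show ?thesis
    using assms by (auto simp: test_function_def intro!: smooth_on_UNIV_I)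
qed

lemma differentiable_times_mollifier: "differentiable_times n (mollifier a \<epsilon>)"
  using differentiable_times_affine [OF differentiable_times_bump, of n "1 / bump_prim a \<epsilon> (a + \<epsilon>)" a \<epsilon> 1 0]
  by (simp add: mollifier_def [abs_def])

text \<open>A difference of two mollifiers has integral zero, hence a primitive with compact
  support. Testing with this primitive compares the averages of a function near \<open>a\<close> and
  near \<open>b\<close>.\<close>

lemma test_function_mollifier_difference:
  assumes "0 < \<epsilon>" "0 < a - \<epsilon>" "a + \<epsilon> < l" "0 < b - \<epsilon>" "b + \<epsilon> < l"
  obtains \<phi> where "test_function l \<phi>" "\<And>x. deriv \<phi> x = mollifier a \<epsilon> x - mollifier b \<epsilon> x"
proof -
  let ?A = "bump_prim a \<epsilon> (a + \<epsilon>)" and ?B = "bump_prim b \<epsilon> (b + \<epsilon>)"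
  define \<phi> where "\<phi> x = bump_prim a \<epsilon> x / ?A - bump_prim b \<epsilon> x / ?B" for x
  have D: "(\<phi> has_real_derivative mollifier a \<epsilon> x - mollifier b \<epsilon> x) (at x)" for x
    unfolding \<phi>_def mollifier_def using assms bump_prim_pos [of \<epsilon> a] bump_prim_pos [of \<epsilon> b]
    by (auto intro!: derivative_eq_intros bump_prim_derivative)
  have m: "differentiable_times n (\<lambda>x. mollifier a \<epsilon> x - mollifier b \<epsilon> x)" for n
    using differentiable_times_add [OF differentiable_times_affine [OF differentiable_times_bump, of n "1 / ?A" a \<epsilon> 1 0]
      differentiable_times_affine [OF differentiable_times_bump, of n "- (1 / ?B)" b \<epsilon> 1 0]]
    by (simp add: mollifier_def)
  have "test_function l \<phi>"
  proof (rule test_function_I)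
    show "differentiable_times n \<phi>" for n
      using D m by (cases n) (auto intro!: exI [of _ "\<lambda>x. mollifier a \<epsilon> x - mollifier b \<epsilon> x"])
    show "0 < min a b - \<epsilon>" "max a b + \<epsilon> < l" using assms by auto
    fix x assume "x \<notin> {min a b - \<epsilon>..max a b + \<epsilon>}"
    then consider "x \<le> a - \<epsilon>" "x \<le> b - \<epsilon>" | "a + \<epsilon> \<le> x" "b + \<epsilon> \<le> x" by force
    then show "\<phi> x = 0"
    proof cases
      case 1 then show ?thesis using assms by (simp add: \<phi>_def bump_prim_left)
    next
      case 2 then show ?thesis
        using assms bump_prim_right [of \<epsilon> a x] bump_prim_right [of \<epsilon> b x] bump_prim_pos [of \<epsilon> a] bump_prim_pos [of \<epsilon> b] by (simp add: \<phi>_def)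
    qed
  qed
  moreover have "deriv \<phi> x = mollifier a \<epsilon> x - mollifier b \<epsilon> x" for x
    using D by (rule DERIV_imp_deriv)
  ultimately show ?thesis using that by blast
qed

section \<open>Square-integrable functions and weak derivatives on an interval\<close>

abbreviation iv :: "real \<Rightarrow> real measure" where "iv l \<equiv> lebesgue_on {0<..<l}"

lemma finite_measure_iv [simp]: "finite_measure (iv l)"
  by (intro finite_measure_lebesgue_on bounded_set_imp_lmeasurable) auto

lemma space_iv [simp]: "space (iv l) = {0<..<l}"
  by simp

lemma iv_const [simp]: "integrable (iv l) (\<lambda>_. c)"
  by (rule finite_measure.integrable_const) simp

lemma cnj_measurable [measurable]: "cnj \<in> borel_measurable borel"
  by (intro borel_measurable_continuous_onI continuous_intros)

lemma L2_measurable: "f \<in> L2_interval l \<Longrightarrow> f \<in> borel_measurable (iv l)"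
  by (simp add: L2_interval_def)

lemma continuous_measurable_iv: "continuous_on {0<..<l} f \<Longrightarrow> f \<in> borel_measurable (iv l)"
  by (intro continuous_imp_measurable_on_sets_lebesgue) auto

lemma id_measurable_iv [measurable]: "(\<lambda>x. x) \<in> borel_measurable (iv l)"
  by (intro continuous_measurable_iv continuous_intros)

lemma L2_product:
  assumes "f \<in> L2_interval l" "g \<in> L2_interval l"
  shows "integrable (iv l) (\<lambda>x. f x * cnj (g x))"
proof (rule Bochner_Integration.integrable_bound)
  have [measurable]: "f \<in> borel_measurable (iv l)" "g \<in> borel_measurable (iv l)"
    using assms L2_measurable by auto
  show "integrable (iv l) (\<lambda>x. (cmod (f x))\<^sup>2 + (cmod (g x))\<^sup>2)"
    using assms by (intro Bochner_Integration.integrable_add) (auto simp: L2_interval_def)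
  show "(\<lambda>x. f x * cnj (g x)) \<in> borel_measurable (iv l)"
    by measurable
  have "a * b \<le> a\<^sup>2 + b\<^sup>2" if "0 \<le> a" "0 \<le> b" for a b :: real
    using sum_squares_bound [of a b] mult_nonneg_nonneg [OF that] by linarith
  then show "AE x in iv l. norm (f x * cnj (g x)) \<le> norm ((cmod (f x))\<^sup>2 + (cmod (g x))\<^sup>2)"
    by (simp add: norm_mult)
qed

lemma L2_bounded:
  assumes f: "f \<in> borel_measurable (iv l)" and b: "AE x in iv l. cmod (f x) \<le> K"
  shows "f \<in> L2_interval l"
proof -
  have "integrable (iv l) (\<lambda>x. (cmod (f x))\<^sup>2)"
  proof (rule Bochner_Integration.integrable_bound)
    show "integrable (iv l) (\<lambda>x. K\<^sup>2)" by simp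
    show "(\<lambda>x. (cmod (f x))\<^sup>2) \<in> borel_measurable (iv l)" using f by measurable
    show "AE x in iv l. norm ((cmod (f x))\<^sup>2) \<le> norm (K\<^sup>2)"
      using b by eventually_elim (auto intro: power_mono)
  qed
  then show ?thesis using f by (simp add: L2_interval_def)
qed

lemma L2_const: "(\<lambda>_. c) \<in> L2_interval l"
  by (rule L2_bounded [where K = "cmod c"]) auto

lemma L2_continuous:
  assumes "continuous_on {0..l} f"
  shows "f \<in> L2_interval l"
proof -
  have "compact (f ` {0..l})" using assms by (intro compact_continuous_image) auto
  then obtain K where "\<And>x. x \<in> {0..l} \<Longrightarrow> cmod (f x) \<le> K"
    by (meson bounded_iff compact_imp_bounded image_eqI)
  moreover have "continuous_on {0<..<l} f" using assms by (rule continuous_on_subset) auto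
  ultimately show ?thesis
    by (intro L2_bounded [where K = K] continuous_measurable_iv AE_I2) auto
qed

lemma L2_integrable: "f \<in> L2_interval l \<Longrightarrow> integrable (iv l) f"
  using L2_product [of f l "\<lambda>_. 1"] L2_const by simp

lemma L2_scale: "f \<in> L2_interval l \<Longrightarrow> (\<lambda>x. c * f x) \<in> L2_interval l"
  by (auto simp: L2_interval_def norm_mult power_mult_distrib)

lemma L2_add:
  assumes "f \<in> L2_interval l" "g \<in> L2_interval l"
  shows "(\<lambda>x. f x + g x) \<in> L2_interval l"
proof -
  have [measurable]: "f \<in> borel_measurable (iv l)" "g \<in> borel_measurable (iv l)"
    using assms L2_measurable by auto
  have "integrable (iv l) (\<lambda>x. (cmod (f x + g x))\<^sup>2)"
  proof (rule Bochner_Integration.integrable_bound)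
    show "integrable (iv l) (\<lambda>x. 2 * (cmod (f x))\<^sup>2 + 2 * (cmod (g x))\<^sup>2)"
      using assms by (intro Bochner_Integration.integrable_add) (auto simp: L2_interval_def)
    have "(cmod (f x + g x))\<^sup>2 \<le> 2 * (cmod (f x))\<^sup>2 + 2 * (cmod (g x))\<^sup>2" for x
    proof -
      have "(cmod (f x + g x))\<^sup>2 \<le> (cmod (f x) + cmod (g x))\<^sup>2"
        by (intro power_mono norm_triangle_ineq) auto
      also have "\<dots> \<le> 2 * (cmod (f x))\<^sup>2 + 2 * (cmod (g x))\<^sup>2"
        using sum_squares_bound [of "cmod (f x)" "cmod (g x)"] by (simp add: power2_sum)
      finally show ?thesis .
    qed
    then show "AE x in iv l. norm ((cmod (f x + g x))\<^sup>2) \<le> norm (2 * (cmod (f x))\<^sup>2 + 2 * (cmod (g x))\<^sup>2)"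
      by simp
  qed measurable
  then show ?thesis by (simp add: L2_interval_def)
qed

lemma L2_diff: "f \<in> L2_interval l \<Longrightarrow> g \<in> L2_interval l \<Longrightarrow> (\<lambda>x. f x - g x) \<in> L2_interval l"
  using L2_add [of f l "\<lambda>x. -1 * g x"] L2_scale [of g l "-1"] by simp

lemma L2_restrict:
  assumes f: "f \<in> L2_interval l" and A: "{x. P x} \<in> sets borel"
  shows "(\<lambda>x. if P x then f x else 0) \<in> L2_interval l"
proof -
  have [measurable]: "f \<in> borel_measurable (iv l)" using f L2_measurable by auto
  have [measurable]: "Measurable.pred (iv l) P"
    using measurable_sets [OF id_measurable_iv A, of l] unfolding pred_def by (simp add: vimage_def Int_def conj_commute)
  have "integrable (iv l) (\<lambda>x. (cmod (if P x then f x else 0))\<^sup>2)"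
    by (rule Bochner_Integration.integrable_bound [where f = "\<lambda>x. (cmod (f x))\<^sup>2"])
      (use f in \<open>auto simp: L2_interval_def\<close>)
  then show ?thesis by (simp add: L2_interval_def)
qed

definition ipI :: "real \<Rightarrow> (real \<Rightarrow> complex) \<Rightarrow> (real \<Rightarrow> complex) \<Rightarrow> complex" where
  "ipI l f g = (LINT x|iv l. f x * cnj (g x))"

text \<open>Functions are not identified modulo null sets, so this form is only semidefinite;
  Cauchy-Schwarz is available nevertheless.\<close>

interpretation L2: hermitian_form "\<lambda>(c::complex) (f::real \<Rightarrow> complex) x. c * f x" "L2_interval l" "ipI l" for l
proof unfold_locales
  show "module.subspace (\<lambda>(c::complex) (f::real \<Rightarrow> complex) x. c * f x) (L2_interval l)"
  proof -
    interpret module "\<lambda>(c::complex) (f::real \<Rightarrow> complex) x. c * f x"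
      by unfold_locales (auto simp: fun_eq_iff algebra_simps)
    show ?thesis
      unfolding subspace_def using L2_add L2_scale L2_const [of 0 l] by (auto simp: plus_fun_def zero_fun_def)
  qed
  show "ipI l (\<lambda>x. c * f x) g = c * ipI l f g" for c f g
    by (simp add: ipI_def mult.assoc)
  show "ipI l (f + g) k = ipI l f k + ipI l g k" if "f \<in> L2_interval l" "g \<in> L2_interval l" "k \<in> L2_interval l" for f g k
    using L2_product that by (simp add: ipI_def distrib_right Bochner_Integration.integral_add)
  show "ipI l g f = cnj (ipI l f g)" for f g
    unfolding ipI_def by (subst Bochner_Integration.integral_cnj [symmetric]) (simp add: mult.commute)
qed (auto simp: fun_eq_iff algebra_simps)

lemma ipI_self: "ipI l f f = of_real (LINT x|iv l. (cmod (f x))\<^sup>2)"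
  unfolding ipI_def by (simp add: complex_norm_square [symmetric] flip: integral_complex_of_real of_real_power)

lemma Re_ipI_self: "Re (ipI l f f) = (LINT x|iv l. (cmod (f x))\<^sup>2)"
  by (simp add: ipI_self)

lemma ipI_nonneg: "0 \<le> Re (ipI l f f)"
  by (simp add: Re_ipI_self)

section \<open>Primitives of square-integrable functions\<close>

definition prim :: "real \<Rightarrow> (real \<Rightarrow> complex) \<Rightarrow> real \<Rightarrow> complex" where
  "prim l g x = (LINT y|iv l. (if y < x then g y else 0))"

lemma prim_integrable: "g \<in> L2_interval l \<Longrightarrow> integrable (iv l) (\<lambda>y. if y < x then g y else 0)"
  by (intro L2_integrable L2_restrict) auto

lemma prim_0 [simp]: "prim l g 0 = 0"
proof -
  have "prim l g 0 = (LINT y|iv l. 0)"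
    unfolding prim_def by (intro Bochner_Integration.integral_cong) auto
  then show ?thesis by simp
qed

lemma prim_end: "prim l g l = integral\<^sup>L (iv l) g"
  unfolding prim_def by (intro Bochner_Integration.integral_cong) auto

lemma prim_add: "f \<in> L2_interval l \<Longrightarrow> g \<in> L2_interval l \<Longrightarrow> prim l (\<lambda>x. f x + g x) x = prim l f x + prim l g x"
proof -
  assume fg: "f \<in> L2_interval l" "g \<in> L2_interval l"
  have "prim l (\<lambda>x. f x + g x) x = (LINT y|iv l. (if y < x then f y else 0) + (if y < x then g y else 0))"
    unfolding prim_def by (intro Bochner_Integration.integral_cong) auto
  also have "\<dots> = prim l f x + prim l g x"
    unfolding prim_def using fg by (intro Bochner_Integration.integral_add prim_integrable)
  finally show ?thesis .
qed

lemma prim_diff: "f \<in> L2_interval l \<Longrightarrow> g \<in> L2_interval l \<Longrightarrow> prim l (\<lambda>x. f x - g x) x = prim l f x - prim l g x"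
proof -
  assume fg: "f \<in> L2_interval l" "g \<in> L2_interval l"
  have "prim l (\<lambda>x. f x - g x) x = (LINT y|iv l. (if y < x then f y else 0) - (if y < x then g y else 0))"
    unfolding prim_def by (intro Bochner_Integration.integral_cong) auto
  also have "\<dots> = prim l f x - prim l g x"
    unfolding prim_def using fg by (intro Bochner_Integration.integral_diff prim_integrable)
  finally show ?thesis .
qed

lemma prim_scale: "prim l (\<lambda>x. c * f x) x = c * prim l f x"
proof -
  have "prim l (\<lambda>x. c * f x) x = (LINT y|iv l. c * (if y < x then f y else 0))"
    unfolding prim_def by (intro Bochner_Integration.integral_cong) auto
  then show ?thesis by (simp add: prim_def)
qed

text \<open>The increment is the inner product of \<open>g\<close> with the indicator of
  \<open>{x..<y}\<close>.\<close>

lemma prim_Hoelder: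
  assumes g: "g \<in> L2_interval l" and xy: "0 \<le> x" "x \<le> y" "y \<le> l"
  shows "(cmod (prim l g y - prim l g x))\<^sup>2 \<le> (y - x) * Re (ipI l g g)"
proof -
  define k :: "real \<Rightarrow> complex" where "k t = (if x \<le> t \<and> t < y then 1 else 0)" for t
  have k: "k \<in> L2_interval l"
    unfolding k_def by (intro L2_restrict L2_const) simp
  have "prim l g y - prim l g x = (LINT t|iv l. (if t < y then g t else 0) - (if t < x then g t else 0))"
    unfolding prim_def using g by (intro Bochner_Integration.integral_diff [symmetric] prim_integrable)
  also have "\<dots> = ipI l g k"
    unfolding ipI_def k_def using xy by (intro Bochner_Integration.integral_cong) auto
  finally have "prim l g y - prim l g x = ipI l g k" .
  moreover have "(cmod (ipI l g k))\<^sup>2 \<le> Re (ipI l g g) * Re (ipI l k k)"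
    using g k by (intro L2.Cauchy_Schwarz ipI_nonneg)
  moreover have "Re (ipI l k k) = y - x"
  proof -
    have "Re (ipI l k k) = (LINT t|iv l. indicator {x..<y} t)"
      unfolding Re_ipI_self by (intro Bochner_Integration.integral_cong) (auto simp: k_def)
    also have "\<dots> = measure (iv l) ({x..<y} \<inter> space (iv l))" by simp
    also have "\<dots> = measure lebesgue ({x..<y} \<inter> {0<..<l})"
      by (subst measure_restrict_space) auto
    also have "\<dots> = measure lebesgue {x<..<y}"
      by (rule measure_eq_AE) (use xy AE_lborel_singleton [of x] in \<open>auto intro!: AE_completion elim!: eventually_mono\<close>)
    finally show ?thesis using xy by simp
  qed
  ultimately show ?thesis by (simp add: mult.commute)
qed

lemma prim_continuous:
  assumes g: "g \<in> L2_interval l"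
  shows "continuous_on {0..l} (prim l g)"
proof (rule continuous_on_eq [where f = "prim l g"])
  define K where "K = Re (ipI l g g)"
  have le: "cmod (prim l g y - prim l g x) \<le> sqrt (\<bar>y - x\<bar> * K)" if "x \<in> {0..l}" "y \<in> {0..l}" for x y
  proof (cases "x \<le> y")
    case True
    then show ?thesis using prim_Hoelder [OF g, of x y] that by (intro real_le_rsqrt) (simp add: K_def)
  next
    case False
    then show ?thesis using prim_Hoelder [OF g, of y x] that
      by (intro real_le_rsqrt) (simp add: K_def norm_minus_commute)
  qed
  have "((\<lambda>y. prim l g y - prim l g x) \<longlongrightarrow> 0) (at x within {0..l})" if "x \<in> {0..l}" for x
  proof (rule Lim_null_comparison [where g = "\<lambda>y. sqrt (\<bar>y - x\<bar> * K)"])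
    show "\<forall>\<^sub>F y in at x within {0..l}. norm (prim l g y - prim l g x) \<le> sqrt (\<bar>y - x\<bar> * K)"
      using le that by (auto simp: eventually_at_filter)
    have "((\<lambda>y. sqrt (\<bar>y - x\<bar> * K)) \<longlongrightarrow> sqrt (\<bar>x - x\<bar> * K)) (at x within {0..l})"
      by (intro tendsto_intros)
    then show "((\<lambda>y. sqrt (\<bar>y - x\<bar> * K)) \<longlongrightarrow> 0) (at x within {0..l})" by simp
  qed
  then show "continuous_on {0..l} (prim l g)"
    unfolding continuous_on_def by (simp add: LIM_zero_iff)
qed simp

text \<open>Fubini on the triangle \<open>y < x\<close> of the square; the diagonal is a null set.
  Since \<open>prim\<close> cuts off the integrand and not the domain, everything happens on one
  fixed product measure.\<close>

lemma prim_by_parts: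
  assumes f: "f \<in> L2_interval l" and g: "g \<in> L2_interval l"
  shows "(LINT x|iv l. prim l f x * g x) + (LINT x|iv l. f x * prim l g x) = prim l f l * prim l g l"
proof -
  interpret M: finite_measure "iv l" by simp
  interpret P: pair_sigma_finite "iv l" "iv l" ..
  have [measurable]: "f \<in> borel_measurable (iv l)" "g \<in> borel_measurable (iv l)"
    using assms L2_measurable by auto
  have ff: "integrable (iv l) f" and gg: "integrable (iv l) g" using f g L2_integrable by auto
  have F: "integrable (iv l \<Otimes>\<^sub>M iv l) (\<lambda>(x, y). f y * g x)"
  proof (rule P.Fubini_integrable)
    show "integrable (iv l) (\<lambda>x. LINT y|iv l. norm (case (x, y) of (x, y) \<Rightarrow> f y * g x))"
      using ff gg by (simp add: norm_mult)
  qed (use ff in \<open>auto\<close>)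
  have E: "integrable (iv l \<Otimes>\<^sub>M iv l) (\<lambda>(x, y). if y < x then f y * g x else 0)"
    by (rule Bochner_Integration.integrable_bound [OF F]) (auto simp: split_beta)
  have "(LINT x|iv l. prim l f x * g x) = (LINT x|iv l. LINT y|iv l. (if y < x then f y * g x else 0))"
  proof (intro Bochner_Integration.integral_cong refl)
    fix x
    have "prim l f x * g x = (LINT y|iv l. (if y < x then f y else 0) * g x)"
      by (simp add: prim_def)
    also have "\<dots> = (LINT y|iv l. (if y < x then f y * g x else 0))"
      by (intro Bochner_Integration.integral_cong) auto
    finally show "prim l f x * g x = (LINT y|iv l. (if y < x then f y * g x else 0))" .
  qed
  also have "\<dots> = (LINT y|iv l. LINT x|iv l. (if y < x then f y * g x else 0))"
    using P.Fubini_integral [OF E] by simp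
  also have "\<dots> = (LINT y|iv l. f y * (prim l g l - prim l g y))"
  proof (intro Bochner_Integration.integral_cong refl)
    fix y
    have "(LINT x|iv l. (if y < x then f y * g x else 0)) = f y * (LINT x|iv l. (if y < x then g x else 0))"
      by (subst Bochner_Integration.integral_mult_right_zero [symmetric]) (intro Bochner_Integration.integral_cong, auto)
    also have "(LINT x|iv l. (if y < x then g x else 0)) = (LINT x|iv l. g x - (if x < y then g x else 0))"
    proof (rule Bochner_Integration.integral_cong_AE)
      have "AE x in iv l. x \<noteq> y"
        by (subst AE_restrict_space_iff) (use AE_lborel_singleton [of y] in \<open>auto intro!: AE_completion elim!: eventually_mono\<close>)
      then show "AE x in iv l. (if y < x then g x else 0) = g x - (if x < y then g x else 0)"
        by eventually_elim auto
    qed measurable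
    also have "\<dots> = prim l g l - prim l g y"
      using g gg by (simp add: prim_integrable prim_end) (simp add: prim_def)
    finally show "(LINT x|iv l. (if y < x then f y * g x else 0)) = f y * (prim l g l - prim l g y)" .
  qed
  also have "\<dots> = (LINT y|iv l. f y * prim l g l - f y * prim l g y)"
    by (simp add: right_diff_distrib)
  also have "\<dots> = prim l f l * prim l g l - (LINT y|iv l. f y * prim l g y)"
  proof -
    have "(\<lambda>x. cnj (prim l g x)) \<in> L2_interval l"
      using prim_continuous [OF g] by (intro L2_continuous continuous_intros)
    then have "integrable (iv l) (\<lambda>y. f y * prim l g y)"
      using L2_product [OF f] by force
    then show ?thesis using ff by (simp add: prim_end)
  qed
  finally show ?thesis by simp
qed

text \<open>The exceptional set \<open>S\<close> admits functions with a kink, such as Green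
  functions.\<close>

lemma prim_FTC:
  assumes "finite S" and x: "x \<in> {0..l}" and F: "continuous_on {0..l} F"
    and D: "\<And>y. y \<in> {0<..<l} - S \<Longrightarrow> (F has_vector_derivative F' y) (at y)" and F': "F' \<in> L2_interval l"
  shows "F x = F 0 + prim l F' x"
proof -
  have "(F' has_integral F x - F 0) {0..x}"
    using assms by (intro fundamental_theorem_of_calculus_interior_strong [of S]) (auto intro: continuous_on_subset)
  then have "F x - F 0 = integral {0<..<x} F'"
    by (simp add: integral_open_interval_real [symmetric] integral_unique)
  also have "\<dots> = integral {0<..<l} (\<lambda>y. if y \<in> {0<..<x} then F' y else 0)"
  proof -
    have "{0<..<x} \<inter> {0<..<l} = {0<..<x}" using x by auto
    then show ?thesis by (simp add: integral_restrict_Int del: greaterThanLessThan_iff)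
  qed
  also have "\<dots> = integral {0<..<l} (\<lambda>y. if y < x then F' y else 0)"
    by (intro integral_cong) auto
  also have "\<dots> = prim l F' x"
    unfolding prim_def using F' by (intro lebesgue_integral_eq_integral [symmetric] prim_integrable) auto
  finally show ?thesis by (simp add: algebra_simps)
qed

lemma AE_iv_iff: "(AE x in iv l. P x) \<longleftrightarrow> (AE x in lebesgue. x \<in> {0<..<l} \<longrightarrow> P x)"
  by (intro AE_restrict_space_iff) auto

text \<open>
  The positive and negative parts of a Borel version of \<open>d\<close> are densities of measures that agree
  on half-lines, hence everywhere.
\<close>

lemma real_AE_zero:
  fixes d :: "real \<Rightarrow> real"
  assumes d: "integrable (iv l) d" and 0: "\<And>x. x \<in> {0..l} \<Longrightarrow> (LINT y|iv l. (if y < x then d y else 0)) = 0"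
  shows "AE x in iv l. d x = 0"
proof -
  define d0 where "d0 x = indicator {0<..<l} x *\<^sub>R d x" for x
  have d0: "integrable lebesgue d0"
    using d unfolding d0_def by (subst (asm) integrable_restrict_space) auto
  \<comment> \<open>The comparison of densities takes place on the Borel sets, which are generated
    by half-lines, so a Lebesgue measurable function is first replaced by a Borel version.\<close>
  then obtain d' where d'[measurable]: "d' \<in> borel_measurable lborel" and ae: "AE x in lborel. d0 x = d' x"
    using completion_ex_borel_measurable_real [of d0 lborel] by (auto dest: borel_measurable_integrable)
  have ae': "AE x in lebesgue. d0 x = d' x" using ae by (rule AE_completion)
  have int: "integrable lborel d'"
  proof -
    have "d' \<in> borel_measurable lebesgue" using d' by (rule measurable_completion)
    then have "integrable lebesgue d'"
      using ae' by (intro Bochner_Integration.integrable_cong_AE_imp [OF d0]) (auto elim: eventually_mono)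
    then show ?thesis using integrable_completion [OF d'] by blast
  qed
  have whole: "(LINT y|iv l. d y) = 0" if "0 \<le> l"
  proof -
    have "(LINT y|iv l. d y) = (LINT y|iv l. (if y < l then d y else 0))"
      by (intro Bochner_Integration.integral_cong) auto
    then show ?thesis using 0 [of l] that by simp
  qed
  have zero: "(LINT y|lborel. indicator {x<..} y * d' y) = 0" for x
  proof -
    have "(LINT y|lborel. indicator {x<..} y * d' y) = (LINT y|lebesgue. indicator {x<..} y * d' y)"
      by (rule integral_completion [symmetric]) measurable
    also have "\<dots> = (LINT y|lebesgue. indicator {x<..} y * d0 y)"
    proof (rule Bochner_Integration.integral_cong_AE)
      show "(\<lambda>y. indicator {x<..} y * d' y) \<in> borel_measurable lebesgue"
        by (rule measurable_completion) measurable
      have "(\<lambda>y. indicat_real {x<..} y) \<in> borel_measurable lebesgue"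
        by (rule measurable_completion) measurable
      then show "(\<lambda>y. indicator {x<..} y * d0 y) \<in> borel_measurable lebesgue"
        using d0 by (intro borel_measurable_times) auto
    qed (use ae' in \<open>auto elim: eventually_mono\<close>)
    also have "\<dots> = (LINT y|iv l. indicator {x<..} y * d y)"
      by (subst integral_restrict_space) (auto simp: d0_def mult_ac)
    also have "\<dots> = 0"
    proof (cases "0 \<le> l")
      case False
      then have "(LINT y|iv l. indicator {x<..} y * d y) = (LINT y|iv l. 0)"
        by (intro Bochner_Integration.integral_cong) auto
      then show ?thesis by simp
    next
      case True
      \<comment> \<open>The half-line may start anywhere on the real axis, but the hypothesis
        concerns points of \<open>{0..l}\<close>; the clamped point cuts off the same part of the
        interval up to a null set.\<close>
      define x' where "x' = max 0 (min x l)"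
      have [measurable]: "d \<in> borel_measurable (iv l)" using d by auto
      have x': "x' \<in> {0..l}" using True by (auto simp: x'_def)
      have "(LINT y|iv l. indicator {x<..} y * d y) = (LINT y|iv l. d y - (if y < x' then d y else 0))"
      proof (rule Bochner_Integration.integral_cong_AE)
        show "(\<lambda>y. indicator {x<..} y * d y) \<in> borel_measurable (iv l)" by measurable
        have "AE y in iv l. y \<noteq> x"
          by (subst AE_iv_iff) (use AE_lborel_singleton [of x] in \<open>auto intro!: AE_completion elim!: eventually_mono\<close>)
        moreover have "AE y in iv l. y \<in> {0<..<l}" by (rule AE_I2) simp
        ultimately show "AE y in iv l. indicator {x<..} y * d y = d y - (if y < x' then d y else 0)"
          by eventually_elim (auto simp: x'_def)
      qed measurable
      also have "\<dots> = (LINT y|iv l. d y) - (LINT y|iv l. (if y < x' then d y else 0))"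
      proof (rule Bochner_Integration.integral_diff [OF d])
        show "integrable (iv l) (\<lambda>y. if y < x' then d y else 0)"
          by (rule Bochner_Integration.integrable_bound [OF d]) auto
      qed
      finally show ?thesis using 0 [OF x'] whole True by simp
    qed
    finally show ?thesis .
  qed
  define p n where "p y = max 0 (d' y)" and "n y = max 0 (- d' y)" for y
  have pn: "integrable lborel p" "integrable lborel n"
    unfolding p_def n_def using int by auto
  have [measurable]: "p \<in> borel_measurable lborel" "n \<in> borel_measurable lborel"
    using pn by auto
  have emp: "emeasure (density lborel (\<lambda>y. ennreal (g y))) {x<..} = ennreal (LINT y|lborel. indicator {x<..} y * g y)"
    if "integrable lborel g" "\<And>y. 0 \<le> g y" for g :: "real \<Rightarrow> real" and x
  proof -
    have "emeasure (density lborel (\<lambda>y. ennreal (g y))) {x<..} = (\<integral>\<^sup>+ y. ennreal (indicator {x<..} y * g y) \<partial>lborel)"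
      using that by (subst emeasure_density) (auto intro!: nn_integral_cong simp: indicator_def)
    also have "\<dots> = ennreal (LINT y|lborel. indicator {x<..} y * g y)"
      using that by (intro nn_integral_eq_integral integrable_real_mult_indicator) (auto intro: integrable_mult_indicator [where 'b = real, simplified])
    finally show ?thesis .
  qed
  have "density lborel (\<lambda>y. ennreal (p y)) = density lborel (\<lambda>y. ennreal (n y))"
  proof (rule measure_eqI_lessThan)
    fix x
    show "emeasure (density lborel (\<lambda>y. ennreal (p y))) {x<..} < \<infinity>"
      using emp [OF pn(1), of x] by (simp add: p_def)
    have "(LINT y|lborel. indicator {x<..} y * p y) - (LINT y|lborel. indicator {x<..} y * n y) =
        (LINT y|lborel. indicator {x<..} y * p y - indicator {x<..} y * n y)"
      using pn by (intro Bochner_Integration.integral_diff [symmetric]) (auto intro: integrable_mult_indicator [where 'b = real, simplified])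
    also have "\<dots> = (LINT y|lborel. indicator {x<..} y * d' y)"
      by (intro Bochner_Integration.integral_cong) (auto simp: p_def n_def indicator_def)
    finally have "(LINT y|lborel. indicator {x<..} y * p y) = (LINT y|lborel. indicator {x<..} y * n y)"
      using zero by simp
    then show "emeasure (density lborel (\<lambda>y. ennreal (p y))) {x<..} = emeasure (density lborel (\<lambda>y. ennreal (n y))) {x<..}"
      using emp [OF pn(1), of x] emp [OF pn(2), of x] by (simp add: p_def n_def)
  qed auto
  then have "AE y in lborel. ennreal (p y) = ennreal (n y)"
    by (subst (asm) sigma_finite_measure.density_unique_iff [OF sigma_finite_lborel]) auto
  then have "AE y in lborel. d0 y = 0"
    using ae by eventually_elim (auto simp: p_def n_def max_def split: if_splits)
  then have "AE y in lebesgue. d0 y = 0" by (rule AE_completion)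
  then show ?thesis
    by (subst AE_iv_iff) (auto simp: d0_def elim: eventually_mono)
qed

lemma prim_AE_zero:
  assumes g: "g \<in> L2_interval l" and 0: "\<And>x. x \<in> {0..l} \<Longrightarrow> prim l g x = 0"
  shows "AE x in iv l. g x = 0"
proof -
  have re: "(LINT y|iv l. (if y < x then Re (g y) else 0)) = Re (prim l g x)"
   and im: "(LINT y|iv l. (if y < x then Im (g y) else 0)) = Im (prim l g x)" for x
    unfolding prim_def integral_Re [OF prim_integrable [OF g], symmetric] integral_Im [OF prim_integrable [OF g], symmetric]
    by (auto intro!: Bochner_Integration.integral_cong)
  have "AE x in iv l. Re (g x) = 0"
    using 0 re L2_integrable [OF g] by (intro real_AE_zero) auto
  moreover have "AE x in iv l. Im (g x) = 0"
    using 0 im L2_integrable [OF g] by (intro real_AE_zero) auto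
  ultimately show ?thesis by eventually_elim (simp add: complex_eq_iff)
qed

section \<open>Weak derivatives and primitives\<close>

lemma smooth_deriv:
  assumes "smooth_on UNIV f"
  shows "(f has_real_derivative deriv f x) (at x)" "continuous_on S (deriv f)" "continuous_on S f"
proof -
  have "f differentiable at x" "deriv f differentiable at x" for x
    using assms by (auto simp: smooth_on_def dest: spec [of _ 0] spec [of _ 1])
  then show "(f has_real_derivative deriv f x) (at x)" "continuous_on S (deriv f)" "continuous_on S f"
    by (auto simp: DERIV_deriv_iff_real_differentiable intro!: continuous_at_imp_continuous_on differentiable_imp_continuous_within)
qed

lemma test_function_boundary: "test_function l \<phi> \<Longrightarrow> x \<notin> {0<..<l} \<Longrightarrow> \<phi> x = 0"
  unfolding test_function_def using closure_subset [of "{x. \<phi> x \<noteq> 0}"] by blast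

text \<open>Integration by parts, with the test function written as the primitive of its own
  derivative; the boundary term and the contribution of the constant \<open>f 0\<close> vanish
  because the test function is zero at both ends.\<close>

lemma has_weak_derivative_prim:
  assumes l: "0 < l" and g: "g \<in> L2_interval l" and f: "\<And>x. x \<in> {0..l} \<Longrightarrow> f x = f 0 + prim l g x"
  shows "has_weak_derivative l f g"
proof -
  have cf: "continuous_on {0..l} f"
    using prim_continuous [OF g] by (subst continuous_on_cong [OF refl f]) (auto intro!: continuous_intros)
  have "(LINT x|iv l. f x * of_real (deriv \<phi> x)) = - (LINT x|iv l. g x * of_real (\<phi> x))" if \<phi>: "test_function l \<phi>" for \<phi>
  proof -
    have sm: "smooth_on UNIV \<phi>" using \<phi> by (simp add: test_function_def)
    define \<psi> where "\<psi> x = complex_of_real (deriv \<phi> x)" for x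
    have \<psi>: "\<psi> \<in> L2_interval l"
      unfolding \<psi>_def using smooth_deriv(2) [OF sm] by (intro L2_continuous continuous_intros)
    have \<phi>p: "complex_of_real (\<phi> x) = prim l \<psi> x" if "x \<in> {0..l}" for x
    proof -
      have "complex_of_real (\<phi> x) = complex_of_real (\<phi> 0) + prim l \<psi> x"
      proof (rule prim_FTC [where S = "{}"])
        show "((\<lambda>x. complex_of_real (\<phi> x)) has_vector_derivative \<psi> y) (at y)" for y
          unfolding \<psi>_def using smooth_deriv(1) [OF sm]
          by (intro has_vector_derivative_of_real)
        show "continuous_on {0..l} (\<lambda>x. complex_of_real (\<phi> x))"
          using smooth_deriv(3) [OF sm] by (intro continuous_intros)
      qed (use that \<psi> in auto)
      then show ?thesis using test_function_boundary [OF \<phi>, of 0] by simp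
    qed
    have end0: "prim l \<psi> l = 0"
      using \<phi>p [of l] test_function_boundary [OF \<phi>, of l] l by simp
    have "(LINT x|iv l. f x * of_real (deriv \<phi> x)) = (LINT x|iv l. f 0 * \<psi> x + prim l g x * \<psi> x)"
    proof (intro Bochner_Integration.integral_cong refl)
      fix x assume "x \<in> space (iv l)"
      then have "f x = f 0 + prim l g x" using f [of x] by simp
      then show "f x * of_real (deriv \<phi> x) = f 0 * \<psi> x + prim l g x * \<psi> x"
        by (simp only: \<psi>_def distrib_right)
    qed
    also have "\<dots> = (LINT x|iv l. f 0 * \<psi> x) + (LINT x|iv l. prim l g x * \<psi> x)"
    proof (rule Bochner_Integration.integral_add)
      have "(\<lambda>x. cnj (\<psi> x)) \<in> L2_interval l"
        unfolding \<psi>_def using smooth_deriv(2) [OF sm] by (intro L2_continuous continuous_intros)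
      then show "integrable (iv l) (\<lambda>x. prim l g x * \<psi> x)"
        using L2_product [OF L2_continuous [OF prim_continuous [OF g]]] by force
    qed (use \<psi> L2_integrable in auto)
    also have "(LINT x|iv l. f 0 * \<psi> x) = 0"
      using end0 by (simp add: prim_end)
    also have "(LINT x|iv l. prim l g x * \<psi> x) = - (LINT x|iv l. g x * prim l \<psi> x)"
      using prim_by_parts [OF g \<psi>] end0 by (simp add: eq_neg_iff_add_eq_0)
    also have "(LINT x|iv l. g x * prim l \<psi> x) = (LINT x|iv l. g x * of_real (\<phi> x))"
      by (intro Bochner_Integration.integral_cong refl) (use \<phi>p in auto)
    finally show ?thesis by simp
  qed
  then show ?thesis
    unfolding has_weak_derivative_def using g L2_continuous [OF cf] by blast
qed

lemma mollifier_integral: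
  assumes \<epsilon>: "0 < \<epsilon>" "0 < a - \<epsilon>" "a + \<epsilon> < l"
  shows "(LINT x|iv l. mollifier a \<epsilon> x) = 1" "integrable (iv l) (mollifier a \<epsilon>)"
proof -
  have c: "continuous_on S (mollifier a \<epsilon>)" for S
    unfolding mollifier_def using bump_prim_pos [of \<epsilon> a] \<epsilon> by (intro continuous_intros continuous_bump) auto
  have m: "(\<lambda>x. complex_of_real (mollifier a \<epsilon> x)) \<in> L2_interval l"
    using c by (intro L2_continuous continuous_intros)
  then show i: "integrable (iv l) (mollifier a \<epsilon>)"
    using L2_integrable integrable_Re by force
  have "complex_of_real (bump_prim a \<epsilon> l / bump_prim a \<epsilon> (a + \<epsilon>)) = complex_of_real (bump_prim a \<epsilon> 0 / bump_prim a \<epsilon> (a + \<epsilon>)) + prim l (\<lambda>x. of_real (mollifier a \<epsilon> x)) l"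
  proof (rule prim_FTC [where S = "{}"])
    have d: "((\<lambda>x. bump_prim a \<epsilon> x / bump_prim a \<epsilon> (a + \<epsilon>)) has_real_derivative mollifier a \<epsilon> x) (at x)" for x
      unfolding mollifier_def using \<epsilon> by (intro DERIV_cdivide bump_prim_derivative)
    show "((\<lambda>x. complex_of_real (bump_prim a \<epsilon> x / bump_prim a \<epsilon> (a + \<epsilon>))) has_vector_derivative complex_of_real (mollifier a \<epsilon> x)) (at x)" for x
      using d by (intro has_vector_derivative_of_real)
    have "continuous_on {0..l} (\<lambda>x. bump_prim a \<epsilon> x / bump_prim a \<epsilon> (a + \<epsilon>))"
      using d by (intro continuous_at_imp_continuous_on) (auto intro: DERIV_isCont)
    then show "continuous_on {0..l} (\<lambda>x. complex_of_real (bump_prim a \<epsilon> x / bump_prim a \<epsilon> (a + \<epsilon>)))"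
      by (rule continuous_on_of_real)
  qed (use m \<epsilon> in auto)
  also have "bump_prim a \<epsilon> 0 = 0" using \<epsilon> by (intro bump_prim_left) auto
  also have "bump_prim a \<epsilon> l = bump_prim a \<epsilon> (a + \<epsilon>)" using \<epsilon> by (intro bump_prim_right) auto
  finally have "complex_of_real (LINT x|iv l. mollifier a \<epsilon> x) = 1"
    using bump_prim_pos [of \<epsilon> a] \<epsilon> by (simp add: prim_end)
  then show "(LINT x|iv l. mollifier a \<epsilon> x) = 1" by simp
qed

text \<open>Closeness to \<open>u a\<close> is required only near \<open>a\<close>. The lemma can
  therefore also be applied to the potential, which is continuous inside an edge but need not extend
  continuously to its ends.\<close>

lemma mollifier_concentration:
  fixes u :: "real \<Rightarrow> complex"
  assumes u: "integrable (iv l) (\<lambda>x. u x * of_real (mollifier a \<epsilon> x))" and \<epsilon>: "0 < \<epsilon>" "0 < a - \<epsilon>" "a + \<epsilon> < l"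
    and near: "\<And>x. \<bar>x - a\<bar> < \<epsilon> \<Longrightarrow> cmod (u x - u a) \<le> e"
  shows "cmod ((LINT x|iv l. u x * of_real (mollifier a \<epsilon> x)) - u a) \<le> e"
proof -
  have m: "integrable (iv l) (\<lambda>x. u a * complex_of_real (mollifier a \<epsilon> x))"
    using mollifier_integral(2) [OF \<epsilon>] by simp
  have pos: "0 \<le> mollifier a \<epsilon> x" for x
    using bump_prim_pos [of \<epsilon> a] \<epsilon> by (simp add: mollifier_def bump_nonneg)
  have "(LINT x|iv l. u x * of_real (mollifier a \<epsilon> x)) - u a = (LINT x|iv l. u x * of_real (mollifier a \<epsilon> x) - u a * of_real (mollifier a \<epsilon> x))"
    using u m mollifier_integral [OF \<epsilon>] by simp
  also have "cmod \<dots> \<le> (LINT x|iv l. e * mollifier a \<epsilon> x)"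
  proof (rule Bochner_Integration.integral_norm_bound_integral)
    fix x
    show "norm (u x * of_real (mollifier a \<epsilon> x) - u a * of_real (mollifier a \<epsilon> x)) \<le> e * mollifier a \<epsilon> x"
    proof (cases "\<bar>x - a\<bar> < \<epsilon>")
      case True
      then show ?thesis
        using near [OF True] pos [of x] by (simp add: norm_mult mult_right_mono flip: left_diff_distrib)
    next
      case False
      then show ?thesis by (simp add: mollifier_def bump_zero)
    qed
  qed (use u m mollifier_integral [OF \<epsilon>] in auto)
  also have "\<dots> = e" using mollifier_integral [OF \<epsilon>] by simp
  finally show ?thesis .
qed

lemma mollifier_product_integrable:
  assumes "u \<in> L2_interval l" "0 < \<epsilon>"
  shows "integrable (iv l) (\<lambda>x. u x * complex_of_real (mollifier a \<epsilon> x))"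
proof -
  have c: "continuous_on S (mollifier a \<epsilon>)" for S
    unfolding mollifier_def using bump_prim_pos [of \<epsilon> a] assms by (intro continuous_intros continuous_bump) auto
  have "(\<lambda>x. complex_of_real (mollifier a \<epsilon> x)) \<in> L2_interval l"
    using c by (intro L2_continuous continuous_intros)
  then show ?thesis using L2_product [OF assms(1)] by force
qed

text \<open>The lemma of du Bois-Reymond: the primitive of a difference of mollifiers is an
  admissible test function, and shrinking the mollifiers turns averages into values.\<close>

lemma weakly_constant:
  fixes u :: "real \<Rightarrow> complex"
  assumes u: "continuous_on {0..l} u"
    and 0: "\<And>\<phi>. test_function l \<phi> \<Longrightarrow> (LINT x|iv l. u x * of_real (deriv \<phi> x)) = 0"
    and ab: "a \<in> {0<..<l}" "b \<in> {0<..<l}"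
  shows "u a = u b"
proof -
  have "cmod (u a - u b) \<le> e" if "0 < e" for e
  proof -
    have "\<exists>d>0. \<forall>x. \<bar>x - c\<bar> < d \<longrightarrow> x \<in> {0..l} \<and> cmod (u x - u c) \<le> e / 2" if c: "c \<in> {0<..<l}" for c
    proof -
      obtain d where d: "d > 0" "\<And>x. x \<in> {0..l} \<Longrightarrow> \<bar>x - c\<bar> < d \<Longrightarrow> cmod (u x - u c) < e / 2"
        using u c \<open>0 < e\<close> unfolding continuous_on_iff dist_norm real_norm_def
        by (metis atLeastAtMost_iff greaterThanLessThan_iff half_gt_zero less_imp_le)
      show ?thesis
        using d c by (intro exI [of _ "min d (min c (l - c))"]) (auto simp: less_imp_le)
    qed
    from this [OF ab(1)] this [OF ab(2)] obtain d1 d2 where d: "d1 > 0" "\<And>x. \<bar>x - a\<bar> < d1 \<Longrightarrow> cmod (u x - u a) \<le> e / 2"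
      "d2 > 0" "\<And>x. \<bar>x - b\<bar> < d2 \<Longrightarrow> cmod (u x - u b) \<le> e / 2"
      by blast
    \<comment> \<open>Halving turns the non-strict bounds satisfied by \<open>m\<close> into the
      strict ones required of \<open>\<epsilon>\<close>.\<close>
    define m where "m = min (min (min d1 d2) (min a (l - a))) (min b (l - b))"
    define \<epsilon> where "\<epsilon> = m / 2"
    have "0 < m" "m \<le> d1" "m \<le> d2" "m \<le> a" "m \<le> l - a" "m \<le> b" "m \<le> l - b"
      using d(1,3) ab by (auto simp: m_def min_less_iff_conj min_le_iff_disj)
    then have \<epsilon>: "0 < \<epsilon>" "\<epsilon> < d1" "\<epsilon> < d2" "0 < a - \<epsilon>" "a + \<epsilon> < l" "0 < b - \<epsilon>" "b + \<epsilon> < l"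
      unfolding \<epsilon>_def by linarith+
    obtain \<phi> where \<phi>: "test_function l \<phi>" "\<And>x. deriv \<phi> x = mollifier a \<epsilon> x - mollifier b \<epsilon> x"
      using test_function_mollifier_difference [of \<epsilon> a l b] \<epsilon> by metis
    have i: "integrable (iv l) (\<lambda>x. u x * complex_of_real (mollifier c \<epsilon> x))" for c
      using \<epsilon> by (intro mollifier_product_integrable L2_continuous u)
    have "(LINT x|iv l. u x * of_real (mollifier a \<epsilon> x) - u x * of_real (mollifier b \<epsilon> x)) = 0"
      using 0 [OF \<phi>(1)] by (simp add: \<phi>(2) right_diff_distrib)
    then have eq: "(LINT x|iv l. u x * of_real (mollifier a \<epsilon> x)) = (LINT x|iv l. u x * of_real (mollifier b \<epsilon> x))"
      using i by simp
    have "cmod ((LINT x|iv l. u x * of_real (mollifier a \<epsilon> x)) - u a) \<le> e / 2"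
      "cmod ((LINT x|iv l. u x * of_real (mollifier b \<epsilon> x)) - u b) \<le> e / 2"
      using d \<epsilon> by (intro mollifier_concentration i; simp)+
    then show ?thesis
      unfolding eq using norm_triangle_ineq4 [of "(LINT x|iv l. u x * of_real (mollifier b \<epsilon> x)) - u b" "(LINT x|iv l. u x * of_real (mollifier b \<epsilon> x)) - u a"]
      by simp
  qed
  then have "cmod (u a - u b) \<le> 0" by (rule field_le_epsilon) auto
  then show ?thesis by simp
qed

text \<open>Subtracting the primitive of \<open>g\<close> from \<open>f\<close> leaves a weakly
  constant function. From here on the space \<open>graph_H1\<close> is handled through primitives,
  and distributional test functions no longer appear.\<close>

theorem has_weak_derivative_iff:
  assumes l: "0 < l" and f: "continuous_on {0..l} f"
  shows "has_weak_derivative l f g \<longleftrightarrow> g \<in> L2_interval l \<and> (\<forall>x\<in>{0..l}. f x = f 0 + prim l g x)"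
proof
  assume *: "has_weak_derivative l f g"
  then have g: "g \<in> L2_interval l" by (simp add: has_weak_derivative_def)
  define u where "u x = f x - prim l g x" for x
  have cu: "continuous_on {0..l} u"
    unfolding u_def using f prim_continuous [OF g] by (intro continuous_intros)
  have 0: "(LINT x|iv l. u x * of_real (deriv \<phi> x)) = 0" if \<phi>: "test_function l \<phi>" for \<phi>
  proof -
    have c: "(\<lambda>x. complex_of_real (deriv \<phi> x)) \<in> L2_interval l"
      using smooth_deriv(2) \<phi> by (intro L2_continuous continuous_intros) (auto simp: test_function_def)
    have i: "integrable (iv l) (\<lambda>x. v x * of_real (deriv \<phi> x))" if "continuous_on {0..l} v" for v :: "real \<Rightarrow> complex"
      using L2_product [OF L2_continuous [OF that] c] by simp
    have "has_weak_derivative l (prim l g) g"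
      by (rule has_weak_derivative_prim) (use l g in auto)
    then have "(LINT x|iv l. f x * of_real (deriv \<phi> x)) = (LINT x|iv l. prim l g x * of_real (deriv \<phi> x))"
      using * \<phi> by (simp add: has_weak_derivative_def)
    then show ?thesis
      using i [OF f] i [OF prim_continuous [OF g]] by (simp add: u_def left_diff_distrib)
  qed
  have "u x = u (l / 2)" if "x \<in> {0..l}" for x
  proof -
    have x: "x \<in> closure {0<..<l}" using that l by simp
    have c: "continuous_on (closure {0<..<l}) u" using cu l by simp
    have "u y = u (l / 2)" if "y \<in> {0<..<l}" for y
      using l that by (intro weakly_constant [OF cu 0]) auto
    then show ?thesis using continuous_constant_on_closure [OF c _ x, of "u (l / 2)"] by blast
  qed
  then have u0: "u x = u 0" if "x \<in> {0..l}" for x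
    using l that by (metis atLeastAtMost_iff less_imp_le order_refl)
  have "f x = f 0 + prim l g x" if "x \<in> {0..l}" for x
    using u0 [OF that] by (simp add: u_def algebra_simps)
  then show "g \<in> L2_interval l \<and> (\<forall>x\<in>{0..l}. f x = f 0 + prim l g x)" using g by blast
qed (use l has_weak_derivative_prim in blast)

lemma integral_iv_indicator:
  assumes "0 \<le> x" "x \<le> y" "y \<le> l"
  shows "(LINT t|iv l. indicator {x..<y} t) = y - x"
proof -
  have "(LINT t|iv l. indicator {x..<y} t) = measure (iv l) ({x..<y} \<inter> space (iv l))" by simp
  also have "\<dots> = measure lebesgue ({x..<y} \<inter> {0<..<l})"
    by (subst measure_restrict_space) auto
  also have "\<dots> = measure lebesgue {x<..<y}"
    by (rule measure_eq_AE) (use assms AE_lborel_singleton [of x] in \<open>auto intro!: AE_completion elim!: eventually_mono\<close>)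
  finally show ?thesis using assms by simp
qed

lemma measure_iv [simp]: "0 \<le> l \<Longrightarrow> measure (iv l) {0<..<l} = l"
  by (subst measure_restrict_space) auto

lemma indicator_integrable_iv [simp]: "integrable (iv l) (indicat_real {x..<y})"
  by (rule Bochner_Integration.integrable_bound [where f = "\<lambda>_. 1 :: real"])
    (auto intro: measurable_compose [OF id_measurable_iv])

lemma Re_ipI_le:
  assumes "0 \<le> l" "f \<in> L2_interval l" "\<And>x. x \<in> {0<..<l} \<Longrightarrow> cmod (f x) \<le> e"
  shows "Re (ipI l f f) \<le> l * e\<^sup>2"
proof -
  have "(LINT x|iv l. (cmod (f x))\<^sup>2) \<le> (LINT x|iv l. e\<^sup>2)"
    using assms by (intro integral_mono) (auto simp: L2_interval_def intro: power_mono)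
  then show ?thesis using assms by (simp add: Re_ipI_self)
qed

section \<open>Completeness of the space of square-integrable functions\<close>

lemma AE_convergent_of_fast_Cauchy:
  assumes f: "\<And>k. f k \<in> L2_interval l" and d: "\<And>k. Re (ipI l (f (Suc k) - f k) (f (Suc k) - f k)) \<le> (1/4) ^ k"
  shows "AE x in iv l. convergent (\<lambda>k. f k x)"
proof (cases "0 \<le> l")
  case False
  then show ?thesis by (auto intro!: AE_I2)
next
  case l: True
  define D where "D k x = cmod (f (Suc k) x - f k x)" for k x
  have DL: "(\<lambda>x. f (Suc k) x - f k x) \<in> L2_interval l" for k using f by (intro L2_diff)
  have Di: "integrable (iv l) (D k)" for k
    unfolding D_def using L2_integrable [OF DL] by (rule integrable_norm)
  have le: "(LINT x|iv l. D k x) \<le> (1 + l) * (1/2) ^ k" for k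
  proof -
    \<comment> \<open>Young's inequality \<open>D \<le> 2^k D^2 + 2^-k\<close> exchanges the
      quadratic decay \<open>4^-k\<close> for a summable bound of the linear integral; the measure
      of the interval is finite.\<close>
    have "(LINT x|iv l. D k x) \<le> (LINT x|iv l. 2 ^ k * (D k x)\<^sup>2 + (1/2) ^ k)"
    proof (rule integral_mono [OF Di])
      show "integrable (iv l) (\<lambda>x. 2 ^ k * (D k x)\<^sup>2 + (1/2) ^ k)"
        using DL [of k] unfolding D_def L2_interval_def by (intro Bochner_Integration.integrable_add) auto
      fix x
      have "2 * D k x \<le> 2 ^ k * (D k x)\<^sup>2 + (1/2) ^ k"
        using zero_le_power2 [of "2 ^ k * D k x - 1"]
        by (simp add: power2_eq_square field_simps)
      moreover have "0 \<le> D k x" by (simp add: D_def)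
      ultimately show "D k x \<le> 2 ^ k * (D k x)\<^sup>2 + (1/2) ^ k" by linarith
    qed
    also have "\<dots> = 2 ^ k * (LINT x|iv l. (D k x)\<^sup>2) + l * (1/2) ^ k"
      using DL [of k] l unfolding D_def L2_interval_def by (subst Bochner_Integration.integral_add) auto
    also have "(LINT x|iv l. (D k x)\<^sup>2) \<le> (1/4) ^ k"
      using d [of k] by (simp add: Re_ipI_self D_def)
    also have "2 ^ k * (1/4 :: real) ^ k = (1/2) ^ k"
      by (simp flip: power_mult_distrib)
    finally show ?thesis by (simp add: algebra_simps)
  qed
  have [measurable]: "D k \<in> borel_measurable (iv l)" for k using Di by auto
  have "(\<integral>\<^sup>+ x. (\<Sum>k. ennreal (D k x)) \<partial>iv l) = (\<Sum>k. \<integral>\<^sup>+ x. ennreal (D k x) \<partial>iv l)"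
    by (rule nn_integral_suminf) measurable
  also have "\<dots> = (\<Sum>k. ennreal (LINT x|iv l. D k x))"
    using Di by (subst nn_integral_eq_integral) (auto simp: D_def)
  also have "\<dots> \<noteq> \<infinity>"
  proof -
    have "summable (\<lambda>k. (LINT x|iv l. D k x))"
    proof (rule summable_comparison_test')
      show "summable (\<lambda>k. (1 + l) * (1/2 :: real) ^ k)" by (intro summable_mult summable_geometric) simp
      show "norm (LINT x|iv l. D k x) \<le> (1 + l) * (1/2) ^ k" if "k \<ge> 0" for k
        using le [of k] by (simp add: D_def)
    qed
    then show ?thesis by (simp add: ennreal_suminf_neq_top D_def)
  qed
  finally have "AE x in iv l. (\<Sum>k. ennreal (D k x)) \<noteq> \<infinity>"
    by (intro nn_integral_PInf_AE) auto
  then show ?thesis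
  proof eventually_elim
    case (elim x)
    then have "summable (\<lambda>k. D k x)"
      by (intro summable_suminf_not_top) (auto simp: D_def)
    then have "summable (\<lambda>k. f (Suc k) x - f k x)"
      unfolding D_def by (rule summable_norm_cancel)
    then have "convergent (\<lambda>n. f 0 x + (\<Sum>k<n. f (Suc k) x - f k x))"
      by (intro convergent_add convergent_const) (simp add: summable_iff_convergent)
    then show ?case by (simp add: sum_lessThan_telescope [of "\<lambda>k. f k x"])
  qed
qed

text \<open>Riesz-Fischer: a rapidly converging subsequence has an almost everywhere limit, and
  Fatou's lemma shows that the whole sequence converges to it in norm.\<close>

theorem L2_complete:
  assumes f: "\<And>n. f n \<in> L2_interval l"
    and Cauchy: "\<And>e. e > 0 \<Longrightarrow> \<exists>N. \<forall>m\<ge>N. \<forall>n\<ge>N. Re (ipI l (f m - f n) (f m - f n)) < e"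
  shows "\<exists>g\<in>L2_interval l. (\<lambda>n. Re (ipI l (f n - g) (f n - g))) \<longlonglongrightarrow> 0"
proof -
  have "\<exists>N. \<forall>m\<ge>N. \<forall>n\<ge>N. Re (ipI l (f m - f n) (f m - f n)) < (1/4) ^ k" for k
    by (rule Cauchy) simp
  then obtain N where N: "\<And>k m n. m \<ge> N k \<Longrightarrow> n \<ge> N k \<Longrightarrow> Re (ipI l (f m - f n) (f m - f n)) < (1/4) ^ k"
    by metis
  \<comment> \<open>The sum dominates \<open>N k\<close> both at index \<open>k\<close> and at
    \<open>Suc k\<close>, and the summand \<open>k\<close> makes the indices tend to
    infinity.\<close>
  define r where "r k = k + (\<Sum>i\<le>k. N i)" for k
  have rN: "r k \<ge> N k" "r (Suc k) \<ge> N k" "r k \<ge> k" for k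
    using member_le_sum [of k "{..k}" N] by (auto simp: r_def)
  have "AE x in iv l. convergent (\<lambda>k. f (r k) x)"
    by (intro AE_convergent_of_fast_Cauchy f less_imp_le [OF N] rN)
  then have lim: "AE x in iv l. (\<lambda>k. f (r k) x) \<longlonglongrightarrow> lim (\<lambda>k. f (r k) x)"
    by eventually_elim (simp add: convergent_LIMSEQ_iff)
  define g where "g x = lim (\<lambda>k. f (r k) x)" for x
  have [measurable]: "f n \<in> borel_measurable (iv l)" for n using f L2_measurable by blast
  have [measurable]: "g \<in> borel_measurable (iv l)"
    unfolding g_def by (rule borel_measurable_lim_metric) measurable
  \<comment> \<open>Nonnegative integrals, because the integrability of \<open>g\<close> is a
    consequence of this estimate.\<close>
  have key: "(\<integral>\<^sup>+ x. ennreal ((cmod (f m x - g x))\<^sup>2) \<partial>iv l) \<le> ennreal e"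
    if e: "\<And>n. n \<ge> M \<Longrightarrow> Re (ipI l (f m - f n) (f m - f n)) < e" for m M e
  proof -
    have "(\<integral>\<^sup>+ x. ennreal ((cmod (f m x - g x))\<^sup>2) \<partial>iv l) = (\<integral>\<^sup>+ x. liminf (\<lambda>k. ennreal ((cmod (f m x - f (r k) x))\<^sup>2)) \<partial>iv l)"
    proof (rule nn_integral_cong_AE)
      show "AE x in iv l. ennreal ((cmod (f m x - g x))\<^sup>2) = liminf (\<lambda>k. ennreal ((cmod (f m x - f (r k) x))\<^sup>2))"
        using lim
      proof eventually_elim
        case (elim x)
        then have "(\<lambda>k. ennreal ((cmod (f m x - f (r k) x))\<^sup>2)) \<longlonglongrightarrow> ennreal ((cmod (f m x - g x))\<^sup>2)"
          unfolding g_def by (intro tendsto_intros tendsto_ennrealI)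
        from lim_imp_Liminf [OF trivial_limit_sequentially this] show ?case by (rule sym)
      qed
    qed
    also have "\<dots> \<le> liminf (\<lambda>k. \<integral>\<^sup>+ x. ennreal ((cmod (f m x - f (r k) x))\<^sup>2) \<partial>iv l)"
      by (rule nn_integral_liminf) measurable
    also have "\<dots> \<le> ennreal e"
    proof -
      have "(\<integral>\<^sup>+ x. ennreal ((cmod (f m x - f (r k) x))\<^sup>2) \<partial>iv l) \<le> ennreal e" if "k \<ge> M" for k
      proof -
        have "(\<lambda>x. f m x - f (r k) x) \<in> L2_interval l" using f by (intro L2_diff)
        then have "(\<integral>\<^sup>+ x. ennreal ((cmod (f m x - f (r k) x))\<^sup>2) \<partial>iv l) = ennreal (Re (ipI l (f m - f (r k)) (f m - f (r k))))"
          by (simp add: Re_ipI_self nn_integral_eq_integral L2_interval_def)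
        then show ?thesis
          using e [of "r k"] rN(3) [of k] that by (simp add: ennreal_leI less_imp_le)
      qed
      then have "\<forall>\<^sub>F k in sequentially. (\<integral>\<^sup>+ x. ennreal ((cmod (f m x - f (r k) x))\<^sup>2) \<partial>iv l) \<le> ennreal e"
        using eventually_sequentially by blast
      then have "liminf (\<lambda>k. \<integral>\<^sup>+ x. ennreal ((cmod (f m x - f (r k) x))\<^sup>2) \<partial>iv l) \<le> liminf (\<lambda>k::nat. ennreal e)"
        by (rule Liminf_mono)
      then show ?thesis by (simp add: Liminf_const)
    qed
    finally show ?thesis .
  qed
  have diff: "(\<lambda>x. f m x - g x) \<in> L2_interval l" "Re (ipI l (f m - g) (f m - g)) \<le> e"
    if "\<And>n. n \<ge> M \<Longrightarrow> Re (ipI l (f m - f n) (f m - f n)) < e" "e > 0" for m M e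
  proof -
    have k: "(\<integral>\<^sup>+ x. ennreal ((cmod (f m x - g x))\<^sup>2) \<partial>iv l) \<le> ennreal e"
      using that(1) by (rule key)
    have i: "integrable (iv l) (\<lambda>x. (cmod (f m x - g x))\<^sup>2)"
    proof (rule integrableI_bounded)
      show "(\<integral>\<^sup>+ x. ennreal (norm ((cmod (f m x - g x))\<^sup>2)) \<partial>iv l) < \<infinity>"
        using le_less_trans [OF k ennreal_less_top] by simp
    qed measurable
    then show "(\<lambda>x. f m x - g x) \<in> L2_interval l" by (simp add: L2_interval_def)
    have "ennreal (LINT x|iv l. (cmod (f m x - g x))\<^sup>2) \<le> ennreal e"
      using k i by (simp add: nn_integral_eq_integral)
    then show "Re (ipI l (f m - g) (f m - g)) \<le> e"
      using that(2) by (simp add: Re_ipI_self)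
  qed
  obtain M where M: "\<And>n. n \<ge> M \<Longrightarrow> Re (ipI l (f M - f n) (f M - f n)) < 1"
    using Cauchy [of 1] by auto
  have gL: "g \<in> L2_interval l"
    using L2_diff [OF f [of M] diff(1) [OF M]] by simp
  have "(\<lambda>n. Re (ipI l (f n - g) (f n - g))) \<longlonglongrightarrow> 0"
  proof (rule LIMSEQ_I)
    fix e :: real assume "0 < e"
    then obtain M where M: "\<And>m n. m \<ge> M \<Longrightarrow> n \<ge> M \<Longrightarrow> Re (ipI l (f m - f n) (f m - f n)) < e / 2"
      using Cauchy [of "e / 2"] by auto
    have "norm (Re (ipI l (f m - g) (f m - g)) - 0) < e" if "m \<ge> M" for m
      using diff(2) [of M m "e / 2"] M that ipI_nonneg [of l "f m - g"] \<open>0 < e\<close> by force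
    then show "\<exists>no. \<forall>n\<ge>no. norm (Re (ipI l (f n - g) (f n - g)) - 0) < e" by blast
  qed
  then show ?thesis using gL by blast
qed

section \<open>Pointwise estimates on an edge\<close>

lemma Hoelder:
  assumes f: "\<And>x. x \<in> {0..l} \<Longrightarrow> f x = f 0 + prim l g x" and g: "g \<in> L2_interval l"
    and xy: "x \<in> {0..l}" "y \<in> {0..l}"
  shows "(cmod (f x - f y))\<^sup>2 \<le> \<bar>x - y\<bar> * Re (ipI l g g)"
proof -
  have "f x - f y = prim l g x - prim l g y" using f [OF xy(1)] f [OF xy(2)] by simp
  then show ?thesis
    using prim_Hoelder [OF g, of x y] prim_Hoelder [OF g, of y x] xy
    by (cases "x \<le> y") (auto simp: norm_minus_commute)
qed

text \<open>The bound for \<open>f x\<close> in terms of \<open>f y\<close> is averaged over a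
  window of length \<open>\<delta>\<close> around \<open>x\<close>. After division by
  \<open>\<delta>\<close> the Dirichlet part carries the factor \<open>2 \<delta>\<close>, and the
  freedom to make it small lets the vertex terms be dominated by half of the Dirichlet form.\<close>

lemma Sobolev:
  assumes f: "\<And>x. x \<in> {0..l} \<Longrightarrow> f x = f 0 + prim l g x" and g: "g \<in> L2_interval l"
    and fL: "f \<in> L2_interval l" and x: "x \<in> {0..l}" and \<delta>: "0 < \<delta>" "\<delta> \<le> l"
  shows "\<delta> * (cmod (f x))\<^sup>2 \<le> 2 * Re (ipI l f f) + 2 * \<delta>\<^sup>2 * Re (ipI l g g)"
proof -
  \<comment> \<open>The window starts at \<open>x\<close> unless that would make it leave the edge
    at its right end.\<close>
  define c where "c = min x (l - \<delta>)"
  have c: "0 \<le> c" "c + \<delta> \<le> l" "c \<le> x" "x \<le> c + \<delta>" using x \<delta> by (auto simp: c_def)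
  let ?G = "Re (ipI l g g)"
  have le: "(cmod (f x))\<^sup>2 \<le> 2 * (cmod (f y))\<^sup>2 + 2 * \<delta> * ?G" if y: "y \<in> {c..<c + \<delta>}" for y
  proof -
    have "(cmod (f x))\<^sup>2 \<le> (cmod (f y) + cmod (f x - f y))\<^sup>2"
      by (intro power_mono) (metis norm_triangle_sub, simp)
    also have "\<dots> \<le> 2 * (cmod (f y))\<^sup>2 + 2 * (cmod (f x - f y))\<^sup>2"
      using sum_squares_bound [of "cmod (f y)" "cmod (f x - f y)"] by (simp add: power2_sum)
    also have "(cmod (f x - f y))\<^sup>2 \<le> \<bar>x - y\<bar> * ?G"
      using y c x by (intro Hoelder [OF f g]) auto
    also have "\<bar>x - y\<bar> * ?G \<le> \<delta> * ?G"
      using y c by (intro mult_right_mono ipI_nonneg) auto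
    finally show ?thesis by simp
  qed
  have fi: "integrable (iv l) (\<lambda>y. (cmod (f y))\<^sup>2)" using fL by (simp add: L2_interval_def)
  have ind: "integrable (iv l) (\<lambda>y. indicator {c..<c + \<delta>} y * (a::real))" for a
    by simp
  have "(LINT y|iv l. indicator {c..<c + \<delta>} y * (cmod (f x))\<^sup>2)
      \<le> (LINT y|iv l. 2 * (cmod (f y))\<^sup>2 + indicator {c..<c + \<delta>} y * (2 * \<delta> * ?G))"
  proof (rule integral_mono)
    show "integrable (iv l) (\<lambda>y. 2 * (cmod (f y))\<^sup>2 + indicator {c..<c + \<delta>} y * (2 * \<delta> * ?G))"
      using fi ind by (intro Bochner_Integration.integrable_add) auto
    show "indicator {c..<c + \<delta>} y * (cmod (f x))\<^sup>2 \<le> 2 * (cmod (f y))\<^sup>2 + indicator {c..<c + \<delta>} y * (2 * \<delta> * ?G)" for y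
      using le [of y] by (auto simp: indicator_def)
  qed (use ind in auto)
  also have "\<dots> = 2 * Re (ipI l f f) + \<delta> * (2 * \<delta> * ?G)"
    using fi c \<delta> integral_iv_indicator [of c "c + \<delta>" l] by (subst Bochner_Integration.integral_add) (auto simp: Re_ipI_self)
  finally show ?thesis
    using c \<delta> integral_iv_indicator [of c "c + \<delta>" l] by (simp add: power2_eq_square algebra_simps)
qed

lemma Linf_bound:
  assumes "q \<in> Linf_interval l"
  obtains K where "0 \<le> K" "AE x in iv l. \<bar>q x\<bar> \<le> K"
proof -
  obtain C where "AE x in iv l. \<bar>q x\<bar> \<le> C" using assms by (auto simp: Linf_interval_def)
  then have "AE x in iv l. \<bar>q x\<bar> \<le> max 0 C" by eventually_elim auto
  then show ?thesis using that [of "max 0 C"] by auto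
qed

lemma L2_mult:
  assumes q: "q \<in> borel_measurable (iv l)" and K: "AE x in iv l. \<bar>q x\<bar> \<le> K" and f: "f \<in> L2_interval l"
  shows "(\<lambda>x. of_real (q x) * f x) \<in> L2_interval l"
    "Re (ipI l (\<lambda>x. of_real (q x) * f x) (\<lambda>x. of_real (q x) * f x)) \<le> K\<^sup>2 * Re (ipI l f f)"
proof -
  have [measurable]: "f \<in> borel_measurable (iv l)" "q \<in> borel_measurable (iv l)" using f q L2_measurable by auto
  have le: "AE x in iv l. (cmod (of_real (q x) * f x))\<^sup>2 \<le> K\<^sup>2 * (cmod (f x))\<^sup>2"
    using K
  proof eventually_elim
    case (elim x)
    then have "\<bar>q x\<bar>\<^sup>2 \<le> K\<^sup>2" by (intro power_mono) auto
    then show ?case by (simp add: norm_mult power_mult_distrib mult_right_mono)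
  qed
  have fi: "integrable (iv l) (\<lambda>x. K\<^sup>2 * (cmod (f x))\<^sup>2)" using f by (simp add: L2_interval_def)
  have i: "integrable (iv l) (\<lambda>x. (cmod (of_real (q x) * f x))\<^sup>2)"
    by (rule Bochner_Integration.integrable_bound [OF fi]) (use le in auto)
  then show "(\<lambda>x. of_real (q x) * f x) \<in> L2_interval l" by (simp add: L2_interval_def)
  have "(LINT x|iv l. (cmod (of_real (q x) * f x))\<^sup>2) \<le> (LINT x|iv l. K\<^sup>2 * (cmod (f x))\<^sup>2)"
    by (rule integral_mono_AE [OF i fi le])
  then show "Re (ipI l (\<lambda>x. of_real (q x) * f x) (\<lambda>x. of_real (q x) * f x)) \<le> K\<^sup>2 * Re (ipI l f f)"
    by (simp add: Re_ipI_self)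
qed

section \<open>Forms on a metric graph\<close>

text \<open>\<open>weak_derivative\<close> is an arbitrary choice and depends linearly on its
  argument only almost everywhere, so the linearity of the forms rests on this lemma.\<close>

lemma ipI_cong_AE:
  assumes "AE x in iv l. f x = f' x" "f \<in> L2_interval l" "f' \<in> L2_interval l" "g \<in> L2_interval l"
  shows "ipI l f g = ipI l f' g"
  unfolding ipI_def
proof (rule Bochner_Integration.integral_cong_AE)
  show "AE x in iv l. f x * cnj (g x) = f' x * cnj (g x)"
    using assms(1) by eventually_elim simp
qed (use L2_product assms in \<open>blast intro: borel_measurable_integrable\<close>)+

lemma graph_inner_ipI: "graph_inner G len f g = (\<Sum>e\<in>arcs G. ipI (len e) (f e) (g e))"
  by (simp add: graph_inner_def graph_integral_def ipI_def)

lemma schroedinger_form_ipI: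
  "schroedinger_form G len q \<sigma> f g =
     (\<Sum>e\<in>arcs G. ipI (len e) (weak_derivative (len e) (f e)) (weak_derivative (len e) (g e))) +
     (\<Sum>e\<in>arcs G. ipI (len e) (\<lambda>x. of_real (q e x) * f e x) (g e)) +
     (\<Sum>v\<in>verts G. of_real (\<sigma> v) * (vertex_value G len f v * cnj (vertex_value G len g v)))"
  by (simp add: schroedinger_form_def graph_integral_def ipI_def mult.assoc)

section \<open>The form domain on the graph\<close>

context metric_graph
begin

abbreviation "H1 \<equiv> graph_H1 G len"
abbreviation D :: "('e \<Rightarrow> real \<Rightarrow> complex) \<Rightarrow> 'e \<Rightarrow> real \<Rightarrow> complex" where
  "D f e \<equiv> weak_derivative (len e) (f e)"
abbreviation "vv \<equiv> vertex_value G len"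

text \<open>In a connected graph with at least one arc no vertex is isolated: a vertex that is not
  the tail of the given arc starts a nontrivial undirected walk to it. This makes vertex values well
  defined and degrees positive.\<close>

lemma incident_arc:
  assumes v: "v \<in> verts G"
  shows "\<exists>e\<in>arcs G. tail G e = v \<or> head G e = v"
proof -
  obtain e where e: "e \<in> arcs G" using arcs_nonempty by blast
  show ?thesis
  proof (cases "tail G e = v")
    case False
    have "v \<rightarrow>\<^sup>*\<^bsub>with_proj (mk_symmetric G)\<^esub> tail G e"
      using connected v e unfolding Digraph_Component.connected_def strongly_connected_def by simp
    then obtain w where "v \<rightarrow>\<^bsub>with_proj (mk_symmetric G)\<^esub> w"
      using False by (cases rule: pre_digraph.converse_reachable_cases) auto
    then show ?thesis by (auto simp: mk_symmetric_def arcs_ends_def arc_to_ends_def)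
  qed (use e in blast)
qed

lemma H1_C: "f \<in> H1 \<Longrightarrow> f \<in> graph_C G len"
  by (simp add: graph_H1_def)

lemma H1_continuous: "f \<in> H1 \<Longrightarrow> e \<in> arcs G \<Longrightarrow> continuous_on {0..len e} (f e)"
  by (simp add: graph_H1_def graph_C_def)

lemma H1_L2: "f \<in> H1 \<Longrightarrow> e \<in> arcs G \<Longrightarrow> f e \<in> L2_interval (len e)"
  by (intro L2_continuous H1_continuous)

lemma H1_has_weak_derivative:
  "f \<in> H1 \<Longrightarrow> e \<in> arcs G \<Longrightarrow> has_weak_derivative (len e) (f e) (D f e)"
  using someI_ex [of "has_weak_derivative (len e) (f e)"]
  by (auto simp: graph_H1_def H1_interval_def weak_derivative_def)

lemma D_L2: "f \<in> H1 \<Longrightarrow> e \<in> arcs G \<Longrightarrow> D f e \<in> L2_interval (len e)"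
  using H1_has_weak_derivative by (simp add: has_weak_derivative_def)

lemma D_FTC: "f \<in> H1 \<Longrightarrow> e \<in> arcs G \<Longrightarrow> x \<in> {0..len e} \<Longrightarrow> f e x = f e 0 + prim (len e) (D f e) x"
  using H1_has_weak_derivative [of f e] has_weak_derivative_iff [OF len_pos [of e] H1_continuous [of f e], of "D f e"] by blast

lemma D_unique:
  assumes f: "f \<in> H1" and e: "e \<in> arcs G" and g: "g \<in> L2_interval (len e)"
    and FTC: "\<And>x. x \<in> {0..len e} \<Longrightarrow> f e x = f e 0 + prim (len e) g x"
  shows "AE x in iv (len e). D f e x = g x"
proof -
  have "AE x in iv (len e). D f e x - g x = 0"
  proof (rule prim_AE_zero)
    show "(\<lambda>x. D f e x - g x) \<in> L2_interval (len e)" using D_L2 [OF f e] g by (rule L2_diff)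
    show "prim (len e) (\<lambda>x. D f e x - g x) x = 0" if "x \<in> {0..len e}" for x
      using FTC [OF that] D_FTC [OF f e that] prim_diff [OF D_L2 [OF f e] g] by simp
  qed
  then show ?thesis by simp
qed

lemma H1_I:
  assumes f: "f \<in> graph_C G len"
    and g: "\<And>e. e \<in> arcs G \<Longrightarrow> \<exists>g\<in>L2_interval (len e). \<forall>x\<in>{0..len e}. f e x = f e 0 + prim (len e) g x"
  shows "f \<in> H1"
  unfolding graph_H1_def H1_interval_def
proof (intro CollectI conjI ballI f)
  fix e assume e: "e \<in> arcs G"
  then show "\<exists>g. has_weak_derivative (len e) (f e) g"
    using g [OF e] has_weak_derivative_prim [OF len_pos [OF e], of _ "f e"] by blast
qed

lemma vv_exists:
  assumes f: "f \<in> graph_C G len" and v: "v \<in> verts G"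
  shows "\<forall>e\<in>arcs G. (tail G e = v \<longrightarrow> f e 0 = vv f v) \<and> (head G e = v \<longrightarrow> f e (len e) = vv f v)"
proof -
  obtain z where z: "\<forall>e\<in>arcs G. (tail G e = v \<longrightarrow> f e 0 = z) \<and> (head G e = v \<longrightarrow> f e (len e) = z)"
    using f v unfolding graph_C_def by blast
  obtain e where e: "e \<in> arcs G" "tail G e = v \<or> head G e = v" using incident_arc [OF v] by blast
  have "vv f v = z"
    unfolding vertex_value_def
  proof (rule the_equality)
    fix z' assume z': "\<forall>e\<in>arcs G. (tail G e = v \<longrightarrow> f e 0 = z') \<and> (head G e = v \<longrightarrow> f e (len e) = z')"
    show "z' = z" using e bspec [OF z e(1)] bspec [OF z' e(1)] by auto
  qed (rule z)
  then show ?thesis using z by (simp only:)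
qed

lemma vv_tail: "f \<in> graph_C G len \<Longrightarrow> e \<in> arcs G \<Longrightarrow> vv f (tail G e) = f e 0"
  using vv_exists by force

lemma vv_head: "f \<in> graph_C G len \<Longrightarrow> e \<in> arcs G \<Longrightarrow> vv f (head G e) = f e (len e)"
  using vv_exists by force

text \<open>The point is chosen independently of \<open>f\<close>, so identities and bounds for
  vertex values reduce to pointwise ones.\<close>

lemma vv_point:
  assumes "v \<in> verts G"
  obtains e x where "e \<in> arcs G" "x \<in> {0..len e}" "\<And>f. f \<in> graph_C G len \<Longrightarrow> vv f v = f e x"
proof -
  obtain e where "e \<in> arcs G" "tail G e = v \<or> head G e = v" using incident_arc [OF assms] by blast
  then consider "e \<in> arcs G" "tail G e = v" | "e \<in> arcs G" "head G e = v" by blast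
  then show ?thesis
  proof cases
    case 1
    then show ?thesis using that [of e 0] vv_tail [OF _ 1(1)] len_pos [of e] by simp
  next
    case 2
    then show ?thesis using that [of e "len e"] vv_head [OF _ 2(1)] len_pos [of e] by simp
  qed
qed

lemma C_continuous: "f \<in> graph_C G len \<Longrightarrow> e \<in> arcs G \<Longrightarrow> continuous_on {0..len e} (f e)"
  by (simp add: graph_C_def)

lemma C_outside: "f \<in> graph_C G len \<Longrightarrow> e \<notin> arcs G \<or> x < 0 \<or> len e < x \<Longrightarrow> f e x = 0"
  by (auto simp: graph_C_def)

lemma graph_C_I:
  assumes "\<And>e. e \<in> arcs G \<Longrightarrow> continuous_on {0..len e} (f e)"
    and "\<And>e. e \<in> arcs G \<Longrightarrow> f e 0 = z (tail G e)" "\<And>e. e \<in> arcs G \<Longrightarrow> f e (len e) = z (head G e)"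
    and "\<And>e x. e \<notin> arcs G \<or> x < 0 \<or> len e < x \<Longrightarrow> f e x = 0"
  shows "f \<in> graph_C G len"
  unfolding graph_C_def using assms by (auto simp: not_le)

lemma C_add: "f \<in> graph_C G len \<Longrightarrow> g \<in> graph_C G len \<Longrightarrow> f + g \<in> graph_C G len"
proof (rule graph_C_I [where z = "\<lambda>v. vv f v + vv g v"])
  assume fg: "f \<in> graph_C G len" "g \<in> graph_C G len"
  show "continuous_on {0..len e} ((f + g) e)" if "e \<in> arcs G" for e
    using continuous_on_add [OF C_continuous [OF fg(1) that] C_continuous [OF fg(2) that]] by (simp add: plus_fun_def)
qed (auto simp: vv_tail vv_head C_outside)

lemma C_scale: "f \<in> graph_C G len \<Longrightarrow> (\<lambda>e x. c * f e x) \<in> graph_C G len"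
proof (rule graph_C_I [where z = "\<lambda>v. c * vv f v"])
  assume f: "f \<in> graph_C G len"
  show "continuous_on {0..len e} (\<lambda>x. c * f e x)" if "e \<in> arcs G" for e
    using C_continuous [OF f that] by (intro continuous_intros)
qed (auto simp: vv_tail vv_head C_outside)

lemma vv_add:
  assumes "f \<in> graph_C G len" "g \<in> graph_C G len" "v \<in> verts G"
  shows "vv (f + g) v = vv f v + vv g v"
proof -
  obtain e x where "\<And>f. f \<in> graph_C G len \<Longrightarrow> vv f v = f e x" using vv_point [OF assms(3)] by blast
  then show ?thesis using assms C_add [OF assms(1,2)] by simp
qed

lemma vv_scale:
  assumes "f \<in> graph_C G len" "v \<in> verts G"
  shows "vv (\<lambda>e x. c * f e x) v = c * vv f v"
proof -
  obtain e x where "\<And>f. f \<in> graph_C G len \<Longrightarrow> vv f v = f e x" using vv_point [OF assms(2)] by blast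
  then show ?thesis using assms C_scale [OF assms(1)] by simp
qed

lemma D_add_FTC:
  assumes f: "f \<in> H1" and g: "g \<in> H1" and e: "e \<in> arcs G" and x: "x \<in> {0..len e}"
  shows "(f + g) e x = (f + g) e 0 + prim (len e) (\<lambda>x. D f e x + D g e x) x"
  using D_FTC [OF f e x] D_FTC [OF g e x] prim_add [OF D_L2 [OF f e] D_L2 [OF g e]] by simp

lemma H1_add:
  assumes f: "f \<in> H1" and g: "g \<in> H1"
  shows "f + g \<in> H1"
proof (rule H1_I)
  show "\<exists>k\<in>L2_interval (len e). \<forall>x\<in>{0..len e}. (f + g) e x = (f + g) e 0 + prim (len e) k x" if "e \<in> arcs G" for e
    using D_add_FTC [OF f g that] L2_add [OF D_L2 [OF f that] D_L2 [OF g that]] by blast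
qed (intro C_add H1_C f g)

lemma D_scale_FTC:
  assumes f: "f \<in> H1" and e: "e \<in> arcs G" and x: "x \<in> {0..len e}"
  shows "c * f e x = c * f e 0 + prim (len e) (\<lambda>x. c * D f e x) x"
  by (subst D_FTC [OF f e x]) (simp add: prim_scale distrib_left)

lemma H1_scale:
  assumes f: "f \<in> H1"
  shows "(\<lambda>e x. c * f e x) \<in> H1"
proof (rule H1_I)
  show "\<exists>k\<in>L2_interval (len e). \<forall>x\<in>{0..len e}. c * f e x = c * f e 0 + prim (len e) k x" if "e \<in> arcs G" for e
    using D_scale_FTC [OF f that] L2_scale [OF D_L2 [OF f that]] by blast
qed (intro C_scale H1_C f)

lemma D_add: "f \<in> H1 \<Longrightarrow> g \<in> H1 \<Longrightarrow> e \<in> arcs G \<Longrightarrow> AE x in iv (len e). D (f + g) e x = D f e x + D g e x"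
  by (intro D_unique H1_add D_add_FTC L2_add D_L2)

lemma D_scale: "f \<in> H1 \<Longrightarrow> e \<in> arcs G \<Longrightarrow> AE x in iv (len e). D (\<lambda>e x. c * f e x) e x = c * D f e x"
  by (intro D_unique [of "\<lambda>e x. c * f e x"] H1_scale D_scale_FTC L2_scale D_L2)

lemma H1_zero: "0 \<in> H1"
proof (rule H1_I)
  show "\<exists>g\<in>L2_interval (len e). \<forall>x\<in>{0..len e}. 0 e x = 0 e 0 + prim (len e) g x" for e
    using L2_const [of 0 "len e"] by (intro bexI [of _ "\<lambda>_. 0"]) (auto simp: prim_def)
qed (auto simp: graph_C_def)

lemma subspace_H1: "graph_fun.subspace H1"
  unfolding graph_fun.subspace_def using H1_add H1_scale H1_zero by blast

lemma subspace_L2: "graph_fun.subspace (graph_L2 G len)"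
  unfolding graph_fun.subspace_def graph_L2_def
  using L2_add L2_scale L2_const [of 0] by (auto simp: plus_fun_def zero_fun_def)

lemma H1_graph_L2: "H1 \<subseteq> graph_L2 G len"
  by (auto simp: graph_L2_def H1_L2)

lemma graph_L2_edge: "f \<in> graph_L2 G len \<Longrightarrow> e \<in> arcs G \<Longrightarrow> f e \<in> L2_interval (len e)"
  by (simp add: graph_L2_def)

sublocale ip: hermitian_form "\<lambda>(c::complex) (f::'e \<Rightarrow> real \<Rightarrow> complex) e x. c * f e x" "graph_L2 G len" "graph_inner G len"
proof unfold_locales
  show "graph_inner G len (f + g) k = graph_inner G len f k + graph_inner G len g k"
    if "f \<in> graph_L2 G len" "g \<in> graph_L2 G len" "k \<in> graph_L2 G len" for f g k
    unfolding graph_inner_ipI sum.distrib [symmetric]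
    by (intro sum.cong refl) (use that L2.add_left graph_L2_edge in \<open>auto simp: plus_fun_def\<close>)
  show "graph_inner G len (\<lambda>e x. c * f e x) g = c * graph_inner G len f g" for c f g
    by (simp add: graph_inner_ipI ipI_def mult.assoc sum_distrib_left)
  show "graph_inner G len g f = cnj (graph_inner G len f g)" 
    if "f \<in> graph_L2 G len" "g \<in> graph_L2 G len" for f g
    unfolding graph_inner_ipI cnj_sum by (intro sum.cong refl L2.hermitian) (use that graph_L2_edge in auto)
qed (rule subspace_L2)

definition dirichlet :: "('e \<Rightarrow> real \<Rightarrow> complex) \<Rightarrow> ('e \<Rightarrow> real \<Rightarrow> complex) \<Rightarrow> complex" where
  "dirichlet f g = (\<Sum>e\<in>arcs G. ipI (len e) (D f e) (D g e))"

abbreviation dnorm where "dnorm f \<equiv> Re (dirichlet f f)"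
abbreviation nrm where "nrm f \<equiv> Re (graph_inner G len f f)"

sublocale dir: hermitian_form "\<lambda>(c::complex) (f::'e \<Rightarrow> real \<Rightarrow> complex) e x. c * f e x" H1 dirichlet
proof unfold_locales
  show "dirichlet (f + g) k = dirichlet f k + dirichlet g k" if H: "f \<in> H1" "g \<in> H1" "k \<in> H1" for f g k
    unfolding dirichlet_def sum.distrib [symmetric]
  proof (intro sum.cong refl)
    fix e assume e: "e \<in> arcs G"
    have "ipI (len e) (D (f + g) e) (D k e) = ipI (len e) (\<lambda>x. D f e x + D g e x) (D k e)"
      by (rule ipI_cong_AE [OF D_add D_L2 L2_add D_L2]) (intro H1_add D_L2 H e)+
    also have "\<dots> = ipI (len e) (D f e) (D k e) + ipI (len e) (D g e) (D k e)"
      by (rule L2.add_left [unfolded plus_fun_def]) (intro D_L2 H e)+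
    finally show "ipI (len e) (D (f + g) e) (D k e) = \<dots>" .
  qed
  show "dirichlet (\<lambda>e x. c * f e x) g = c * dirichlet f g" if H: "f \<in> H1" "g \<in> H1" for c f g
    unfolding dirichlet_def sum_distrib_left
  proof (intro sum.cong refl)
    fix e assume e: "e \<in> arcs G"
    have "ipI (len e) (D (\<lambda>e x. c * f e x) e) (D g e) = ipI (len e) (\<lambda>x. c * D f e x) (D g e)"
      by (rule ipI_cong_AE [OF D_scale D_L2 L2_scale D_L2]) (intro H1_scale D_L2 H e)+
    also have "\<dots> = c * ipI (len e) (D f e) (D g e)"
      using H e by (intro L2.scale_left D_L2)
    finally show "ipI (len e) (D (\<lambda>e x. c * f e x) e) (D g e) = \<dots>" .
  qed
  show "dirichlet g f = cnj (dirichlet f g)" if H: "f \<in> H1" "g \<in> H1" for f g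
    unfolding dirichlet_def cnj_sum by (intro sum.cong refl L2.hermitian D_L2 H)
qed (rule subspace_H1)

lemma nrm_nonneg: "0 \<le> nrm f"
  by (simp add: graph_inner_ipI sum_nonneg ipI_nonneg)

lemma dnorm_nonneg: "0 \<le> dnorm f"
  by (simp add: dirichlet_def sum_nonneg ipI_nonneg)

lemma edge_nrm_le: "e \<in> arcs G \<Longrightarrow> Re (ipI (len e) (f e) (f e)) \<le> nrm f"
  unfolding graph_inner_ipI Re_sum by (rule member_le_sum) (auto simp: ipI_nonneg)

lemma edge_dnorm_le: "e \<in> arcs G \<Longrightarrow> Re (ipI (len e) (D f e) (D f e)) \<le> dnorm f"
  unfolding dirichlet_def Re_sum by (rule member_le_sum [where f = "\<lambda>e. Re (ipI (len e) (D f e) (D f e))"]) (auto simp: ipI_nonneg)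

definition min_len where "min_len = Min (len ` arcs G)"

lemma min_len: "0 < min_len" "e \<in> arcs G \<Longrightarrow> min_len \<le> len e"
  unfolding min_len_def using arcs_nonempty len_pos by auto

lemma graph_Sobolev:
  assumes f: "f \<in> H1" and e: "e \<in> arcs G" and x: "x \<in> {0..len e}" and \<delta>: "0 < \<delta>" "\<delta> \<le> min_len"
  shows "(cmod (f e x))\<^sup>2 \<le> 2 / \<delta> * nrm f + 2 * \<delta> * dnorm f"
proof -
  have "\<delta> * (cmod (f e x))\<^sup>2 \<le> 2 * Re (ipI (len e) (f e) (f e)) + 2 * \<delta>\<^sup>2 * Re (ipI (len e) (D f e) (D f e))"
    using \<delta> min_len(2) [OF e] by (intro Sobolev D_FTC D_L2 H1_L2 f e x) auto
  also have "\<dots> \<le> 2 * nrm f + 2 * \<delta>\<^sup>2 * dnorm f"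
    using edge_nrm_le [OF e] edge_dnorm_le [OF e] by (intro add_mono mult_left_mono) auto
  finally have le: "\<delta> * (cmod (f e x))\<^sup>2 \<le> 2 * nrm f + 2 * \<delta>\<^sup>2 * dnorm f"
    .
  have "\<delta> * (2 / \<delta> * nrm f + 2 * \<delta> * dnorm f) = 2 * nrm f + 2 * \<delta>\<^sup>2 * dnorm f"
    using \<delta>(1) by (simp add: distrib_left power2_eq_square)
  then show ?thesis using le \<delta>(1) by (metis mult_le_cancel_left_pos)
qed

lemma vertex_Sobolev:
  assumes f: "f \<in> H1" and v: "v \<in> verts G" and \<delta>: "0 < \<delta>" "\<delta> \<le> min_len"
  shows "(cmod (vv f v))\<^sup>2 \<le> 2 / \<delta> * nrm f + 2 * \<delta> * dnorm f"
proof -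
  obtain e x where "e \<in> arcs G" "x \<in> {0..len e}" "vv f v = f e x"
    using vv_point [OF v] H1_C [OF f] by metis
  then show ?thesis using graph_Sobolev [OF f] \<delta> by simp
qed

text \<open>For vanishing norm the Sobolev bound reduces to \<open>2 \<delta> * dnorm f\<close> with
  arbitrarily small \<open>\<delta>\<close>. Because the functions are normalised off the graph,
  \<open>f\<close> is zero as a HOL function and not just almost everywhere.\<close>

lemma nrm_definite:
  assumes f: "f \<in> H1" and 0: "nrm f = 0"
  shows "f = 0"
proof (rule ext, rule ext)
  fix e x
  show "f e x = 0 e x"
  proof (cases "e \<in> arcs G \<and> x \<in> {0..len e}")
    case True
    have "(cmod (f e x))\<^sup>2 \<le> 0"
    proof (rule field_le_epsilon)
      fix \<eta> :: real assume "0 < \<eta>"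
      define \<delta> where "\<delta> = min min_len (\<eta> / (2 * (dnorm f + 1)))"
      have d: "0 < dnorm f + 1" using dnorm_nonneg [of f] by simp
      then have \<delta>: "0 < \<delta>" "\<delta> \<le> min_len" "\<delta> \<le> \<eta> / (2 * (dnorm f + 1))"
        using min_len(1) \<open>0 < \<eta>\<close> by (auto simp: \<delta>_def)
      have "(cmod (f e x))\<^sup>2 \<le> 2 * \<delta> * dnorm f"
        using graph_Sobolev [OF f _ _ \<delta>(1,2), of e x] True 0 by simp
      also have "\<dots> \<le> 2 * \<delta> * (dnorm f + 1)" using \<delta> by simp
      also have "\<dots> \<le> \<eta>" using \<delta>(3) d by (simp add: field_simps)
      finally show "(cmod (f e x))\<^sup>2 \<le> 0 + \<eta>" by simp
    qed
    then show ?thesis by simp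
  next
    case False
    then show ?thesis using H1_C [OF f] by (auto simp: graph_C_def)
  qed
qed

end

section \<open>Compactness and completeness of the form domain\<close>

context metric_graph
begin

text \<open>Bounded energy gives a common Hoelder estimate of exponent 1/2 on each edge, so
  Arzela-Ascoli applies there; uniform convergence on finitely many bounded edges implies
  convergence in norm.\<close>

lemma compact_sequence:
  assumes f: "\<And>n. f n \<in> H1" and n: "\<And>n. nrm (f n) \<le> K" and d: "\<And>n. dnorm (f n) \<le> K"
  shows "\<exists>r::nat \<Rightarrow> nat. strict_mono r \<and> (\<forall>e>0. \<exists>N. \<forall>m\<ge>N. \<forall>n\<ge>N. nrm (f (r m) - f (r n)) < e)"
proof -
  have K: "0 \<le> K" using nrm_nonneg [of "f 0"] n [of 0] by linarith
  have edge: "\<exists>k::nat \<Rightarrow> nat. strict_mono k \<and> (\<forall>\<eta>>0. \<exists>N. \<forall>m\<ge>N. \<forall>n\<ge>N. \<forall>x\<in>{0..len e}. cmod (f (r (k m)) e x - f (r (k n)) e x) < \<eta>)"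
    if e: "e \<in> arcs G" for e and r :: "nat \<Rightarrow> nat"
  proof -
    have bound: "cmod (f (r n) e x) \<le> sqrt (2 / min_len * K + 2 * min_len * K)" if "x \<in> {0..len e}" for n x
    proof (rule real_le_rsqrt)
      have "(cmod (f (r n) e x))\<^sup>2 \<le> 2 / min_len * nrm (f (r n)) + 2 * min_len * dnorm (f (r n))"
        using min_len(1) by (intro graph_Sobolev f e that) auto
      also have "\<dots> \<le> 2 / min_len * K + 2 * min_len * K"
        using n d min_len(1) by (intro add_mono mult_left_mono) auto
      finally show "(cmod (f (r n) e x))\<^sup>2 \<le> 2 / min_len * K + 2 * min_len * K" .
    qed
    have equi: "\<exists>d>0. \<forall>n y. y \<in> {0..len e} \<and> norm (x - y) < d \<longrightarrow> norm (f (r n) e x - f (r n) e y) < \<eta>"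
      if x: "x \<in> {0..len e}" and \<eta>: "0 < \<eta>" for x \<eta>
    proof (intro exI conjI allI impI)
      show "0 < \<eta>\<^sup>2 / (K + 1)" using \<eta> K by simp
      fix n y assume y: "y \<in> {0..len e} \<and> norm (x - y) < \<eta>\<^sup>2 / (K + 1)"
      have "(cmod (f (r n) e x - f (r n) e y))\<^sup>2 \<le> \<bar>x - y\<bar> * Re (ipI (len e) (D (f (r n)) e) (D (f (r n)) e))"
        using x y by (intro Hoelder D_FTC D_L2 f e) auto
      also have "\<dots> \<le> \<bar>x - y\<bar> * (K + 1)"
        using edge_dnorm_le [OF e, of "f (r n)"] d [of "r n"] by (intro mult_left_mono) auto
      also have "\<dots> < \<eta>\<^sup>2" using y K by (simp add: field_simps)
      finally show "norm (f (r n) e x - f (r n) e y) < \<eta>"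
        using \<eta> by (simp add: power2_less_imp_less)
    qed
    obtain g k where k: "strict_mono (k :: nat \<Rightarrow> nat)"
      "\<And>\<eta>. 0 < \<eta> \<Longrightarrow> \<exists>N. \<forall>n x. n \<ge> N \<and> x \<in> {0..len e} \<longrightarrow> norm (f (r (k n)) e x - g x) < \<eta>"
      by (rule Arzela_Ascoli [of "{0..len e}" "\<lambda>n. f (r n) e" "sqrt (2 / min_len * K + 2 * min_len * K)"])
        (use bound equi compact_Icc in blast)+
    have "\<exists>N. \<forall>m\<ge>N. \<forall>n\<ge>N. \<forall>x\<in>{0..len e}. cmod (f (r (k m)) e x - f (r (k n)) e x) < \<eta>" if "\<eta> > 0" for \<eta>
    proof -
      obtain N where N: "\<And>n x. n \<ge> N \<Longrightarrow> x \<in> {0..len e} \<Longrightarrow> norm (f (r (k n)) e x - g x) < \<eta> / 2"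
        using k(2) [of "\<eta> / 2"] \<open>\<eta> > 0\<close> by auto
      have "cmod (f (r (k m)) e x - f (r (k n)) e x) < \<eta>" if "m \<ge> N" "n \<ge> N" "x \<in> {0..len e}" for m n x
        using norm_triangle_ineq4 [of "f (r (k m)) e x - g x" "f (r (k n)) e x - g x"] N [OF that(1,3)] N [OF that(2,3)] by simp
      then show ?thesis by blast
    qed
    then show ?thesis using k(1) by blast
  qed
  \<comment> \<open>Extraction edge by edge. The edges already treated are not disturbed by a
    further subsequence \<open>k\<close>, because \<open>k n \<ge> n\<close>.\<close>
  have "\<exists>r::nat \<Rightarrow> nat. strict_mono r \<and> (\<forall>e\<in>A. \<forall>\<eta>>0. \<exists>N. \<forall>m\<ge>N. \<forall>n\<ge>N. \<forall>x\<in>{0..len e}. cmod (f (r m) e x - f (r n) e x) < \<eta>)"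
    if "finite A" "A \<subseteq> arcs G" for A
    using that
  proof (induction A)
    case empty
    show ?case by (intro exI [of _ id]) (auto simp: strict_mono_def)
  next
    case (insert e A)
    then obtain r :: "nat \<Rightarrow> nat" where r: "strict_mono r"
      "\<And>e \<eta>. e \<in> A \<Longrightarrow> \<eta> > 0 \<Longrightarrow> \<exists>N. \<forall>m\<ge>N. \<forall>n\<ge>N. \<forall>x\<in>{0..len e}. cmod (f (r m) e x - f (r n) e x) < \<eta>"
      by auto
    obtain k :: "nat \<Rightarrow> nat" where k: "strict_mono k"
      "\<And>\<eta>. \<eta> > 0 \<Longrightarrow> \<exists>N. \<forall>m\<ge>N. \<forall>n\<ge>N. \<forall>x\<in>{0..len e}. cmod (f (r (k m)) e x - f (r (k n)) e x) < \<eta>"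
      using edge [of e r] insert.prems by auto
    have "\<exists>N. \<forall>m\<ge>N. \<forall>n\<ge>N. \<forall>x\<in>{0..len a}. cmod (f (r (k m)) a x - f (r (k n)) a x) < \<eta>"
      if a: "a \<in> insert e A" "\<eta> > 0" for a \<eta>
    proof (cases "a = e")
      case False
      then obtain N where "\<forall>m\<ge>N. \<forall>n\<ge>N. \<forall>x\<in>{0..len a}. cmod (f (r m) a x - f (r n) a x) < \<eta>"
        using r(2) [of a \<eta>] a by auto
      then show ?thesis
        using seq_suble [OF k(1)] by (intro exI [of _ N]) (meson order_trans)
    qed (use k(2) a in auto)
    then show ?case
      using strict_mono_o [OF r(1) k(1)] by (intro exI [of _ "r \<circ> k"]) (auto simp: o_def)
  qed
  from this [OF finite_arcs subset_refl] obtain r :: "nat \<Rightarrow> nat" where r: "strict_mono r"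
    "\<And>e \<eta>. e \<in> arcs G \<Longrightarrow> \<eta> > 0 \<Longrightarrow> \<exists>N. \<forall>m\<ge>N. \<forall>n\<ge>N. \<forall>x\<in>{0..len e}. cmod (f (r m) e x - f (r n) e x) < \<eta>"
    by blast
  have "\<exists>N. \<forall>m\<ge>N. \<forall>n\<ge>N. nrm (f (r m) - f (r n)) < \<eta>" if \<eta>: "\<eta> > 0" for \<eta>
  proof -
    define L where "L = (\<Sum>e\<in>arcs G. len e)"
    have L: "0 \<le> L" unfolding L_def using len_pos by (intro sum_nonneg) (auto intro: less_imp_le)
    define \<gamma> where "\<gamma> = sqrt (\<eta> / (L + 1))"
    have \<gamma>: "\<gamma> > 0" "L * \<gamma>\<^sup>2 < \<eta>" using L \<eta> by (auto simp: \<gamma>_def field_simps)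
    obtain N where N: "\<And>e m n x. e \<in> arcs G \<Longrightarrow> m \<ge> N e \<Longrightarrow> n \<ge> N e \<Longrightarrow> x \<in> {0..len e} \<Longrightarrow> cmod (f (r m) e x - f (r n) e x) < \<gamma>"
      using r(2) [OF _ \<gamma>(1)] by metis
    have "nrm (f (r m) - f (r n)) < \<eta>" if mn: "m \<ge> (\<Sum>e\<in>arcs G. N e)" "n \<ge> (\<Sum>e\<in>arcs G. N e)" for m n
    proof -
      have "nrm (f (r m) - f (r n)) \<le> (\<Sum>e\<in>arcs G. len e * \<gamma>\<^sup>2)"
        unfolding graph_inner_ipI Re_sum
      proof (intro sum_mono Re_ipI_le)
        fix e assume e: "e \<in> arcs G"
        then have "N e \<le> (\<Sum>e\<in>arcs G. N e)" by (intro member_le_sum) auto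
        then show "cmod ((f (r m) - f (r n)) e x) \<le> \<gamma>" if "x \<in> {0<..<len e}" for x
          using N [OF e, of m n x] mn that by simp
        show "(f (r m) - f (r n)) e \<in> L2_interval (len e)"
          using L2_diff [OF H1_L2 [OF f e] H1_L2 [OF f e]] by (simp add: fun_diff_def)
      qed (use len_pos in \<open>auto intro: less_imp_le\<close>)
      also have "\<dots> = L * \<gamma>\<^sup>2" by (simp add: L_def sum_distrib_right)
      finally show ?thesis using \<gamma>(2) by linarith
    qed
    then show ?thesis by blast
  qed
  then show ?thesis using r(1) by blast
qed

lemma D_diff: "f \<in> H1 \<Longrightarrow> g \<in> H1 \<Longrightarrow> e \<in> arcs G \<Longrightarrow> AE x in iv (len e). D (f - g) e x = D f e x - D g e x"
proof (rule D_unique)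
  assume H: "f \<in> H1" "g \<in> H1" "e \<in> arcs G"
  show "f - g \<in> H1" using H by (intro dir.dom_closed)
  show "(\<lambda>x. D f e x - D g e x) \<in> L2_interval (len e)" using H by (intro L2_diff D_L2)
  show "(f - g) e x = (f - g) e 0 + prim (len e) (\<lambda>x. D f e x - D g e x) x" if "x \<in> {0..len e}" for x
    using D_FTC [OF H(1,3) that] D_FTC [OF H(2,3) that] prim_diff [OF D_L2 [OF H(1,3)] D_L2 [OF H(2,3)]] by simp
qed

lemma Re_ipI_cong_AE:
  assumes "AE x in iv l. f x = f' x" "f \<in> L2_interval l" "f' \<in> L2_interval l"
  shows "Re (ipI l f f) = Re (ipI l f' f')"
  using ipI_cong_AE [OF assms assms(2)] ipI_cong_AE [OF assms assms(3)] L2.hermitian [OF assms(2,3)] by simp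

lemma edge_dnorm_diff_le:
  assumes "f \<in> H1" "g \<in> H1" "e \<in> arcs G"
  shows "Re (ipI (len e) (D f e - D g e) (D f e - D g e)) \<le> dnorm (f - g)"
proof -
  have "Re (ipI (len e) (D (f - g) e) (D (f - g) e)) = Re (ipI (len e) (D f e - D g e) (D f e - D g e))"
    using assms D_diff [OF assms] L2_diff [OF D_L2 [OF assms(1,3)] D_L2 [OF assms(2,3)]]
    by (intro Re_ipI_cong_AE D_L2 dir.dom_closed) (auto simp: fun_diff_def)
  then show ?thesis using edge_dnorm_le [OF assms(3), of "f - g"] by simp
qed

text \<open>The derivatives converge in norm on each edge by completeness, the functions converge
  pointwise by the Sobolev bound, and the representation by primitives survives the limit. So the
  limit of the derivatives is the derivative of the limit.\<close>

lemma closed_sequence: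
  assumes f: "\<And>n. f n \<in> H1"
    and Cauchy: "\<And>e. e > 0 \<Longrightarrow> \<exists>N. \<forall>m\<ge>N. \<forall>n\<ge>N. nrm (f m - f n) < e \<and> dnorm (f m - f n) < e"
  shows "\<exists>g\<in>H1. (\<lambda>n. nrm (f n - g)) \<longlonglongrightarrow> 0 \<and> (\<lambda>n. dnorm (f n - g)) \<longlonglongrightarrow> 0"
proof -
  have "\<exists>g\<in>L2_interval (len e). (\<lambda>n. Re (ipI (len e) (D (f n) e - g) (D (f n) e - g))) \<longlonglongrightarrow> 0" if e: "e \<in> arcs G" for e
  proof (rule L2_complete)
    fix \<eta> :: real assume "\<eta> > 0"
    then obtain N where "\<forall>m\<ge>N. \<forall>n\<ge>N. nrm (f m - f n) < \<eta> \<and> dnorm (f m - f n) < \<eta>" using Cauchy by blast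
    then show "\<exists>N. \<forall>m\<ge>N. \<forall>n\<ge>N. Re (ipI (len e) (D (f m) e - D (f n) e) (D (f m) e - D (f n) e)) < \<eta>"
      using edge_dnorm_diff_le [OF f f e] by (meson le_less_trans)
  qed (intro D_L2 f e)
  then have "\<forall>e\<in>arcs G. \<exists>g. g \<in> L2_interval (len e) \<and> (\<lambda>n. Re (ipI (len e) (D (f n) e - g) (D (f n) e - g))) \<longlonglongrightarrow> 0"
    by blast
  from bchoice [OF this] obtain k where k: "\<And>e. e \<in> arcs G \<Longrightarrow> k e \<in> L2_interval (len e)"
    "\<And>e. e \<in> arcs G \<Longrightarrow> (\<lambda>n. Re (ipI (len e) (D (f n) e - k e) (D (f n) e - k e))) \<longlonglongrightarrow> 0"
    by blast
  have "convergent (\<lambda>n. f n e x)" if e: "e \<in> arcs G" and x: "x \<in> {0..len e}" for e x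
  proof -
    have "Cauchy (\<lambda>n. f n e x)"
      unfolding Cauchy_iff
    proof (intro allI impI)
      fix \<eta> :: real assume \<eta>: "0 < \<eta>"
      define c where "c = 2 / min_len + 2 * min_len"
      have c: "c > 0" using min_len(1) by (simp add: c_def add_pos_pos)
      obtain N where N: "\<And>m n. m \<ge> N \<Longrightarrow> n \<ge> N \<Longrightarrow> nrm (f m - f n) < \<eta>\<^sup>2 / c \<and> dnorm (f m - f n) < \<eta>\<^sup>2 / c"
        using Cauchy [of "\<eta>\<^sup>2 / c"] \<eta> c by auto
      have "cmod (f m e x - f n e x) < \<eta>" if "m \<ge> N" "n \<ge> N" for m n
      proof -
        have "(cmod ((f m - f n) e x))\<^sup>2 \<le> 2 / min_len * nrm (f m - f n) + 2 * min_len * dnorm (f m - f n)"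
          using min_len(1) f by (intro graph_Sobolev e x dir.dom_closed) auto
        also have "\<dots> < 2 / min_len * (\<eta>\<^sup>2 / c) + 2 * min_len * (\<eta>\<^sup>2 / c)"
          using N [OF that] min_len(1) by (intro add_strict_mono mult_strict_left_mono) auto
        also have "\<dots> = c * (\<eta>\<^sup>2 / c)" by (simp only: c_def distrib_right)
        also have "\<dots> = \<eta>\<^sup>2" using c by simp
        finally show ?thesis using \<eta> by (simp add: power2_less_imp_less)
      qed
      then show "\<exists>M. \<forall>m\<ge>M. \<forall>n\<ge>M. norm (f m e x - f n e x) < \<eta>" by blast
    qed
    then show ?thesis by (simp add: Cauchy_convergent_iff)
  qed
  \<comment> \<open>Limits are taken on the graph only; outside, \<open>graph_C\<close> prescribes
    the value 0.\<close>
  define g where "g e x = (if e \<in> arcs G \<and> x \<in> {0..len e} then lim (\<lambda>n. f n e x) else 0)" for e x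
  have gl: "(\<lambda>n. f n e x) \<longlonglongrightarrow> g e x" if "e \<in> arcs G" "x \<in> {0..len e}" for e x
    using \<open>\<And>e x. _ \<Longrightarrow> _ \<Longrightarrow> convergent (\<lambda>n. f n e x)\<close> [OF that] that by (simp add: g_def convergent_LIMSEQ_iff)
  have g_FTC: "g e x = g e 0 + prim (len e) (k e) x" if e: "e \<in> arcs G" and x: "x \<in> {0..len e}" for e x
  proof -
    have "(\<lambda>n. prim (len e) (D (f n) e) x - prim (len e) (k e) x) \<longlonglongrightarrow> 0"
    proof (rule Lim_null_comparison [OF always_eventually])
      have "(\<lambda>n. sqrt (len e * Re (ipI (len e) (D (f n) e - k e) (D (f n) e - k e)))) \<longlonglongrightarrow> sqrt (len e * 0)"
        by (intro tendsto_intros k e)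
      then show "(\<lambda>n. sqrt (len e * Re (ipI (len e) (D (f n) e - k e) (D (f n) e - k e)))) \<longlonglongrightarrow> 0" by simp
      show "\<forall>n. norm (prim (len e) (D (f n) e) x - prim (len e) (k e) x) \<le> sqrt (len e * Re (ipI (len e) (D (f n) e - k e) (D (f n) e - k e)))"
      proof
        fix n
        have d: "(\<lambda>x. D (f n) e x - k e x) \<in> L2_interval (len e)" by (intro L2_diff D_L2 f e k)
        have "(cmod (prim (len e) (\<lambda>x. D (f n) e x - k e x) x))\<^sup>2 \<le> x * Re (ipI (len e) (D (f n) e - k e) (D (f n) e - k e))"
          using prim_Hoelder [OF d, of 0 x] x by (simp add: fun_diff_def)
        also have "\<dots> \<le> len e * Re (ipI (len e) (D (f n) e - k e) (D (f n) e - k e))"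
          using x by (intro mult_right_mono ipI_nonneg) auto
        finally show "norm (prim (len e) (D (f n) e) x - prim (len e) (k e) x) \<le> sqrt (len e * Re (ipI (len e) (D (f n) e - k e) (D (f n) e - k e)))"
          using prim_diff [OF D_L2 [OF f e] k(1) [OF e]] by (intro real_le_rsqrt) simp
      qed
    qed
    then have "(\<lambda>n. f n e 0 + prim (len e) (D (f n) e) x) \<longlonglongrightarrow> g e 0 + prim (len e) (k e) x"
      using gl [OF e, of 0] len_pos [OF e] by (intro tendsto_add) (auto simp: LIM_zero_iff)
    then have "(\<lambda>n. f n e x) \<longlonglongrightarrow> g e 0 + prim (len e) (k e) x"
      using D_FTC [OF f e x] by (simp only:)
    then show ?thesis using gl [OF e x] LIMSEQ_unique by blast
  qed
  have gC: "g \<in> graph_C G len"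
  proof (rule graph_C_I [where z = "\<lambda>v. lim (\<lambda>n. vv (f n) v)"])
    show "continuous_on {0..len e} (g e)" if e: "e \<in> arcs G" for e
      using prim_continuous [OF k(1) [OF e]] by (subst continuous_on_cong [OF refl g_FTC [OF e]]) (auto intro!: continuous_intros)
    show "g e 0 = lim (\<lambda>n. vv (f n) (tail G e))" "g e (len e) = lim (\<lambda>n. vv (f n) (head G e))" if "e \<in> arcs G" for e
      using that len_pos [OF that] H1_C [OF f] by (auto simp: g_def vv_tail vv_head)
  qed (auto simp: g_def)
  have gH: "g \<in> H1"
    by (rule H1_I [OF gC]) (use g_FTC k in blast)
  have Dg: "AE x in iv (len e). D g e x = k e x" if "e \<in> arcs G" for e
    by (intro D_unique gH that k g_FTC)
  have edge_d: "Re (ipI (len e) (D (f n - g) e) (D (f n - g) e)) = Re (ipI (len e) (D (f n) e - k e) (D (f n) e - k e))"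
    if e: "e \<in> arcs G" for e n
  proof (rule Re_ipI_cong_AE)
    show "AE x in iv (len e). D (f n - g) e x = (D (f n) e - k e) x"
      using D_diff [OF f gH e, of n] Dg [OF e] by eventually_elim simp
    show "D (f n) e - k e \<in> L2_interval (len e)"
      using L2_diff [OF D_L2 [OF f e] k(1) [OF e]] by (simp add: fun_diff_def)
  qed (intro D_L2 dir.dom_closed f gH e)
  have dl: "(\<lambda>n. dnorm (f n - g)) \<longlonglongrightarrow> 0"
  proof -
    have "(\<lambda>n. \<Sum>e\<in>arcs G. Re (ipI (len e) (D (f n) e - k e) (D (f n) e - k e))) \<longlonglongrightarrow> (\<Sum>e\<in>arcs G. 0)"
      by (intro tendsto_sum k)
    moreover have "dnorm (f n - g) = (\<Sum>e\<in>arcs G. Re (ipI (len e) (D (f n) e - k e) (D (f n) e - k e)))" for n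
      unfolding dirichlet_def Re_sum by (intro sum.cong refl edge_d)
    ultimately show ?thesis by simp
  qed
  have "(\<lambda>n. nrm (f n - g)) \<longlonglongrightarrow> 0"
  proof -
    \<comment> \<open>The difference is controlled by its value at \<open>0\<close> and by its
      derivative. The square root under the square fits the bound to
      \<open>Re_ipI_le\<close>.\<close>
    have "Re (ipI (len e) ((f n - g) e) ((f n - g) e)) \<le> len e * (sqrt (2 * (cmod (f n e 0 - g e 0))\<^sup>2 + 2 * len e * dnorm (f n - g)))\<^sup>2"
      if e: "e \<in> arcs G" for e n
    proof (rule Re_ipI_le)
      have fg: "f n - g \<in> H1" by (intro dir.dom_closed f gH)
      show "(f n - g) e \<in> L2_interval (len e)" by (intro H1_L2 fg e)
      show "0 \<le> len e" using len_pos [OF e] by simp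
      fix x assume x: "x \<in> {0<..<len e}"
      show "cmod ((f n - g) e x) \<le> sqrt (2 * (cmod (f n e 0 - g e 0))\<^sup>2 + 2 * len e * dnorm (f n - g))"
      proof (rule real_le_rsqrt)
        let ?u = "(f n - g) e"
        have "(cmod (?u x))\<^sup>2 \<le> (cmod (?u 0) + cmod (?u x - ?u 0))\<^sup>2"
          by (intro power_mono norm_ge_zero) (metis norm_triangle_sub)
        also have "\<dots> \<le> 2 * (cmod (?u 0))\<^sup>2 + 2 * (cmod (?u x - ?u 0))\<^sup>2"
          using sum_squares_bound [of "cmod (?u 0)" "cmod (?u x - ?u 0)"] by (simp add: power2_sum)
        also have "(cmod (?u x - ?u 0))\<^sup>2 \<le> \<bar>x - 0\<bar> * Re (ipI (len e) (D (f n - g) e) (D (f n - g) e))"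
          using x by (intro Hoelder D_FTC D_L2 fg e) auto
        also have "\<dots> \<le> len e * dnorm (f n - g)"
          using x len_pos [OF e] by (intro mult_mono ipI_nonneg edge_dnorm_le e) auto
        finally show "(cmod (?u x))\<^sup>2 \<le> 2 * (cmod (f n e 0 - g e 0))\<^sup>2 + 2 * len e * dnorm (f n - g)" by simp
      qed
    qed
    then have le: "nrm (f n - g) \<le> (\<Sum>e\<in>arcs G. len e * (2 * (cmod (f n e 0 - g e 0))\<^sup>2 + 2 * len e * dnorm (f n - g)))" for n
      unfolding graph_inner_ipI Re_sum using len_pos dnorm_nonneg
      by (intro sum_mono) (auto simp: less_imp_le)
    have "(\<lambda>n. \<Sum>e\<in>arcs G. len e * (2 * (cmod (f n e 0 - g e 0))\<^sup>2 + 2 * len e * dnorm (f n - g))) \<longlonglongrightarrow>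
        (\<Sum>e\<in>arcs G. len e * (2 * (cmod (g e 0 - g e 0))\<^sup>2 + 2 * len e * 0))"
      using len_pos by (intro tendsto_intros gl dl) (auto intro: less_imp_le)
    then have lim0: "(\<lambda>n. \<Sum>e\<in>arcs G. len e * (2 * (cmod (f n e 0 - g e 0))\<^sup>2 + 2 * len e * dnorm (f n - g))) \<longlonglongrightarrow> 0" by simp
    show ?thesis
      by (rule tendsto_sandwich [OF always_eventually always_eventually tendsto_const lim0]) (use le nrm_nonneg in auto)
  qed
  then show ?thesis using gH dl by blast
qed

text \<open>A sine wave with \<open>k\<close> half-periods on a single edge. Its energy need not be
  computed: it rises from 0 to 1 over the length \<open>l / (2 k)\<close>, and the Hoelder estimate
  then forces an energy of at least \<open>2 k / l\<close>, while its squared norm is at most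
  \<open>l\<close>.\<close>

lemma dirichlet_unbounded: "\<exists>f\<in>H1. K * nrm f < dnorm f"
proof -
  obtain e where e: "e \<in> arcs G" using arcs_nonempty by blast
  let ?l = "len e"
  have l: "?l > 0" using len_pos e by blast
  obtain m :: nat where m: "real m > \<bar>K\<bar> * ?l * ?l" using reals_Archimedean2 by blast
  define k where "k = Suc m"
  have k: "real k > \<bar>K\<bar> * ?l * ?l" "real k > 0" using m by (auto simp: k_def)
  define s where "s x = complex_of_real (sin (k * pi * x / ?l))" for x
  define s' where "s' x = complex_of_real (k * pi / ?l * cos (k * pi * x / ?l))" for x
  define f where "f e' x = (if e' = e \<and> x \<in> {0..?l} then s x else 0)" for e' x
  have sl: "s ?l = 0" "s 0 = 0" using l by (auto simp: s_def)
  have s'L: "s' \<in> L2_interval ?l" unfolding s'_def by (intro L2_continuous continuous_intros) (use l in auto)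
  have sc: "continuous_on S s" for S unfolding s_def by (intro continuous_intros) (use l in auto)
  have sFTC: "s x = s 0 + prim ?l s' x" if "x \<in> {0..?l}" for x
  proof (rule prim_FTC [where S = "{}"])
    show "(s has_vector_derivative s' y) (at y)" for y
      unfolding s_def s'_def using l
      by (intro has_vector_derivative_of_real) (auto intro!: derivative_eq_intros)
  qed (use sc s'L that in auto)
  have fe: "f e x = s x" if "x \<in> {0..?l}" for x using that by (simp add: f_def)
  have "f \<in> graph_C G len"
  proof (rule graph_C_I [where z = "\<lambda>_. 0"])
    show "continuous_on {0..len e'} (f e')" if "e' \<in> arcs G" for e'
    proof (cases "e' = e")
      case True
      then show ?thesis using sc fe by (subst continuous_on_cong [OF refl, where g = s]) auto
    next
      case False
      then show ?thesis by (simp add: f_def)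
    qed
  qed (use sl e in \<open>auto simp: f_def\<close>)
  then have fH: "f \<in> H1"
  proof (rule H1_I)
    fix e' assume "e' \<in> arcs G"
    show "\<exists>g\<in>L2_interval (len e'). \<forall>x\<in>{0..len e'}. f e' x = f e' 0 + prim (len e') g x"
    proof (cases "e' = e")
      case True
      have "f e x = f e 0 + prim ?l s' x" if "x \<in> {0..?l}" for x
        unfolding fe [OF that] using sFTC [OF that] fe [of 0] l by (simp only: atLeastAtMost_iff order_refl less_imp_le simp_thms)
      then show ?thesis using s'L True by blast
    next
      case False
      then show ?thesis using L2_const [of 0 "len e'"] by (intro bexI [of _ "\<lambda>_. 0"]) (auto simp: prim_def f_def)
    qed
  qed
  have n: "nrm f \<le> ?l"
  proof -
    have "nrm f = (\<Sum>e'\<in>{e}. Re (ipI (len e') (f e') (f e')))"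
      unfolding graph_inner_ipI Re_sum using e by (intro sum.mono_neutral_right) (auto simp: f_def [abs_def] ipI_def)
    also have "\<dots> \<le> ?l * 1\<^sup>2"
    proof -
      have "Re (ipI ?l (f e) (f e)) \<le> ?l * 1\<^sup>2"
        using l H1_L2 [OF fH e] by (intro Re_ipI_le) (auto simp: f_def s_def)
      then show ?thesis by simp
    qed
    finally show ?thesis by simp
  qed
  have d: "2 * k / ?l \<le> dnorm f"
  proof -
    have half: "?l / (2 * k) \<in> {0..?l}" using l k(2) by (auto simp: k_def field_simps)
    have "s (?l / (2 * k)) = 1" using l k(2) by (simp add: s_def)
    then have "1 = (cmod (f e (?l / (2 * k)) - f e 0))\<^sup>2"
      using half l sl by (simp add: fe)
    also have "\<dots> \<le> \<bar>?l / (2 * k) - 0\<bar> * Re (ipI ?l (D f e) (D f e))"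
      using half l by (intro Hoelder D_FTC D_L2 fH e) auto
    also have "\<dots> \<le> \<bar>?l / (2 * k) - 0\<bar> * dnorm f"
      using edge_dnorm_le [OF e] by (intro mult_left_mono) auto
    finally show ?thesis using l k(2) by (simp add: field_simps)
  qed
  have "K * nrm f \<le> \<bar>K\<bar> * ?l" using n nrm_nonneg [of f] by (intro mult_mono) auto
  also have "\<dots> < k / ?l" using k l by (simp add: field_simps)
  also have "\<dots> \<le> dnorm f" using d k l by (simp add: field_simps)
  finally show ?thesis using fH by blast
qed

end

section \<open>The Schroedinger form as a closed form\<close>

locale schroedinger = metric_graph G len
  for G :: "('v, 'e) pre_digraph" (structure) and len :: "'e \<Rightarrow> real" +
  fixes q :: "'e \<Rightarrow> real \<Rightarrow> real" and \<sigma> :: "'v \<Rightarrow> real"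
  assumes admissible: "admissible_potential G len q"
begin

abbreviation "h \<equiv> schroedinger_form G len q \<sigma>"

definition qmax :: real where
  "qmax = (SOME K. 0 \<le> K \<and> (\<forall>e\<in>arcs G. AE x in iv (len e). \<bar>q e x\<bar> \<le> K))"

lemma qmax: "0 \<le> qmax" "e \<in> arcs G \<Longrightarrow> AE x in iv (len e). \<bar>q e x\<bar> \<le> qmax"
proof -
  have "\<forall>e\<in>arcs G. \<exists>K. 0 \<le> K \<and> (AE x in iv (len e). \<bar>q e x\<bar> \<le> K)"
  proof
    fix e assume "e \<in> arcs G"
    then have "q e \<in> Linf_interval (len e)" using admissible by (simp add: admissible_potential_def)
    then show "\<exists>K. 0 \<le> K \<and> (AE x in iv (len e). \<bar>q e x\<bar> \<le> K)" by (rule Linf_bound) blast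
  qed
  from bchoice [OF this] obtain K where K: "\<And>e. e \<in> arcs G \<Longrightarrow> 0 \<le> K e"
    "\<And>e. e \<in> arcs G \<Longrightarrow> AE x in iv (len e). \<bar>q e x\<bar> \<le> K e" by blast
  have "0 \<le> sum K (arcs G) \<and> (\<forall>e\<in>arcs G. AE x in iv (len e). \<bar>q e x\<bar> \<le> sum K (arcs G))"
  proof (intro conjI ballI sum_nonneg K)
    fix e assume e: "e \<in> arcs G"
    have "K e \<le> sum K (arcs G)" using e K by (intro member_le_sum) auto
    then show "AE x in iv (len e). \<bar>q e x\<bar> \<le> sum K (arcs G)"
      using K(2) [OF e] by (auto elim!: eventually_mono)
  qed auto
  then have "0 \<le> qmax \<and> (\<forall>e\<in>arcs G. AE x in iv (len e). \<bar>q e x\<bar> \<le> qmax)"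
    unfolding qmax_def by (rule someI)
  then show "0 \<le> qmax" "e \<in> arcs G \<Longrightarrow> AE x in iv (len e). \<bar>q e x\<bar> \<le> qmax" by blast+
qed

lemma q_measurable: "e \<in> arcs G \<Longrightarrow> q e \<in> borel_measurable (iv (len e))"
  using admissible by (simp add: admissible_potential_def Linf_interval_def)

text \<open>Putting the potential on one factor makes the potential term an inner product in
  \<open>graph_L2\<close>. The product usually leaves the form domain, and Bessel's inequality still
  applies to it.\<close>

definition qmul :: "('e \<Rightarrow> real \<Rightarrow> complex) \<Rightarrow> 'e \<Rightarrow> real \<Rightarrow> complex" where
  "qmul f = (\<lambda>e x. of_real (q e x) * f e x)"

lemma qmul_L2: "f \<in> graph_L2 G len \<Longrightarrow> qmul f \<in> graph_L2 G len"
  unfolding graph_L2_def qmul_def using L2_mult(1) [OF q_measurable qmax(2)] by blast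

lemma qmul_nrm:
  assumes "f \<in> graph_L2 G len"
  shows "nrm (qmul f) \<le> qmax\<^sup>2 * nrm f"
  unfolding graph_inner_ipI Re_sum sum_distrib_left qmul_def
  by (intro sum_mono L2_mult(2) q_measurable qmax) (use assms in \<open>auto simp: graph_L2_def\<close>)

lemma qmul_add: "qmul (f + g) = qmul f + qmul g"
  by (auto simp: qmul_def fun_eq_iff distrib_left)

lemma qmul_scale: "qmul (\<lambda>e x. c * f e x) = (\<lambda>e x. c * qmul f e x)"
  by (auto simp: qmul_def fun_eq_iff)

lemma qmul_symmetric: "graph_inner G len (qmul f) g = graph_inner G len f (qmul g)"
  by (simp add: graph_inner_ipI ipI_def qmul_def mult_ac)

lemma H1_in_L2 [intro]: "f \<in> H1 \<Longrightarrow> f \<in> graph_L2 G len"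
  using H1_graph_L2 by blast

lemma form_eq: "h f g = dirichlet f g + graph_inner G len (qmul f) g
    + (\<Sum>v\<in>verts G. of_real (\<sigma> v) * (vv f v * cnj (vv g v)))"
  by (simp add: schroedinger_form_ipI dirichlet_def graph_inner_ipI qmul_def)

lemma Re_form: "Re (h f f) = dnorm f + Re (graph_inner G len (qmul f) f) + (\<Sum>v\<in>verts G. \<sigma> v * (cmod (vv f v))\<^sup>2)"
  unfolding form_eq by (simp add: complex_norm_square [symmetric])

lemma qmul_form_le:
  assumes f: "f \<in> graph_L2 G len"
  shows "\<bar>Re (graph_inner G len (qmul f) f)\<bar> \<le> qmax * nrm f"
proof -
  have "(cmod (graph_inner G len (qmul f) f))\<^sup>2 \<le> nrm (qmul f) * nrm f"
    by (intro ip.Cauchy_Schwarz nrm_nonneg qmul_L2 f)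
  also have "\<dots> \<le> qmax\<^sup>2 * nrm f * nrm f"
    by (intro mult_right_mono qmul_nrm nrm_nonneg f)
  also have "\<dots> = (qmax * nrm f)\<^sup>2" by (simp add: power2_eq_square)
  finally have "cmod (graph_inner G len (qmul f) f) \<le> qmax * nrm f"
    by (rule power2_le_imp_le) (use qmax nrm_nonneg in auto)
  then show ?thesis using abs_Re_le_cmod order_trans by blast
qed

sublocale hf: hermitian_form "\<lambda>(c::complex) (f::'e \<Rightarrow> real \<Rightarrow> complex) e x. c * f e x" H1 h
proof unfold_locales
  show "h (f + g) k = h f k + h g k" if H: "f \<in> H1" "g \<in> H1" "k \<in> H1" for f g k
  proof -
    have "graph_inner G len (qmul (f + g)) k = graph_inner G len (qmul f) k + graph_inner G len (qmul g) k"
      unfolding qmul_add using H by (intro ip.add_left qmul_L2) auto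
    moreover have "vv (f + g) v = vv f v + vv g v" if "v \<in> verts G" for v
      using vv_add [OF H1_C H1_C] H that by blast
    ultimately show ?thesis
      using H by (simp add: form_eq dir.add_left distrib_left distrib_right sum.distrib)
  qed
  show "h (\<lambda>e x. c * f e x) g = c * h f g" if H: "f \<in> H1" "g \<in> H1" for c f g
  proof -
    have "graph_inner G len (qmul (\<lambda>e x. c * f e x)) g = c * graph_inner G len (qmul f) g"
      unfolding qmul_scale using H by (intro ip.scale_left qmul_L2) auto
    moreover have "vv (\<lambda>e x. c * f e x) v = c * vv f v" if "v \<in> verts G" for v
      using vv_scale [OF H1_C] H that by blast
    ultimately show ?thesis
      using H by (simp add: form_eq dir.scale_left distrib_left sum_distrib_left mult_ac)
  qed
  show "h g f = cnj (h f g)" if H: "f \<in> H1" "g \<in> H1" for f g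
  proof -
    have "graph_inner G len (qmul g) f = cnj (graph_inner G len (qmul f) g)"
      unfolding qmul_symmetric [of f g] using H by (intro ip.hermitian qmul_L2) auto
    then show ?thesis
      unfolding form_eq using dir.hermitian [OF H] by (simp add: mult_ac)
  qed
qed (rule subspace_H1)

definition \<sigma>sum :: real where "\<sigma>sum = (\<Sum>v\<in>verts G. \<bar>\<sigma> v\<bar>)"
text \<open>Chosen so that \<open>2 * \<sigma>sum * \<delta>0 \<le> 1 / 2\<close>: the vertex terms
  then cost at most half of the Dirichlet norm. The \<open>+ 1\<close> covers
  \<open>\<sigma>sum = 0\<close>, and \<open>min_len\<close> keeps the Sobolev window inside every
  edge.\<close>

definition \<delta>0 :: real where "\<delta>0 = min min_len (1 / (4 * (\<sigma>sum + 1)))"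
definition form_lb :: real where "form_lb = qmax + 2 * \<sigma>sum / \<delta>0"

lemma \<sigma>sum_nonneg: "0 \<le> \<sigma>sum"
  by (simp add: \<sigma>sum_def sum_nonneg)

lemma \<delta>0: "0 < \<delta>0" "\<delta>0 \<le> min_len" "2 * \<sigma>sum * \<delta>0 \<le> 1 / 2"
proof -
  show "0 < \<delta>0" "\<delta>0 \<le> min_len" using \<sigma>sum_nonneg min_len(1) by (auto simp: \<delta>0_def)
  have "2 * \<sigma>sum * \<delta>0 \<le> 2 * \<sigma>sum * (1 / (4 * (\<sigma>sum + 1)))"
    using \<sigma>sum_nonneg by (intro mult_left_mono) (auto simp: \<delta>0_def)
  also have "\<dots> \<le> 1 / 2" using \<sigma>sum_nonneg by (simp add: field_simps)
  finally show "2 * \<sigma>sum * \<delta>0 \<le> 1 / 2" .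
qed

lemma form_lb_nonneg: "0 \<le> form_lb"
  using \<delta>0(1) \<sigma>sum_nonneg qmax by (simp add: form_lb_def)

lemma vertex_form_le:
  assumes f: "f \<in> H1"
  shows "\<bar>\<Sum>v\<in>verts G. \<sigma> v * (cmod (vv f v))\<^sup>2\<bar> \<le> 2 * \<sigma>sum / \<delta>0 * nrm f + dnorm f / 2"
proof -
  have "\<bar>\<Sum>v\<in>verts G. \<sigma> v * (cmod (vv f v))\<^sup>2\<bar> \<le> (\<Sum>v\<in>verts G. \<bar>\<sigma> v\<bar> * (2 / \<delta>0 * nrm f + 2 * \<delta>0 * dnorm f))"
    by (rule order_trans [OF sum_abs])
      (use vertex_Sobolev [OF f _ \<delta>0(1,2)] in \<open>auto simp: abs_mult intro!: sum_mono mult_left_mono\<close>)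
  also have "\<dots> = 2 * \<sigma>sum / \<delta>0 * nrm f + 2 * \<sigma>sum * \<delta>0 * dnorm f"
    by (simp add: \<sigma>sum_def distrib_left sum_distrib_left sum_distrib_right sum_divide_distrib sum.distrib mult_ac)
  also have "2 * \<sigma>sum * \<delta>0 * dnorm f \<le> 1 / 2 * dnorm f"
    using \<delta>0(3) dnorm_nonneg by (rule mult_right_mono)
  finally show ?thesis by simp
qed

text \<open>Equivalence of the form norm with that of the Dirichlet form. Compactness, completeness
  and unboundedness are proved for the latter and carried over by these two bounds.\<close>

lemma form_bounds:
  assumes f: "f \<in> H1"
  shows "dnorm f / 2 - form_lb * nrm f \<le> Re (h f f)" "Re (h f f) \<le> 2 * dnorm f + form_lb * nrm f"
proof -
  have "form_lb * nrm f = qmax * nrm f + 2 * \<sigma>sum / \<delta>0 * nrm f" by (simp add: form_lb_def distrib_right)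
  moreover have "\<bar>Re (graph_inner G len (qmul f) f)\<bar> \<le> qmax * nrm f" using f by (intro qmul_form_le) auto
  ultimately show "dnorm f / 2 - form_lb * nrm f \<le> Re (h f f)" "Re (h f f) \<le> 2 * dnorm f + form_lb * nrm f"
    using vertex_form_le [OF f] dnorm_nonneg [of f] unfolding Re_form by linarith+
qed

sublocale cf: closed_form "\<lambda>(c::complex) (f::'e \<Rightarrow> real \<Rightarrow> complex) e x. c * f e x" "graph_L2 G len" "graph_inner G len" H1 h form_lb
proof unfold_locales
  show "- form_lb * nrm f \<le> Re (h f f)" if "f \<in> H1" for f
    using form_bounds(1) [OF that] dnorm_nonneg [of f] by simp
  show "\<exists>r::nat \<Rightarrow> nat. strict_mono r \<and> (\<forall>e>0. \<exists>N. \<forall>m\<ge>N. \<forall>n\<ge>N. nrm (f (r m) - f (r n)) < e)"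
    if f: "\<And>n. f n \<in> H1" "\<And>n. nrm (f n) \<le> K" "\<And>n. Re (h (f n) (f n)) \<le> K" for f :: "nat \<Rightarrow> _" and K
  proof (rule compact_sequence [where K = "2 * K + 2 * form_lb * K"])
    have K: "0 \<le> K" using f(2) [of 0] nrm_nonneg [of "f 0"] by linarith
    fix n
    have "0 \<le> form_lb * K" using K form_lb_nonneg by simp
    then show "nrm (f n) \<le> 2 * K + 2 * form_lb * K" using f(2) [of n] K by simp
    have "form_lb * nrm (f n) \<le> form_lb * K" using f(2) [of n] form_lb_nonneg by (intro mult_left_mono) auto
    then show "dnorm (f n) \<le> 2 * K + 2 * form_lb * K" using form_bounds(1) [OF f(1) [of n]] f(3) [of n] by linarith
  qed (rule f)
  show "\<exists>x\<in>H1. (\<lambda>n. nrm (f n - x)) \<longlonglongrightarrow> 0 \<and> (\<lambda>n. Re (h (f n - x) (f n - x))) \<longlonglongrightarrow> 0"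
    if f: "\<And>n. f n \<in> H1" and C: "\<And>e. e > 0 \<Longrightarrow> \<exists>N. \<forall>m\<ge>N. \<forall>n\<ge>N. nrm (f m - f n) < e \<and> Re (h (f m - f n) (f m - f n)) < e" for f :: "nat \<Rightarrow> _"
  proof -
    have "\<exists>g\<in>H1. (\<lambda>n. nrm (f n - g)) \<longlonglongrightarrow> 0 \<and> (\<lambda>n. dnorm (f n - g)) \<longlonglongrightarrow> 0"
    proof (rule closed_sequence [OF f])
      fix e :: real assume e: "e > 0"
      \<comment> \<open>The first of \<open>form_bounds\<close>, solved for \<open>dnorm\<close>,
        multiplies the tolerance by at most \<open>2 * (1 + form_lb)\<close>.\<close>
      define e' where "e' = e / (2 * (1 + form_lb))"
      have e': "e' > 0" "2 * (1 + form_lb) * e' = e" using e form_lb_nonneg by (auto simp: e'_def)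
      have "e' \<le> (1 + form_lb) * e'" using form_lb_nonneg e' by (simp add: distrib_right)
      then have ee: "e' \<le> e" using e' by linarith
      obtain N where N: "\<And>m n. m \<ge> N \<Longrightarrow> n \<ge> N \<Longrightarrow> nrm (f m - f n) < e' \<and> Re (h (f m - f n) (f m - f n)) < e'"
        using C [OF e'(1)] by blast
      have "nrm (f m - f n) < e \<and> dnorm (f m - f n) < e" if "m \<ge> N" "n \<ge> N" for m n
      proof -
        have "f m - f n \<in> H1" by (intro dir.dom_closed f)
        then have "dnorm (f m - f n) \<le> 2 * Re (h (f m - f n) (f m - f n)) + 2 * (form_lb * nrm (f m - f n))"
          using form_bounds(1) [of "f m - f n"] by linarith
        also have "\<dots> < 2 * e' + 2 * (form_lb * e')"
          using N [OF that] form_lb_nonneg by (intro add_less_le_mono mult_left_mono) auto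
        also have "\<dots> = e" using e'(2) by (simp add: algebra_simps)
        finally show ?thesis using N [OF that] ee by linarith
      qed
      then show "\<exists>N. \<forall>m\<ge>N. \<forall>n\<ge>N. nrm (f m - f n) < e \<and> dnorm (f m - f n) < e" by blast
    qed
    then obtain g where g: "g \<in> H1" "(\<lambda>n. nrm (f n - g)) \<longlonglongrightarrow> 0" "(\<lambda>n. dnorm (f n - g)) \<longlonglongrightarrow> 0" by blast
    have fg: "f n - g \<in> H1" for n by (intro dir.dom_closed f g)
    have 1: "(\<lambda>n. dnorm (f n - g) / 2 - form_lb * nrm (f n - g)) \<longlonglongrightarrow> 0 / 2 - form_lb * 0" by (intro tendsto_intros g) simp
    have 2: "(\<lambda>n. 2 * dnorm (f n - g) + form_lb * nrm (f n - g)) \<longlonglongrightarrow> 2 * 0 + form_lb * 0" by (intro tendsto_intros g)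
    have "(\<lambda>n. Re (h (f n - g) (f n - g))) \<longlonglongrightarrow> 0"
      by (rule tendsto_sandwich [where f = "\<lambda>n. dnorm (f n - g) / 2 - form_lb * nrm (f n - g)" and h = "\<lambda>n. 2 * dnorm (f n - g) + form_lb * nrm (f n - g)"])
        (use 1 2 form_bounds [OF fg] in auto)
    then show ?thesis using g by blast
  qed
  show "\<exists>x\<in>H1. K * nrm x < Re (h x x)" for K
  proof -
    obtain f where f: "f \<in> H1" "2 * (K + form_lb) * nrm f < dnorm f" using dirichlet_unbounded by blast
    then show ?thesis using form_bounds(1) [OF f(1)] by (intro bexI [of _ f]) (auto simp: algebra_simps)
  qed
qed (use H1_graph_L2 nrm_nonneg nrm_definite in auto)

abbreviation "\<psi> \<equiv> cf.eigvec"

lemma eigenspace_eq: "eigenspace G len q \<sigma> t = cf.eigspace t"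
proof -
  have "(f, \<lambda>e x. of_real t * f e x) \<in> schroedinger_operator G len q \<sigma> \<longleftrightarrow>
      f \<in> H1 \<and> (\<forall>y\<in>H1. h f y = of_real t * graph_inner G len f y)" for f
    using ip.scale_left [of f _ "of_real t"] ip.dom_closed(4) [of f "of_real t"] H1_in_L2
    unfolding schroedinger_operator_def by auto
  then show ?thesis by (auto simp: eigenspace_def cf.eigspace_def)
qed

text \<open>The existence that the definite description \<open>eigenvalue\<close> presupposes; with
  it the assumption on eigenvalues becomes one on the minimax sequence
  \<open>cf.eigval\<close>.\<close>

theorem eigenvalue_enumeration_eigval: "eigenvalue_enumeration G len q \<sigma> cf.eigval"
  unfolding eigenvalue_enumeration_def eigenspace_eq graph_fun_dim_def
  using cf.eigval_mono cf.eigval_at_top cf.dim_eigspace by auto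

theorem eigenvalue_eq: "eigenvalue G len q \<sigma> = cf.eigval"
  unfolding eigenvalue_def
  using eigenvalue_enumeration_eigval eigenvalue_enumeration_unique by blast

end

section \<open>Approximate Green functions\<close>

text \<open>
  A solution \<open>U\<close> of \<open>U'' = \<kappa>\<^sup>2 U\<close> off \<open>x0\<close> whose derivative jumps by \<open>-J\<close> at \<open>x0\<close> is described by the
  continuous function \<open>W\<close> that agrees with \<open>U'\<close> before \<open>x0\<close> and with \<open>U' + J\<close> after it.
\<close>

lemma continuous_of_real_L2: "continuous_on {0..l} U \<Longrightarrow> (\<lambda>y. complex_of_real (U y)) \<in> L2_interval l"
  by (intro L2_continuous continuous_on_of_real)

lemma kink_L2:
  assumes "continuous_on {0..l} W"
  shows "(\<lambda>y. complex_of_real (W y - (if y < x0 then 0 else J))) \<in> L2_interval l"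
proof -
  have "{y. \<not> y < x0} \<in> sets borel" by (simp add: not_less flip: atLeast_def)
  then have "(\<lambda>y. complex_of_real (W y) - (if \<not> y < x0 then complex_of_real J else 0)) \<in> L2_interval l"
    by (intro L2_diff continuous_of_real_L2 assms L2_restrict L2_const)
  moreover have "(\<lambda>y. complex_of_real (W y) - (if \<not> y < x0 then complex_of_real J else 0)) =
      (\<lambda>y. complex_of_real (W y - (if y < x0 then 0 else J)))" by auto
  ultimately show ?thesis by (simp only:)
qed

lemma kink_FTC:
  assumes U: "continuous_on {0..l} U" and W: "continuous_on {0..l} W"
    and U': "\<And>y. y \<in> {0<..<l} \<Longrightarrow> y \<noteq> x0 \<Longrightarrow> (U has_real_derivative W y - (if y < x0 then 0 else J)) (at y)"
    and x: "x \<in> {0..l}"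
  shows "complex_of_real (U x) = complex_of_real (U 0) + prim l (\<lambda>y. complex_of_real (W y - (if y < x0 then 0 else J))) x"
proof (rule prim_FTC [where S = "{x0}"])
  show "((\<lambda>x. complex_of_real (U x)) has_vector_derivative complex_of_real (W y - (if y < x0 then 0 else J))) (at y)"
    if "y \<in> {0<..<l} - {x0}" for y
    using that by (intro has_vector_derivative_of_real U') auto
qed (use x U kink_L2 [OF W] in \<open>auto intro!: continuous_on_of_real\<close>)

text \<open>One integration by parts for the continuous part \<open>W\<close>, whose derivative is
  \<open>\<kappa>\<^sup>2 * U\<close>. The jump contributes \<open>J\<close> times the integral of
  \<open>g\<close> from \<open>x0\<close> to \<open>l\<close>, which is
  \<open>J * (f l - f x0)\<close>. Thus the only interior value of \<open>f\<close> on the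
  right-hand side is the one at the kink.\<close>

lemma Green_identity:
  assumes l: "0 < l" and x0: "x0 \<in> {0..l}"
    and f: "\<And>x. x \<in> {0..l} \<Longrightarrow> f x = f 0 + prim l g x" and g: "g \<in> L2_interval l"
    and U: "continuous_on {0..l} U" and W: "continuous_on {0..l} W"
    and W': "\<And>y. y \<in> {0<..<l} \<Longrightarrow> y \<noteq> x0 \<Longrightarrow> (W has_real_derivative \<kappa>\<^sup>2 * U y) (at y)"
  shows "ipI l g (\<lambda>y. complex_of_real (W y - (if y < x0 then 0 else J))) + of_real (\<kappa>\<^sup>2) * ipI l f (\<lambda>y. complex_of_real (U y))
    = f l * of_real (W l) - f 0 * of_real (W 0) - of_real J * (f l - f x0)"
proof -
  define k where "k y = complex_of_real (\<kappa>\<^sup>2 * U y)" for y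
  have k: "k \<in> L2_interval l" unfolding k_def using U by (intro continuous_of_real_L2 continuous_intros)
  have fc: "continuous_on {0..l} f"
    using prim_continuous [OF g] by (subst continuous_on_cong [OF refl f]) (auto intro!: continuous_intros)
  have Wp: "complex_of_real (W x) = of_real (W 0) + prim l k x" if "x \<in> {0..l}" for x
    by (rule prim_FTC [where S = "{x0}"])
      (use that k W W' in \<open>auto intro!: has_vector_derivative_of_real continuous_on_of_real simp: k_def [abs_def] simp del: of_real_mult of_real_power\<close>)
  have gi: "integrable (iv l) g" using g by (rule L2_integrable)
  have int: "integrable (iv l) (\<lambda>y. a y * b y)" if "a \<in> L2_interval l" "continuous_on {0..l} b" for a b :: "real \<Rightarrow> complex"
    using L2_product [OF that(1), of "\<lambda>y. cnj (b y)"] that(2) by (force intro!: L2_continuous continuous_intros)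
  have pl: "prim l g l = f l - f 0" "prim l g x0 = f x0 - f 0"
    using f [of l] f [of x0] l x0 by (auto simp: algebra_simps)
  have "ipI l g (\<lambda>y. complex_of_real (W y - (if y < x0 then 0 else J)))
      = (LINT y|iv l. of_real (W 0) * g y + g y * prim l k y - of_real J * (g y - (if y < x0 then g y else 0)))"
    unfolding ipI_def
  proof (intro Bochner_Integration.integral_cong refl)
    fix y assume "y \<in> space (iv l)"
    then have *: "complex_of_real (W y) = of_real (W 0) + prim l k y" by (intro Wp) auto
    have "g y * cnj (complex_of_real (W y - (if y < x0 then 0 else J))) = g y * (complex_of_real (W y) - (if y < x0 then 0 else of_real J))"
      by simp
    also have "\<dots> = of_real (W 0) * g y + g y * prim l k y - of_real J * (g y - (if y < x0 then g y else 0))"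
      unfolding * by (simp add: algebra_simps)
    finally show "g y * cnj (complex_of_real (W y - (if y < x0 then 0 else J))) = \<dots>" .
  qed
  also have "\<dots> = of_real (W 0) * prim l g l + (LINT y|iv l. g y * prim l k y) - of_real J * (prim l g l - prim l g x0)"
    using gi int [OF g prim_continuous [OF k]] prim_integrable [OF g, of x0]
    by (simp add: prim_end) (simp add: prim_def)
  also have "(LINT y|iv l. g y * prim l k y) = prim l g l * prim l k l - (LINT y|iv l. prim l g y * k y)"
    using prim_by_parts [OF g k] by (simp add: algebra_simps)
  also have "(LINT y|iv l. prim l g y * k y) = (LINT y|iv l. k y * f y - f 0 * k y)"
  proof (intro Bochner_Integration.integral_cong refl)
    fix y assume "y \<in> space (iv l)"
    then have "f y = f 0 + prim l g y" by (intro f) auto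
    then have pg: "prim l g y = f y - f 0" by (simp add: algebra_simps)
    show "prim l g y * k y = k y * f y - f 0 * k y" unfolding pg by (simp add: algebra_simps)
  qed
  also have "\<dots> = (LINT y|iv l. k y * f y) - f 0 * prim l k l"
    using L2_integrable [OF k] int [OF k fc] by (simp add: prim_end)
  also have "(LINT y|iv l. k y * f y) = of_real (\<kappa>\<^sup>2) * ipI l f (\<lambda>y. complex_of_real (U y))"
    unfolding ipI_def by (subst Bochner_Integration.integral_mult_right_zero [symmetric]) (simp add: k_def mult_ac)
  finally have eq: "ipI l g (\<lambda>y. complex_of_real (W y - (if y < x0 then 0 else J))) =
    of_real (W 0) * prim l g l + (prim l g l * prim l k l - (of_real (\<kappa>\<^sup>2) * ipI l f (\<lambda>y. complex_of_real (U y)) - f 0 * prim l k l))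
      - of_real J * (prim l g l - prim l g x0)" .
  have "complex_of_real (W l) = of_real (W 0) + prim l k l" using Wp [of l] l by simp
  then have kl: "prim l k l = of_real (W l) - of_real (W 0)" by (simp add: algebra_simps)
  show ?thesis unfolding eq kl pl by (simp add: algebra_simps)
qed

context metric_graph
begin

definition embed :: "('e \<Rightarrow> real \<Rightarrow> real) \<Rightarrow> 'e \<Rightarrow> real \<Rightarrow> complex" where
  "embed U e y = (if e \<in> arcs G \<and> y \<in> {0..len e} then complex_of_real (U e y) else 0)"

lemma embed_H1:
  assumes U: "\<And>e. e \<in> arcs G \<Longrightarrow> continuous_on {0..len e} (U e)" and W: "\<And>e. e \<in> arcs G \<Longrightarrow> continuous_on {0..len e} (W e)"
    and U': "\<And>e y. e \<in> arcs G \<Longrightarrow> y \<in> {0<..<len e} \<Longrightarrow> y \<noteq> x0 e \<Longrightarrow>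
      (U e has_real_derivative W e y - (if y < x0 e then 0 else J e)) (at y)"
    and z: "\<And>e. e \<in> arcs G \<Longrightarrow> U e 0 = z (tail G e)" "\<And>e. e \<in> arcs G \<Longrightarrow> U e (len e) = z (head G e)"
  shows "embed U \<in> H1"
    and "e \<in> arcs G \<Longrightarrow> AE y in iv (len e). D (embed U) e y = complex_of_real (W e y - (if y < x0 e then 0 else J e))"
    and "v \<in> verts G \<Longrightarrow> vv (embed U) v = of_real (z v)"
proof -
  have C: "embed U \<in> graph_C G len"
  proof (rule graph_C_I [where z = "\<lambda>v. of_real (z v)"])
    show "continuous_on {0..len e} (embed U e)" if e: "e \<in> arcs G" for e
      by (rule continuous_on_eq [OF continuous_on_of_real [OF U [OF e]]]) (use e in \<open>auto simp: embed_def\<close>)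
  qed (use z len_pos in \<open>auto simp: embed_def less_imp_le\<close>)
  have FTC: "embed U e x = embed U e 0 + prim (len e) (\<lambda>y. complex_of_real (W e y - (if y < x0 e then 0 else J e))) x"
    if e: "e \<in> arcs G" and x: "x \<in> {0..len e}" for e x
  proof -
    have "complex_of_real (U e x) = of_real (U e 0) + prim (len e) (\<lambda>y. complex_of_real (W e y - (if y < x0 e then 0 else J e))) x"
      by (rule kink_FTC [OF U [OF e] W [OF e] U' [OF e] x])
    then show ?thesis using e x by (simp only: embed_def atLeastAtMost_iff order_refl simp_thms if_True) auto
  qed
  show H: "embed U \<in> H1"
    by (rule H1_I [OF C]) (use FTC kink_L2 [OF W] in blast)
  show "e \<in> arcs G \<Longrightarrow> AE y in iv (len e). D (embed U) e y = complex_of_real (W e y - (if y < x0 e then 0 else J e))"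
    by (intro D_unique H kink_L2 W FTC)
  show "v \<in> verts G \<Longrightarrow> vv (embed U) v = of_real (z v)"
  proof -
    assume "v \<in> verts G"
    then obtain e where e: "e \<in> arcs G" "tail G e = v \<or> head G e = v" using incident_arc by blast
    then show ?thesis
      using vv_tail [OF C e(1)] vv_head [OF C e(1)] z [OF e(1)] len_pos [OF e(1)] by (auto simp: embed_def)
  qed
qed

text \<open>Away from the kinks \<open>U\<close> solves the homogeneous equation, so only values of
  \<open>f\<close> at edge ends and kinks remain. For an eigenfunction \<open>f\<close> the
  left-hand side is its coefficient along \<open>U\<close> times
  \<open>\<lambda>_n + \<kappa>^2\<close>, up to the terms with \<open>q\<close> and
  \<open>\<sigma>\<close>.\<close>

lemma embed_Green:
  assumes U: "\<And>e. e \<in> arcs G \<Longrightarrow> continuous_on {0..len e} (U e)" and W: "\<And>e. e \<in> arcs G \<Longrightarrow> continuous_on {0..len e} (W e)"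
    and U': "\<And>e y. e \<in> arcs G \<Longrightarrow> y \<in> {0<..<len e} \<Longrightarrow> y \<noteq> x0 e \<Longrightarrow>
      (U e has_real_derivative W e y - (if y < x0 e then 0 else J e)) (at y)"
    and z: "\<And>e. e \<in> arcs G \<Longrightarrow> U e 0 = z (tail G e)" "\<And>e. e \<in> arcs G \<Longrightarrow> U e (len e) = z (head G e)"
    and W': "\<And>e y. e \<in> arcs G \<Longrightarrow> y \<in> {0<..<len e} \<Longrightarrow> y \<noteq> x0 e \<Longrightarrow> (W e has_real_derivative \<kappa>\<^sup>2 * U e y) (at y)"
    and x0: "\<And>e. e \<in> arcs G \<Longrightarrow> x0 e \<in> {0..len e}" and f: "f \<in> H1"
  shows "dirichlet f (embed U) + of_real (\<kappa>\<^sup>2) * graph_inner G len f (embed U) =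
    (\<Sum>e\<in>arcs G. f e (len e) * of_real (W e (len e)) - f e 0 * of_real (W e 0) - of_real (J e) * (f e (len e) - f e (x0 e)))"
  unfolding dirichlet_def graph_inner_ipI sum_distrib_left sum.distrib [symmetric]
proof (intro sum.cong refl)
  fix e assume e: "e \<in> arcs G"
  have uH: "embed U \<in> H1" by (rule embed_H1(1) [OF U W U' z])
  let ?w = "\<lambda>y. complex_of_real (W e y - (if y < x0 e then 0 else J e))"
  have w: "?w \<in> L2_interval (len e)" by (intro kink_L2 W e)
  have "AE y in iv (len e). D (embed U) e y = ?w y"
    by (rule embed_H1(2) [OF U W U' z e])
  then have "ipI (len e) (D (embed U) e) (D f e) = ipI (len e) ?w (D f e)"
    by (rule ipI_cong_AE [OF _ D_L2 [OF uH e] w D_L2 [OF f e]])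
  then have 1: "ipI (len e) (D f e) (D (embed U) e) = ipI (len e) (D f e) ?w"
    using L2.hermitian [OF D_L2 [OF uH e] D_L2 [OF f e]] L2.hermitian [OF w D_L2 [OF f e]] by simp
  have 2: "ipI (len e) (f e) (embed U e) = ipI (len e) (f e) (\<lambda>y. complex_of_real (U e y))"
    unfolding ipI_def by (intro Bochner_Integration.integral_cong refl) (use e in \<open>auto simp: embed_def\<close>)
  show "ipI (len e) (D f e) (D (embed U) e) + of_real (\<kappa>\<^sup>2) * ipI (len e) (f e) (embed U e) =
      f e (len e) * of_real (W e (len e)) - f e 0 * of_real (W e 0) - of_real (J e) * (f e (len e) - f e (x0 e))"
    unfolding 1 2 by (rule Green_identity [OF len_pos [OF e] x0 [OF e] D_FTC [OF f e] D_L2 [OF f e] U [OF e] W [OF e] W' [OF e]])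
qed

lemma embed_nrm: "nrm (embed U) = (\<Sum>e\<in>arcs G. LINT y|iv (len e). (U e y)\<^sup>2)"
  unfolding graph_inner_ipI Re_sum Re_ipI_self
  by (intro sum.cong refl Bochner_Integration.integral_cong) (auto simp: embed_def)

end

section \<open>Hyperbolic functions and their limits\<close>

lemma real_FTC_integral:
  assumes l: "0 \<le> l" and F: "continuous_on {0..l} F" and p: "continuous_on {0..l} p"
    and D: "\<And>y. y \<in> {0<..<l} \<Longrightarrow> y \<noteq> x0 \<Longrightarrow> (F has_real_derivative p y) (at y)"
  shows "(LINT y|iv l. p y) = F l - F 0"
proof -
  have "complex_of_real (F l) = of_real (F 0) + prim l (\<lambda>y. complex_of_real (p y)) l"
    by (rule prim_FTC [where S = "{x0}"])
      (use assms continuous_of_real_L2 [OF p] in \<open>auto intro!: has_vector_derivative_of_real continuous_on_of_real\<close>)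
  then have "complex_of_real (F l) = complex_of_real (F 0 + (LINT y|iv l. p y))" by (simp add: prim_end)
  then show ?thesis by (metis add_diff_cancel_left' of_real_eq_iff)
qed

text \<open>The common divisor of \<open>hsin\<close> and \<open>hcos\<close> makes
  \<open>hsin\<close> equal to 1 at \<open>l\<close>; at \<open>l\<close> the function
  \<open>hcos\<close> is then the hyperbolic cotangent, which tends to 1.\<close>

definition hsin :: "real \<Rightarrow> real \<Rightarrow> real \<Rightarrow> real" where
  "hsin \<kappa> l y = sinh (\<kappa> * y) / sinh (\<kappa> * l)"

definition hcos :: "real \<Rightarrow> real \<Rightarrow> real \<Rightarrow> real" where
  "hcos \<kappa> l y = cosh (\<kappa> * y) / sinh (\<kappa> * l)"

lemma hsin_derivative [derivative_intros]:
  "(f has_real_derivative f') (at x) \<Longrightarrow> ((\<lambda>x. hsin \<kappa> l (f x)) has_real_derivative \<kappa> * hcos \<kappa> l (f x) * f') (at x)"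
  unfolding hsin_def hcos_def by (rule DERIV_cong [OF DERIV_cdivide], (rule derivative_eq_intros refl | assumption)+) simp

lemma hcos_derivative [derivative_intros]:
  "(f has_real_derivative f') (at x) \<Longrightarrow> ((\<lambda>x. hcos \<kappa> l (f x)) has_real_derivative \<kappa> * hsin \<kappa> l (f x) * f') (at x)"
  unfolding hsin_def hcos_def by (rule DERIV_cong [OF DERIV_cdivide], (rule derivative_eq_intros refl | assumption)+) simp

lemma hsin_continuous [continuous_intros]: "continuous_on S f \<Longrightarrow> continuous_on S (\<lambda>x. hsin \<kappa> l (f x))"
  unfolding hsin_def divide_inverse by (intro continuous_intros)

lemma hcos_continuous [continuous_intros]: "continuous_on S f \<Longrightarrow> continuous_on S (\<lambda>x. hcos \<kappa> l (f x))"
  unfolding hcos_def divide_inverse by (intro continuous_intros)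

lemma hsin_0 [simp]: "hsin \<kappa> l 0 = 0"
  by (simp add: hsin_def)

lemma hsin_self [simp]: "0 < \<kappa> \<Longrightarrow> 0 < l \<Longrightarrow> hsin \<kappa> l l = 1"
  by (simp add: hsin_def)

lemma hcos_0: "hcos \<kappa> l 0 = 1 / sinh (\<kappa> * l)"
  by (simp add: hcos_def)

lemma hsin_bounds:
  assumes "0 < \<kappa>" "0 < l" "y \<in> {0..l}"
  shows "0 \<le> hsin \<kappa> l y" "hsin \<kappa> l y \<le> 1"
  using assms by (auto simp: hsin_def divide_le_eq_1)

lemma hcos_ge_1: "0 < \<kappa> \<Longrightarrow> 0 < l \<Longrightarrow> 1 \<le> hcos \<kappa> l l"
  unfolding hcos_def by (subst le_divide_eq_1_pos) (auto simp: sinh_le_cosh_real)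

lemma tendsto_hsin: "((\<lambda>\<kappa>. hsin \<kappa> l x) \<longlongrightarrow> 0) at_top" if "0 < x" "x < l"
  unfolding hsin_def sinh_field_def using that by real_asymp

text \<open>The primitive of \<open>(sinh (\<kappa> * x))\<^sup>2\<close> that vanishes at
  0.\<close>

definition sinh_norm :: "real \<Rightarrow> real \<Rightarrow> real" where
  "sinh_norm \<kappa> x = sinh (2 * \<kappa> * x) / (4 * \<kappa>) - x / 2"

lemma sinh_norm_derivative:
  assumes "(f has_real_derivative f') (at x)" "0 < \<kappa>"
  shows "((\<lambda>x. sinh_norm \<kappa> (f x)) has_real_derivative (sinh (\<kappa> * f x))\<^sup>2 * f') (at x)"
proof -
  have "((\<lambda>x. sinh (2 * \<kappa> * f x) / (4 * \<kappa>) - f x / 2) has_real_derivative (cosh (2 * \<kappa> * f x) * (2 * \<kappa> * f') / (4 * \<kappa>) - f' / 2)) (at x)"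
    by (intro DERIV_diff DERIV_cdivide has_field_derivative_sinh DERIV_cmult assms)
  moreover have "cosh (2 * \<kappa> * f x) = 2 * (sinh (\<kappa> * f x))\<^sup>2 + 1"
    using cosh_double [of "\<kappa> * f x"] cosh_square_eq [of "\<kappa> * f x"] by (simp add: mult.assoc)
  then have "cosh (2 * \<kappa> * f x) * (2 * \<kappa> * f') / (4 * \<kappa>) - f' / 2 = (sinh (\<kappa> * f x))\<^sup>2 * f'"
    using assms(2) by (simp add: field_simps)
  ultimately show ?thesis by (simp add: sinh_norm_def)
qed

lemma sinh_norm_0 [simp]: "sinh_norm \<kappa> 0 = 0"
  by (simp add: sinh_norm_def)

lemma sinh_norm_continuous: "continuous_on S f \<Longrightarrow> continuous_on S (\<lambda>x. sinh_norm \<kappa> (f x))"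
  unfolding sinh_norm_def divide_inverse by (intro continuous_intros)

lemma hsin_integral:
  assumes "0 < \<kappa>" "0 < l"
  shows "(LINT y|iv l. (hsin \<kappa> l y)\<^sup>2) = sinh_norm \<kappa> l / (sinh (\<kappa> * l))\<^sup>2"
    "(LINT y|iv l. (hsin \<kappa> l (l - y))\<^sup>2) = sinh_norm \<kappa> l / (sinh (\<kappa> * l))\<^sup>2"
proof -
  have "(LINT y|iv l. (hsin \<kappa> l y)\<^sup>2) = sinh_norm \<kappa> l / (sinh (\<kappa> * l))\<^sup>2 - sinh_norm \<kappa> 0 / (sinh (\<kappa> * l))\<^sup>2"
  proof (rule real_FTC_integral [where ?x0.0 = 0])
    show "((\<lambda>y. sinh_norm \<kappa> y / (sinh (\<kappa> * l))\<^sup>2) has_real_derivative (hsin \<kappa> l y)\<^sup>2) (at y)" for y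
      using sinh_norm_derivative [OF DERIV_ident assms(1)]
      by (auto intro!: DERIV_cdivide simp: hsin_def power_divide)
  qed (use assms in \<open>auto intro!: continuous_intros sinh_norm_continuous simp: divide_inverse\<close>)
  then show "(LINT y|iv l. (hsin \<kappa> l y)\<^sup>2) = sinh_norm \<kappa> l / (sinh (\<kappa> * l))\<^sup>2" by simp
  have "(LINT y|iv l. (hsin \<kappa> l (l - y))\<^sup>2) = - (sinh_norm \<kappa> (l - l) / (sinh (\<kappa> * l))\<^sup>2) - - (sinh_norm \<kappa> (l - 0) / (sinh (\<kappa> * l))\<^sup>2)"
  proof (rule real_FTC_integral [where ?x0.0 = 0])
    have "((\<lambda>y. sinh_norm \<kappa> (l - y)) has_real_derivative (sinh (\<kappa> * (l - y)))\<^sup>2 * (0 - 1)) (at y)" for y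
      by (intro sinh_norm_derivative DERIV_diff DERIV_const DERIV_ident assms)
    then have "((\<lambda>y. - (sinh_norm \<kappa> (l - y) / (sinh (\<kappa> * l))\<^sup>2)) has_real_derivative - ((sinh (\<kappa> * (l - y)))\<^sup>2 * (0 - 1) / (sinh (\<kappa> * l))\<^sup>2)) (at y)" for y
      by (intro DERIV_minus DERIV_cdivide)
    then show "((\<lambda>y. - (sinh_norm \<kappa> (l - y) / (sinh (\<kappa> * l))\<^sup>2)) has_real_derivative (hsin \<kappa> l (l - y))\<^sup>2) (at y)" for y
      by (simp add: hsin_def power_divide)
  qed (use assms in \<open>auto intro!: continuous_intros sinh_norm_continuous simp: divide_inverse\<close>)
  then show "(LINT y|iv l. (hsin \<kappa> l (l - y))\<^sup>2) = sinh_norm \<kappa> l / (sinh (\<kappa> * l))\<^sup>2" by simp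
qed

text \<open>With \<open>t = \<kappa> l\<close> the leading term is
  \<open>sinh (2 t) / (4 sinh^2 t) = coth t / 2\<close>.\<close>

lemma tendsto_vertex_norm: "((\<lambda>\<kappa>::real. \<kappa> * (sinh_norm \<kappa> l / (sinh (\<kappa> * l))\<^sup>2)) \<longlongrightarrow> 1 / 2) at_top" if "l > 0"
proof -
  have "((\<lambda>\<kappa>::real. \<kappa> * ((sinh (2 * \<kappa> * l) / (4 * \<kappa>) - l / 2) / (sinh (\<kappa> * l))\<^sup>2)) \<longlongrightarrow> inverse ((1 / 2)\<^sup>2) / 8) at_top"
    unfolding sinh_field_def using that by real_asymp
  then show ?thesis by (simp add: power2_eq_square sinh_norm_def)
qed

lemma tendsto_eta: "((\<lambda>\<kappa>::real. hcos \<kappa> l l - 1 + hcos \<kappa> l 0) \<longlongrightarrow> 0) at_top" if "l > 0"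
  unfolding hcos_def sinh_field_def cosh_field_def using that by real_asymp

text \<open>The first factor behaves like \<open>exp (- \<kappa> x)\<close> before squaring, and
  \<open>\<kappa> * sinh_norm \<kappa> x\<close> like \<open>exp (2 \<kappa> x) / 8\<close>. The
  exponentials are split off so that each factor has a finite limit.\<close>

lemma tendsto_half_norm:
  assumes "0 < x" "x < l"
  shows "((\<lambda>\<kappa>::real. \<kappa> * ((hsin \<kappa> l (l - x))\<^sup>2 * sinh_norm \<kappa> x)) \<longlongrightarrow> 1 / 8) at_top"
proof -
  have 1: "((\<lambda>\<kappa>::real. sinh (\<kappa> * y) * exp (\<kappa> * x) / sinh (\<kappa> * (x + y))) \<longlongrightarrow> 1) at_top" if "0 < y" for y
  proof -
    have s: "sinh t = exp t * (1 - exp (- 2 * t)) / 2" for t :: real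
      by (simp add: sinh_field_def right_diff_distrib flip: exp_add)
    have exp_lim: "((\<lambda>\<kappa>::real. exp (- 2 * (\<kappa> * t))) \<longlongrightarrow> 0) at_top" if "0 < t" for t
      using that by real_asymp
    have "((\<lambda>\<kappa>::real. (1 - exp (- 2 * (\<kappa> * y))) / (1 - exp (- 2 * (\<kappa> * (x + y))))) \<longlongrightarrow> (1 - 0) / (1 - 0)) at_top"
      using that assms by (intro tendsto_intros exp_lim) auto
    moreover have "sinh (\<kappa> * y) * exp (\<kappa> * x) / sinh (\<kappa> * (x + y)) = (1 - exp (- 2 * (\<kappa> * y))) / (1 - exp (- 2 * (\<kappa> * (x + y))))" for \<kappa>
    proof -
      have e: "exp (\<kappa> * (x + y)) = exp (\<kappa> * x) * exp (\<kappa> * y)" by (simp add: distrib_left exp_add)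
      have cancel: "E * a / 2 * F / (F * E * b / 2) = a / b" if "E \<noteq> 0" "F \<noteq> 0" for E F a b :: real
        using that by simp
      show ?thesis unfolding s [of "\<kappa> * y"] s [of "\<kappa> * (x + y)"] e by (rule cancel) simp_all
    qed
    ultimately show ?thesis by (simp only: diff_zero div_by_1)
  qed
  have 2: "((\<lambda>\<kappa>::real. exp (-2 * \<kappa> * x) * (sinh (2 * \<kappa> * x) / 4 - \<kappa> * x / 2)) \<longlongrightarrow> 1 / 8) at_top"
    unfolding sinh_field_def using assms by real_asymp
  have "((\<lambda>\<kappa>::real. (hsin \<kappa> l (l - x) * exp (\<kappa> * x))\<^sup>2 * (exp (-2 * \<kappa> * x) * (sinh (2 * \<kappa> * x) / 4 - \<kappa> * x / 2))) \<longlongrightarrow> 1\<^sup>2 * (1 / 8)) at_top"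
    using 1 [of "l - x"] assms by (intro tendsto_intros 2) (simp add: hsin_def)
  moreover have "\<forall>\<^sub>F \<kappa> in at_top. (hsin \<kappa> l (l - x) * exp (\<kappa> * x))\<^sup>2 * (exp (-2 * \<kappa> * x) * (sinh (2 * \<kappa> * x) / 4 - \<kappa> * x / 2))
      = \<kappa> * ((hsin \<kappa> l (l - x))\<^sup>2 * sinh_norm \<kappa> x)"
    using eventually_gt_at_top [of 0]
  proof eventually_elim
    case (elim \<kappa>)
    have "(exp (\<kappa> * x))\<^sup>2 * exp (-2 * \<kappa> * x) = 1"
      by (simp add: power2_eq_square flip: exp_add)
    then have "(hsin \<kappa> l (l - x) * exp (\<kappa> * x))\<^sup>2 * (exp (-2 * \<kappa> * x) * (sinh (2 * \<kappa> * x) / 4 - \<kappa> * x / 2))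
      = (hsin \<kappa> l (l - x))\<^sup>2 * (sinh (2 * \<kappa> * x) / 4 - \<kappa> * x / 2)"
      by (simp only: power_mult_distrib mult.assoc) (simp only: mult.assoc [symmetric] mult_1_right)
    then show ?case using elim by (simp add: sinh_norm_def right_diff_distrib)
  qed
  ultimately show ?thesis by (simp add: filterlim_cong)
qed

section \<open>Approximate Green functions at the vertices\<close>

context metric_graph
begin

text \<open>
  The solution of \<open>U'' = \<kappa>\<^sup>2 U\<close> on the edges with value \<open>1\<close> at \<open>v\<close> and \<open>0\<close> at the other vertices. There
  are no loops, so at most one of the first two cases applies.
\<close>

definition vertexU :: "'v \<Rightarrow> real \<Rightarrow> 'e \<Rightarrow> real \<Rightarrow> real" where
  "vertexU v \<kappa> e y = (if tail G e = v then hsin \<kappa> (len e) (len e - y) else if head G e = v then hsin \<kappa> (len e) y else 0)"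

definition vertexW :: "'v \<Rightarrow> real \<Rightarrow> 'e \<Rightarrow> real \<Rightarrow> real" where
  "vertexW v \<kappa> e y = (if tail G e = v then - \<kappa> * hcos \<kappa> (len e) (len e - y) else if head G e = v then \<kappa> * hcos \<kappa> (len e) y else 0)"

text \<open>At the two ends of an edge, the slope of \<open>vertexU\<close> has modulus
  \<open>\<kappa>\<close> times a hyperbolic cotangent at the vertex itself and
  \<open>\<kappa>\<close> over a hyperbolic sine at the other end. On a half-line these would be
  \<open>\<kappa>\<close> and \<open>0\<close>; the deviations are added up over all edges.\<close>

definition eta :: "real \<Rightarrow> real" where
  "eta \<kappa> = (\<Sum>e\<in>arcs G. hcos \<kappa> (len e) (len e) - 1 + hcos \<kappa> (len e) 0)"

lemma tendsto_eta_graph: "(eta \<longlongrightarrow> 0) at_top"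
proof -
  have "((\<lambda>\<kappa>. \<Sum>e\<in>arcs G. hcos \<kappa> (len e) (len e) - 1 + hcos \<kappa> (len e) 0) \<longlongrightarrow> (\<Sum>e\<in>arcs G. 0)) at_top"
    by (intro tendsto_sum tendsto_eta len_pos)
  then show ?thesis by (simp add: eta_def [abs_def])
qed

lemma vertexU_continuous: "continuous_on {0..len e} (vertexU v \<kappa> e)"
  by (cases "tail G e = v"; cases "head G e = v") (simp_all add: vertexU_def [abs_def], (intro continuous_intros)+)

lemma vertexW_continuous: "continuous_on {0..len e} (vertexW v \<kappa> e)"
  by (cases "tail G e = v"; cases "head G e = v") (simp_all add: vertexW_def [abs_def], (intro continuous_intros)+)

lemma vertexU_derivative: "(vertexU v \<kappa> e has_real_derivative vertexW v \<kappa> e y) (at y)"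
  by (cases "tail G e = v"; cases "head G e = v") (auto simp: vertexU_def [abs_def] vertexW_def intro!: derivative_eq_intros)

lemma vertexW_derivative: "(vertexW v \<kappa> e has_real_derivative \<kappa>\<^sup>2 * vertexU v \<kappa> e y) (at y)"
  by (cases "tail G e = v"; cases "head G e = v") (auto simp: vertexU_def vertexW_def [abs_def] power2_eq_square intro!: derivative_eq_intros)

lemma vertex_degree_eq: "real (vertex_degree G v) = (\<Sum>e\<in>arcs G. of_bool (tail G e = v) + of_bool (head G e = v))"
  by (simp add: vertex_degree_def in_degree_def out_degree_def in_arcs_def out_arcs_def sum.distrib of_bool_def
      sum.If_cases Int_def conj_commute)

lemma degree_pos: "v \<in> verts G \<Longrightarrow> 1 \<le> vertex_degree G v"
proof -
  assume "v \<in> verts G"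
  then obtain e where "e \<in> arcs G" "tail G e = v \<or> head G e = v" using incident_arc by blast
  then have "0 < card (in_arcs G v) \<or> 0 < card (out_arcs G v)"
    by (auto simp: card_gt_0_iff in_arcs_def out_arcs_def)
  then show ?thesis by (auto simp: vertex_degree_def in_degree_def out_degree_def)
qed

end

locale loopfree_metric_graph = metric_graph G len
  for G :: "('v, 'e) pre_digraph" (structure) and len :: "'e \<Rightarrow> real" +
  assumes loopfree: "e \<in> arcs G \<Longrightarrow> tail G e \<noteq> head G e"
begin

lemma vertexU_boundary:
  assumes "0 < \<kappa>" "e \<in> arcs G"
  shows "vertexU v \<kappa> e 0 = (if tail G e = v then 1 else 0)" "vertexU v \<kappa> e (len e) = (if head G e = v then 1 else 0)"
  using assms len_pos [of e] loopfree [of e] by (auto simp: vertexU_def)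

lemma vertexU_H1:
  assumes "0 < \<kappa>"
  shows "embed (vertexU v \<kappa>) \<in> H1" "w \<in> verts G \<Longrightarrow> vv (embed (vertexU v \<kappa>)) w = (if w = v then 1 else 0)"
proof -
  \<comment> \<open>There is no kink; a jump of size 0 at the point 0 gives the derivative the shape
    that \<open>embed_H1\<close> expects.\<close>
  have D: "(vertexU v \<kappa> e has_real_derivative vertexW v \<kappa> e y - (if y < 0 then 0 else 0)) (at y)" for e y
    using vertexU_derivative by simp
  show "embed (vertexU v \<kappa>) \<in> H1"
    by (rule embed_H1(1) [OF vertexU_continuous vertexW_continuous D, where z = "\<lambda>w. if w = v then 1 else 0"])
      (use vertexU_boundary assms in auto)
  have "w \<in> verts G \<Longrightarrow> vv (embed (vertexU v \<kappa>)) w = of_real (if w = v then 1 else 0)"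
    by (rule embed_H1(3) [OF vertexU_continuous vertexW_continuous D, where z = "\<lambda>w. if w = v then 1 else 0"])
      (use vertexU_boundary assms in auto)
  then show "w \<in> verts G \<Longrightarrow> vv (embed (vertexU v \<kappa>)) w = (if w = v then 1 else 0)" by simp
qed

text \<open>Each edge at \<open>v\<close> contributes almost exactly \<open>\<kappa>\<close> times
  the value at \<open>v\<close>, which adds up to the degree; everything else is a vertex value
  multiplied by a deviation collected in \<open>eta\<close>.\<close>

lemma vertex_Green:
  assumes \<kappa>: "0 < \<kappa>" and f: "f \<in> H1" and v: "v \<in> verts G"
  shows "cmod (dirichlet f (embed (vertexU v \<kappa>)) + of_real (\<kappa>\<^sup>2) * graph_inner G len f (embed (vertexU v \<kappa>))
      - of_real (\<kappa> * vertex_degree G v) * vv f v) \<le> \<kappa> * eta \<kappa> * (\<Sum>w\<in>verts G. cmod (vv f w))"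
proof -
  define m where "m = (\<Sum>w\<in>verts G. cmod (vv f w))"
  have m: "cmod (vv f w) \<le> m" if "w \<in> verts G" for w
    unfolding m_def using that by (intro member_le_sum) auto
  have D: "(vertexU v \<kappa> e has_real_derivative vertexW v \<kappa> e y - (if y < 0 then 0 else 0)) (at y)" for e y
    using vertexU_derivative by simp
  have "dirichlet f (embed (vertexU v \<kappa>)) + of_real (\<kappa>\<^sup>2) * graph_inner G len f (embed (vertexU v \<kappa>)) =
    (\<Sum>e\<in>arcs G. f e (len e) * of_real (vertexW v \<kappa> e (len e)) - f e 0 * of_real (vertexW v \<kappa> e 0) - of_real 0 * (f e (len e) - f e 0))"
    by (rule embed_Green [OF vertexU_continuous vertexW_continuous D, where z = "\<lambda>w. if w = v then 1 else 0"])
      (use vertexU_boundary \<kappa> vertexW_derivative f len_pos in \<open>auto simp: less_imp_le\<close>)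
  then have eq: "dirichlet f (embed (vertexU v \<kappa>)) + of_real (\<kappa>\<^sup>2) * graph_inner G len f (embed (vertexU v \<kappa>)) - of_real (\<kappa> * vertex_degree G v) * vv f v
    = (\<Sum>e\<in>arcs G. f e (len e) * of_real (vertexW v \<kappa> e (len e)) - f e 0 * of_real (vertexW v \<kappa> e 0)
        - of_real (\<kappa> * (of_bool (tail G e = v) + of_bool (head G e = v))) * vv f v)"
    by (simp add: vertex_degree_eq sum_subtractf sum_distrib_left sum_distrib_right)
  have "cmod (f e (len e) * of_real (vertexW v \<kappa> e (len e)) - f e 0 * of_real (vertexW v \<kappa> e 0)
        - of_real (\<kappa> * (of_bool (tail G e = v) + of_bool (head G e = v))) * vv f v)
      \<le> \<kappa> * (hcos \<kappa> (len e) (len e) - 1 + hcos \<kappa> (len e) 0) * m" if e: "e \<in> arcs G" for e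
  proof -
    let ?c = "hcos \<kappa> (len e) (len e) - 1" and ?d = "hcos \<kappa> (len e) 0"
    have cd: "0 \<le> ?c" "0 \<le> ?d"
      using hcos_ge_1 [OF \<kappa> len_pos [OF e]] \<kappa> len_pos [OF e] by (auto simp: hcos_0)
    have ends: "f e 0 = vv f (tail G e)" "f e (len e) = vv f (head G e)"
      using vv_tail [OF H1_C [OF f] e] vv_head [OF H1_C [OF f] e] by auto
    have est: "cmod (of_real (\<kappa> * ?c) * a - of_real (\<kappa> * ?d) * b) \<le> \<kappa> * (?c + ?d) * m"
      if "cmod a \<le> m" "cmod b \<le> m" for a b
    proof -
      have "cmod (of_real (\<kappa> * ?c) * a - of_real (\<kappa> * ?d) * b) \<le> cmod (of_real (\<kappa> * ?c) * a) + cmod (of_real (\<kappa> * ?d) * b)"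
        by (rule norm_triangle_ineq4)
      also have "\<dots> = \<kappa> * ?c * cmod a + \<kappa> * ?d * cmod b"
        unfolding norm_mult norm_of_real using cd \<kappa> by simp
      also have "\<dots> \<le> \<kappa> * ?c * m + \<kappa> * ?d * m"
        using cd \<kappa> that by (intro add_mono mult_left_mono) auto
      finally show ?thesis by (simp add: algebra_simps)
    qed
    consider "tail G e = v" "head G e \<noteq> v" | "tail G e \<noteq> v" "head G e = v" | "tail G e \<noteq> v" "head G e \<noteq> v"
      using loopfree [OF e] by blast
    then show ?thesis
    proof cases
      case 1
      then have "f e (len e) * of_real (vertexW v \<kappa> e (len e)) - f e 0 * of_real (vertexW v \<kappa> e 0)
        - of_real (\<kappa> * (of_bool (tail G e = v) + of_bool (head G e = v))) * vv f v = of_real (\<kappa> * ?c) * vv f v - of_real (\<kappa> * ?d) * vv f (head G e)"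
        by (simp add: vertexW_def ends algebra_simps)
      then show ?thesis using est [OF m [OF v] m [OF head_in_verts [OF e]]] by simp
    next
      case 2
      then have "f e (len e) * of_real (vertexW v \<kappa> e (len e)) - f e 0 * of_real (vertexW v \<kappa> e 0)
        - of_real (\<kappa> * (of_bool (tail G e = v) + of_bool (head G e = v))) * vv f v = of_real (\<kappa> * ?c) * vv f v - of_real (\<kappa> * ?d) * vv f (tail G e)"
        by (simp add: vertexW_def ends algebra_simps)
      then show ?thesis using est [OF m [OF v] m [OF tail_in_verts [OF e]]] by simp
    next
      case 3
      moreover have "0 \<le> m" unfolding m_def by (simp add: sum_nonneg)
      ultimately show ?thesis using cd \<kappa> by (simp add: vertexW_def)
    qed
  qed
  then have "(\<Sum>e\<in>arcs G. cmod (f e (len e) * of_real (vertexW v \<kappa> e (len e)) - f e 0 * of_real (vertexW v \<kappa> e 0)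
        - of_real (\<kappa> * (of_bool (tail G e = v) + of_bool (head G e = v))) * vv f v))
      \<le> (\<Sum>e\<in>arcs G. \<kappa> * (hcos \<kappa> (len e) (len e) - 1 + hcos \<kappa> (len e) 0) * m)"
    by (rule sum_mono)
  also have "\<dots> = \<kappa> * eta \<kappa> * m" by (simp add: eta_def sum_distrib_left sum_distrib_right)
  finally have le: "(\<Sum>e\<in>arcs G. cmod (f e (len e) * of_real (vertexW v \<kappa> e (len e)) - f e 0 * of_real (vertexW v \<kappa> e 0)
        - of_real (\<kappa> * (of_bool (tail G e = v) + of_bool (head G e = v))) * vv f v)) \<le> \<kappa> * eta \<kappa> * m" .
  show ?thesis unfolding eq by (rule order_trans [OF norm_sum le [unfolded m_def]])
qed

lemma vertexU_nrm:
  assumes "0 < \<kappa>"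
  shows "nrm (embed (vertexU v \<kappa>)) = (\<Sum>e\<in>arcs G. (of_bool (tail G e = v) + of_bool (head G e = v)) * (sinh_norm \<kappa> (len e) / (sinh (\<kappa> * len e))\<^sup>2))"
  unfolding embed_nrm
proof (intro sum.cong refl)
  fix e assume e: "e \<in> arcs G"
  show "(LINT y|iv (len e). (vertexU v \<kappa> e y)\<^sup>2) = (of_bool (tail G e = v) + of_bool (head G e = v)) * (sinh_norm \<kappa> (len e) / (sinh (\<kappa> * len e))\<^sup>2)"
    using hsin_integral [OF assms len_pos [OF e]] loopfree [OF e] by (auto simp: vertexU_def)
qed

lemma tendsto_vertexU_nrm: "((\<lambda>\<kappa>. \<kappa> * nrm (embed (vertexU v \<kappa>))) \<longlongrightarrow> vertex_degree G v / 2) at_top"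
proof -
  have "((\<lambda>\<kappa>. \<Sum>e\<in>arcs G. (of_bool (tail G e = v) + of_bool (head G e = v)) * (\<kappa> * (sinh_norm \<kappa> (len e) / (sinh (\<kappa> * len e))\<^sup>2)))
      \<longlongrightarrow> (\<Sum>e\<in>arcs G. (of_bool (tail G e = v) + of_bool (head G e = v)) * (1 / 2))) at_top"
    by (intro tendsto_sum tendsto_mult tendsto_const tendsto_vertex_norm len_pos)
  also have "(\<Sum>e\<in>arcs G. (of_bool (tail G e = v) + of_bool (head G e = v)) * (1 / 2)) = vertex_degree G v / (2::real)"
    by (simp add: vertex_degree_eq sum_divide_distrib)
  finally show ?thesis
  proof (rule Lim_transform_eventually)
    show "\<forall>\<^sub>F \<kappa> in at_top. (\<Sum>e\<in>arcs G. (of_bool (tail G e = v) + of_bool (head G e = v)) * (\<kappa> * (sinh_norm \<kappa> (len e) / (sinh (\<kappa> * len e))\<^sup>2)))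
        = \<kappa> * nrm (embed (vertexU v \<kappa>))"
      using eventually_gt_at_top [of 0]
    proof eventually_elim
      case (elim \<kappa>)
      show ?case unfolding vertexU_nrm [OF elim] sum_distrib_left by (simp only: mult.left_commute)
    qed
  qed
qed

end

section \<open>Approximate Green functions inside an edge\<close>

lemma max_derivative:
  assumes "y \<noteq> x"
  shows "((\<lambda>y. max 0 (y - x)) has_real_derivative (if y < x then 0 else 1)) (at y)"
proof (cases "y < x")
  case True
  have "((\<lambda>_. 0) has_real_derivative 0) (at y)" by simp
  then have "((\<lambda>y. max 0 (y - x)) has_real_derivative 0) (at y)"
    by (rule has_field_derivative_transform_within_open [where S = "{..<x}"]) (use True in auto)
  then show ?thesis using True by simp
next
  case False
  have "((\<lambda>y. y - x) has_real_derivative 1) (at y)" by (auto intro!: derivative_eq_intros)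
  then have "((\<lambda>y. max 0 (y - x)) has_real_derivative 1) (at y)"
    by (rule has_field_derivative_transform_within_open [where S = "{x<..}"]) (use False assms in auto)
  then show ?thesis using False by simp
qed

text \<open>Reconciles the two formulas for the Green function to the right of its kink: the one
  with a subtracted hyperbolic sine and the product form.\<close>

lemma sinh_three: "sinh (a + b) * sinh (b + c) - sinh (a + b + c) * sinh b = sinh a * sinh (c::real)"
proof -
  have "sinh (a + b) * sinh (b + c) - sinh (a + b + c) * sinh b =
    sinh a * sinh c * ((cosh b)\<^sup>2 - (sinh b)\<^sup>2)"
    by (simp only: sinh_add cosh_add power2_eq_square) algebra
  then show ?thesis by (simp add: hyperbolic_pythagoras)
qed

lemma sinh_product_le: "0 \<le> a \<Longrightarrow> 0 \<le> b \<Longrightarrow> sinh a * sinh b \<le> sinh (a + b) / (2::real)"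
proof -
  assume "0 \<le> a" "0 \<le> b"
  then have "sinh a * sinh b \<le> sinh a * cosh b" "sinh a * sinh b \<le> cosh a * sinh b"
    using sinh_le_cosh_real by (auto intro!: mult_left_mono mult_right_mono)
  then show ?thesis by (simp add: sinh_add)
qed

context metric_graph
begin

text \<open>
  This is \<open>\<kappa>\<close> times the Green function of \<open>-d\<^sup>2/dx\<^sup>2 + \<kappa>\<^sup>2\<close> on \<open>e0\<close> with Dirichlet conditions; for
  \<open>y \<ge> x\<close> it equals \<open>sinh (\<kappa> x) sinh (\<kappa> (l - y)) / sinh (\<kappa> l)\<close>.
\<close>

definition interiorU :: "'e \<Rightarrow> real \<Rightarrow> real \<Rightarrow> 'e \<Rightarrow> real \<Rightarrow> real" where
  "interiorU e0 x \<kappa> e y = (if e = e0 then hsin \<kappa> (len e0) (len e0 - x) * sinh (\<kappa> * y) - sinh (\<kappa> * max 0 (y - x)) else 0)"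

text \<open>The \<open>- 1\<close> adds the jump \<open>\<kappa>\<close> back to the derivative
  beyond \<open>x\<close>; with it the subtracted term vanishes at \<open>x\<close>, and
  \<open>interiorW\<close> is continuous there.\<close>

definition interiorW :: "'e \<Rightarrow> real \<Rightarrow> real \<Rightarrow> 'e \<Rightarrow> real \<Rightarrow> real" where
  "interiorW e0 x \<kappa> e y = (if e = e0 then \<kappa> * hsin \<kappa> (len e0) (len e0 - x) * cosh (\<kappa> * y) - \<kappa> * (cosh (\<kappa> * max 0 (y - x)) - 1) else 0)"

lemma interior_continuous: "continuous_on {0..len e} (interiorU e0 x \<kappa> e)" "continuous_on {0..len e} (interiorW e0 x \<kappa> e)"
  by (cases "e = e0"; simp add: interiorU_def [abs_def] interiorW_def [abs_def]; intro continuous_intros)+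

lemma interiorU_derivative:
  assumes "y \<noteq> (if e = e0 then x else 0)"
  shows "(interiorU e0 x \<kappa> e has_real_derivative interiorW e0 x \<kappa> e y - (if y < (if e = e0 then x else 0) then 0 else (if e = e0 then \<kappa> else 0))) (at y)"
proof (cases "e = e0")
  case True
  have "((\<lambda>y. hsin \<kappa> (len e0) (len e0 - x) * sinh (\<kappa> * y) - sinh (\<kappa> * max 0 (y - x))) has_real_derivative
      hsin \<kappa> (len e0) (len e0 - x) * (cosh (\<kappa> * y) * (\<kappa> * 1)) - cosh (\<kappa> * max 0 (y - x)) * (\<kappa> * (if y < x then 0 else 1))) (at y)"
    by (intro DERIV_diff DERIV_cmult has_field_derivative_sinh DERIV_ident max_derivative) (use assms True in auto)
  then show ?thesis using True by (auto simp: interiorU_def [abs_def] interiorW_def algebra_simps split: if_splits)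
qed (simp add: interiorU_def [abs_def] interiorW_def)

lemma interiorW_derivative:
  assumes "y \<noteq> (if e = e0 then x else 0)"
  shows "(interiorW e0 x \<kappa> e has_real_derivative \<kappa>\<^sup>2 * interiorU e0 x \<kappa> e y) (at y)"
proof (cases "e = e0")
  case True
  have "((\<lambda>y. \<kappa> * hsin \<kappa> (len e0) (len e0 - x) * cosh (\<kappa> * y) - \<kappa> * (cosh (\<kappa> * max 0 (y - x)) - 1)) has_real_derivative
      \<kappa> * hsin \<kappa> (len e0) (len e0 - x) * (sinh (\<kappa> * y) * (\<kappa> * 1)) - \<kappa> * (sinh (\<kappa> * max 0 (y - x)) * (\<kappa> * (if y < x then 0 else 1)) - 0)) (at y)"
    by (intro DERIV_diff DERIV_cmult has_field_derivative_cosh DERIV_const DERIV_ident max_derivative) (use assms True in auto)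
  then show ?thesis
    using True by (auto simp: interiorU_def interiorW_def [abs_def] algebra_simps power2_eq_square max_def split: if_splits)
qed (simp add: interiorU_def interiorW_def [abs_def])

context
  fixes e0 :: 'e and x \<kappa> :: real
  assumes e0: "e0 \<in> arcs G" and x: "x \<in> {0<..<len e0}" and \<kappa>: "0 < \<kappa>"
begin

lemma interiorU_boundary: "interiorU e0 x \<kappa> e 0 = 0" "interiorU e0 x \<kappa> e (len e) = 0"
  using x \<kappa> by (auto simp: interiorU_def hsin_def)

lemma interiorU_H1: "embed (interiorU e0 x \<kappa>) \<in> H1"
  and interiorU_vv: "w \<in> verts G \<Longrightarrow> vv (embed (interiorU e0 x \<kappa>)) w = 0"
proof -
  show "embed (interiorU e0 x \<kappa>) \<in> H1"
    by (rule embed_H1(1) [OF interior_continuous interiorU_derivative, where z = "\<lambda>_. 0"]) (auto simp: interiorU_boundary)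
  have "w \<in> verts G \<Longrightarrow> vv (embed (interiorU e0 x \<kappa>)) w = of_real 0"
    by (rule embed_H1(3) [OF interior_continuous interiorU_derivative, where z = "\<lambda>_. 0"]) (auto simp: interiorU_boundary)
  then show "w \<in> verts G \<Longrightarrow> vv (embed (interiorU e0 x \<kappa>)) w = 0" by simp
qed

text \<open>An exact identity. The function vanishes at both ends of its edge, so its neighbours
  enter only through its slopes there, which are \<open>\<kappa>\<close> times an
  \<open>hsin\<close> and exponentially small when \<open>x\<close> is fixed.\<close>

lemma interior_Green:
  assumes f: "f \<in> H1"
  shows "dirichlet f (embed (interiorU e0 x \<kappa>)) + of_real (\<kappa>\<^sup>2) * graph_inner G len f (embed (interiorU e0 x \<kappa>))
    = of_real \<kappa> * f e0 x - of_real (\<kappa> * hsin \<kappa> (len e0) (len e0 - x)) * f e0 0 - of_real (\<kappa> * hsin \<kappa> (len e0) x) * f e0 (len e0)"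
proof -
  let ?l = "len e0"
  have l: "0 < ?l" using len_pos e0 by blast
  have "dirichlet f (embed (interiorU e0 x \<kappa>)) + of_real (\<kappa>\<^sup>2) * graph_inner G len f (embed (interiorU e0 x \<kappa>))
    = (\<Sum>e\<in>arcs G. f e (len e) * of_real (interiorW e0 x \<kappa> e (len e)) - f e 0 * of_real (interiorW e0 x \<kappa> e 0)
      - of_real (if e = e0 then \<kappa> else 0) * (f e (len e) - f e (if e = e0 then x else 0)))"
    by (rule embed_Green [OF interior_continuous interiorU_derivative, where z = "\<lambda>_. 0"])
      (use x f len_pos in \<open>auto simp: interiorU_boundary less_imp_le intro: interiorW_derivative\<close>)
  also have "\<dots> = (\<Sum>e\<in>{e0}. f e (len e) * of_real (interiorW e0 x \<kappa> e (len e)) - f e 0 * of_real (interiorW e0 x \<kappa> e 0)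
      - of_real (if e = e0 then \<kappa> else 0) * (f e (len e) - f e (if e = e0 then x else 0)))"
    using e0 by (intro sum.mono_neutral_right) (auto simp: interiorW_def)
  also have "\<dots> = f e0 ?l * of_real (interiorW e0 x \<kappa> e0 ?l - \<kappa>) - f e0 0 * of_real (interiorW e0 x \<kappa> e0 0) + of_real \<kappa> * f e0 x"
    by (simp add: algebra_simps)
  also have "interiorW e0 x \<kappa> e0 ?l - \<kappa> = - (\<kappa> * hsin \<kappa> ?l x)"
  proof -
    have "hsin \<kappa> ?l (?l - x) * cosh (\<kappa> * ?l) - cosh (\<kappa> * (?l - x))
        = (sinh (\<kappa> * (?l - x)) * cosh (\<kappa> * ?l) - cosh (\<kappa> * (?l - x)) * sinh (\<kappa> * ?l)) / sinh (\<kappa> * ?l)"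
      using l \<kappa> by (simp add: hsin_def diff_divide_distrib)
    also have "\<dots> = sinh (\<kappa> * (?l - x) - \<kappa> * ?l) / sinh (\<kappa> * ?l)"
      by (simp only: sinh_diff)
    also have "\<kappa> * (?l - x) - \<kappa> * ?l = - (\<kappa> * x)" by (simp add: algebra_simps)
    finally have "hsin \<kappa> ?l (?l - x) * cosh (\<kappa> * ?l) - cosh (\<kappa> * (?l - x)) = - hsin \<kappa> ?l x"
      by (simp add: hsin_def)
    then have "\<kappa> * (hsin \<kappa> ?l (?l - x) * cosh (\<kappa> * ?l) - cosh (\<kappa> * (?l - x))) = \<kappa> * - hsin \<kappa> ?l x" by simp
    then show ?thesis using x by (simp add: interiorW_def algebra_simps)
  qed
  also have "interiorW e0 x \<kappa> e0 0 = \<kappa> * hsin \<kappa> ?l (?l - x)"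
    using x by (simp add: interiorW_def)
  finally show ?thesis by (simp add: algebra_simps)
qed

text \<open>Testing \<open>U\<close> with itself gives
  \<open>dnorm + \<kappa>^2 nrm = \<kappa> U(x)\<close>, and \<open>U(x) \<le> 1/2\<close>. Unlike
  the limit of the norm, this bound is uniform in \<open>x\<close> up to the ends of the
  edge.\<close>

lemma interiorU_nrm_le: "\<kappa> * nrm (embed (interiorU e0 x \<kappa>)) \<le> 1 / 2"
proof -
  let ?l = "len e0" and ?u = "embed (interiorU e0 x \<kappa>)"
  have l: "0 < ?l" using len_pos e0 by blast
  have ends: "?u e0 0 = 0" "?u e0 ?l = 0" using interiorU_boundary [of e0] by (auto simp: embed_def)
  have ux: "?u e0 x = of_real (hsin \<kappa> ?l (?l - x) * sinh (\<kappa> * x))"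
    using e0 x by (simp add: embed_def interiorU_def)
  have "dirichlet ?u ?u + of_real (\<kappa>\<^sup>2) * graph_inner G len ?u ?u = of_real (\<kappa> * (hsin \<kappa> ?l (?l - x) * sinh (\<kappa> * x)))"
    using interior_Green [OF interiorU_H1] unfolding ends ux by simp
  then have "dnorm ?u + \<kappa>\<^sup>2 * nrm ?u = \<kappa> * (hsin \<kappa> ?l (?l - x) * sinh (\<kappa> * x))"
    by (drule_tac arg_cong [where f = Re]) simp
  moreover have "hsin \<kappa> ?l (?l - x) * sinh (\<kappa> * x) \<le> 1 / 2"
    using sinh_product_le [of "\<kappa> * (?l - x)" "\<kappa> * x"] x \<kappa> l by (simp add: hsin_def field_simps)
  then have "\<kappa> * (hsin \<kappa> ?l (?l - x) * sinh (\<kappa> * x)) \<le> \<kappa> * (1 / 2)"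
    using \<kappa> by (intro mult_left_mono) auto
  ultimately have "\<kappa> * (\<kappa> * nrm ?u) \<le> \<kappa> * (1 / 2)"
    using dnorm_nonneg [of ?u] by (simp add: power2_eq_square mult.assoc)
  then show ?thesis using \<kappa> by simp
qed

lemma interiorU_nrm:
  "nrm (embed (interiorU e0 x \<kappa>)) = (hsin \<kappa> (len e0) (len e0 - x))\<^sup>2 * sinh_norm \<kappa> x + (hsin \<kappa> (len e0) x)\<^sup>2 * sinh_norm \<kappa> (len e0 - x)"
proof -
  let ?l = "len e0" and ?A = "hsin \<kappa> (len e0) (len e0 - x)" and ?B = "hsin \<kappa> (len e0) x"
  \<comment> \<open>A primitive of the square: left of \<open>x\<close> only the first term varies,
    right of \<open>x\<close> only the second, and \<open>min\<close> and \<open>max\<close> glue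
    them continuously.\<close>
  let ?F = "\<lambda>y. ?A\<^sup>2 * sinh_norm \<kappa> (min y x) - ?B\<^sup>2 * sinh_norm \<kappa> (?l - max y x)"
  have l: "0 < ?l" using len_pos e0 by blast
  have "(LINT y|iv ?l. (interiorU e0 x \<kappa> e0 y)\<^sup>2) = ?F ?l - ?F 0"
  proof (rule real_FTC_integral [where ?x0.0 = x])
    show "continuous_on {0..?l} ?F" by (intro continuous_intros sinh_norm_continuous)
    show "continuous_on {0..?l} (\<lambda>y. (interiorU e0 x \<kappa> e0 y)\<^sup>2)" by (intro continuous_intros interior_continuous)
    fix y assume y: "y \<in> {0<..<?l}" "y \<noteq> x"
    show "(?F has_real_derivative (interiorU e0 x \<kappa> e0 y)\<^sup>2) (at y)"
    proof (cases "y < x")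
      case True
      have "((\<lambda>y. ?A\<^sup>2 * sinh_norm \<kappa> y - ?B\<^sup>2 * sinh_norm \<kappa> (?l - x)) has_real_derivative ?A\<^sup>2 * ((sinh (\<kappa> * y))\<^sup>2 * 1) - 0) (at y)"
        by (intro DERIV_diff DERIV_cmult sinh_norm_derivative DERIV_ident DERIV_const \<kappa>)
      then have "(?F has_real_derivative ?A\<^sup>2 * ((sinh (\<kappa> * y))\<^sup>2 * 1) - 0) (at y)"
        by (rule has_field_derivative_transform_within_open [where S = "{..<x}"]) (use True in auto)
      then show ?thesis using True by (simp add: interiorU_def power_mult_distrib)
    next
      case False
      then have xy: "x < y" using y by simp
      have "((\<lambda>y. ?A\<^sup>2 * sinh_norm \<kappa> x - ?B\<^sup>2 * sinh_norm \<kappa> (?l - y)) has_real_derivative 0 - ?B\<^sup>2 * ((sinh (\<kappa> * (?l - y)))\<^sup>2 * (0 - 1))) (at y)"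
        by (intro DERIV_diff DERIV_cmult sinh_norm_derivative DERIV_ident DERIV_const \<kappa>)
      then have "(?F has_real_derivative 0 - ?B\<^sup>2 * ((sinh (\<kappa> * (?l - y)))\<^sup>2 * (0 - 1))) (at y)"
        by (rule has_field_derivative_transform_within_open [where S = "{x<..}"]) (use xy in auto)
      moreover have "interiorU e0 x \<kappa> e0 y = ?B * sinh (\<kappa> * (?l - y))"
      proof -
        have "sinh (\<kappa> * (?l - x)) * sinh (\<kappa> * y) - sinh (\<kappa> * ?l) * sinh (\<kappa> * (y - x)) = sinh (\<kappa> * (?l - y)) * sinh (\<kappa> * x)"
          using sinh_three [of "\<kappa> * (?l - y)" "\<kappa> * (y - x)" "\<kappa> * x"] by (simp add: algebra_simps)
        then show ?thesis using l \<kappa> xy by (simp add: interiorU_def hsin_def field_simps)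
      qed
      ultimately show ?thesis by (simp add: power_mult_distrib)
    qed
  qed (use l in auto)
  also have "\<dots> = ?A\<^sup>2 * sinh_norm \<kappa> x + ?B\<^sup>2 * sinh_norm \<kappa> (?l - x)"
    using x by (simp add: min_def max_def)
  finally have e: "(LINT y|iv ?l. (interiorU e0 x \<kappa> e0 y)\<^sup>2) = ?A\<^sup>2 * sinh_norm \<kappa> x + ?B\<^sup>2 * sinh_norm \<kappa> (?l - x)" .
  have "nrm (embed (interiorU e0 x \<kappa>)) = (\<Sum>e\<in>{e0}. LINT y|iv (len e). (interiorU e0 x \<kappa> e y)\<^sup>2)"
    unfolding embed_nrm using e0 by (intro sum.mono_neutral_right) (auto simp: interiorU_def)
  then show ?thesis using e by simp
qed

end

lemma tendsto_interiorU_nrm: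
  assumes e0: "e0 \<in> arcs G" and x: "x \<in> {0<..<len e0}"
  shows "((\<lambda>\<kappa>. \<kappa> * nrm (embed (interiorU e0 x \<kappa>))) \<longlongrightarrow> 1 / 4) at_top"
proof (rule Lim_transform_eventually)
  \<comment> \<open>Both sides of the kink contribute \<open>1/8\<close>; the second summand is the
    first with \<open>x\<close> reflected to \<open>len e0 - x\<close>.\<close>
  have "((\<lambda>\<kappa>. \<kappa> * ((hsin \<kappa> (len e0) (len e0 - x))\<^sup>2 * sinh_norm \<kappa> x) + \<kappa> * ((hsin \<kappa> (len e0) (len e0 - (len e0 - x)))\<^sup>2 * sinh_norm \<kappa> (len e0 - x)))
      \<longlongrightarrow> 1 / 8 + 1 / 8) at_top"
    using x by (intro tendsto_add tendsto_half_norm) auto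
  then show "((\<lambda>\<kappa>. \<kappa> * ((hsin \<kappa> (len e0) (len e0 - x))\<^sup>2 * sinh_norm \<kappa> x) + \<kappa> * ((hsin \<kappa> (len e0) x)\<^sup>2 * sinh_norm \<kappa> (len e0 - x)))
      \<longlongrightarrow> 1 / 4) at_top" by simp
  show "\<forall>\<^sub>F \<kappa> in at_top. \<kappa> * ((hsin \<kappa> (len e0) (len e0 - x))\<^sup>2 * sinh_norm \<kappa> x) + \<kappa> * ((hsin \<kappa> (len e0) x)\<^sup>2 * sinh_norm \<kappa> (len e0 - x))
      = \<kappa> * nrm (embed (interiorU e0 x \<kappa>))"
    using eventually_gt_at_top [of 0]
    by eventually_elim (simp only: interiorU_nrm [OF e0 x] distrib_left)
qed

end

section \<open>The trace inequality\<close>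

lemma L2_set_diff_le:
  assumes "\<And>n. n \<in> A \<Longrightarrow> \<bar>f n - g n\<bar> \<le> b n" "\<And>n. n \<in> A \<Longrightarrow> 0 \<le> f n" "\<And>n. n \<in> A \<Longrightarrow> 0 \<le> g n"
  shows "\<bar>L2_set f A - L2_set g A\<bar> \<le> L2_set b A"
proof -
  have "L2_set f A \<le> L2_set (\<lambda>n. g n + b n) A" "L2_set g A \<le> L2_set (\<lambda>n. f n + b n) A"
    using assms by (force intro!: L2_set_mono)+
  then show ?thesis
    using L2_set_triangle_ineq [of g b A] L2_set_triangle_ineq [of f b A] by linarith
qed

lemma L2_set_sum_le: "finite I \<Longrightarrow> L2_set (\<lambda>n. \<Sum>i\<in>I. f i n) A \<le> (\<Sum>i\<in>I. L2_set (f i) A)"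
proof (induction I rule: finite_induct)
  case empty
  then show ?case by (simp add: L2_set_def)
next
  case (insert i I)
  then show ?case using L2_set_triangle_ineq [of "f i" "\<lambda>n. \<Sum>i\<in>I. f i n" A] by simp
qed

lemma L2_set_bounded_summable:
  fixes f :: "nat \<Rightarrow> real"
  assumes "\<And>N. L2_set f {..<N} \<le> B"
  shows "summable (\<lambda>n. (f n)\<^sup>2)" "(\<lambda>N. L2_set f {..<N}) \<longlonglongrightarrow> sqrt (\<Sum>n. (f n)\<^sup>2)"
proof -
  have "0 \<le> B" using assms [of 0] by (simp add: L2_set_def)
  show s: "summable (\<lambda>n. (f n)\<^sup>2)"
  proof (rule summableI_nonneg_bounded)
    show "(\<Sum>n<N. (f n)\<^sup>2) \<le> B\<^sup>2" for N
    proof -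
      have "(L2_set f {..<N})\<^sup>2 \<le> B\<^sup>2" by (intro power_mono assms L2_set_nonneg)
      then show ?thesis by (simp add: L2_set_def sum_nonneg)
    qed
  qed simp
  then have "(\<lambda>N. \<Sum>n<N. (f n)\<^sup>2) \<longlonglongrightarrow> (\<Sum>n. (f n)\<^sup>2)" by (rule summable_LIMSEQ)
  then show "(\<lambda>N. L2_set f {..<N}) \<longlonglongrightarrow> sqrt (\<Sum>n. (f n)\<^sup>2)"
    unfolding L2_set_def by (intro tendsto_intros)
qed

text \<open>The induction needs the stronger bound \<open>w N * (\<Sum>n<N. v n)\<close>: as partial
  sums are nonpositive, passing to the smaller weight \<open>w (Suc N)\<close> only raises
  it.\<close>

lemma Abel_sum_nonpos:
  fixes w v :: "nat \<Rightarrow> real"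
  assumes w: "\<And>n. w (Suc n) \<le> w n" "\<And>n. 0 \<le> w n" and v: "\<And>k. (\<Sum>n<k. v n) \<le> 0"
  shows "(\<Sum>n<N. w n * v n) \<le> 0"
proof -
  have "(\<Sum>n<N. w n * v n) \<le> w N * (\<Sum>n<N. v n)"
  proof (induction N)
    case (Suc N)
    have "(\<Sum>n<Suc N. w n * v n) \<le> w N * (\<Sum>n<N. v n) + w N * v N" using Suc by simp
    also have "\<dots> = w N * (\<Sum>n<Suc N. v n)" by (simp add: distrib_left)
    also have "\<dots> \<le> w (Suc N) * (\<Sum>n<Suc N. v n)"
      using w(1) v by (rule mult_right_mono_neg)
    finally show ?case .
  qed simp
  also have "\<dots> \<le> 0" using w(2) v by (simp add: mult_nonneg_nonpos)
  finally show ?thesis .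
qed

section \<open>Eigenfunction values against coefficients of approximate Green functions\<close>

locale loopfree_schroedinger = schroedinger G len q \<sigma> + loopfree_metric_graph G len
  for G :: "('v, 'e) pre_digraph" (structure) and len :: "'e \<Rightarrow> real"
    and q :: "'e \<Rightarrow> real \<Rightarrow> real" and \<sigma> :: "'v \<Rightarrow> real"
begin

abbreviation mu :: "real \<Rightarrow> nat \<Rightarrow> real" where "mu \<kappa> n \<equiv> cf.eigval n + \<kappa>\<^sup>2"

definition vertex_sum :: "nat \<Rightarrow> real" where "vertex_sum n = (\<Sum>w\<in>verts G. cmod (vv (\<psi> n) w))"

lemma psi_H1 [simp]: "\<psi> n \<in> H1"
  by (rule cf.eigvec_V)

lemma vv_le_vertex_sum: "w \<in> verts G \<Longrightarrow> cmod (vv (\<psi> n) w) \<le> vertex_sum n"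
  unfolding vertex_sum_def by (intro member_le_sum) auto

lemma eigen_test:
  assumes u: "u \<in> H1"
  shows "of_real (mu \<kappa> n) * graph_inner G len (\<psi> n) u = (dirichlet (\<psi> n) u + of_real (\<kappa>\<^sup>2) * graph_inner G len (\<psi> n) u)
    + graph_inner G len (\<psi> n) (qmul u) + (\<Sum>v\<in>verts G. of_real (\<sigma> v) * (vv (\<psi> n) v * cnj (vv u v)))"
proof -
  have "of_real (cf.eigval n) * graph_inner G len (\<psi> n) u = h (\<psi> n) u"
    using cf.eigvec_eigen [OF u] by simp
  then show ?thesis by (simp add: form_eq qmul_symmetric distrib_right)
qed

text \<open>Three errors: \<open>eta\<close> from the Green identity, \<open>\<sigma>\<close> from
  the vertex condition, and the potential. The last is kept as a coefficient of
  \<open>qmul u\<close> and not estimated for each \<open>n\<close>, because Bessel's inequality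
  controls it after summation.\<close>

lemma vertex_est:
  fixes \<kappa> :: real
  assumes \<kappa>: "0 < \<kappa>" and v: "v \<in> verts G"
  shows "cmod (of_real (\<kappa> * vertex_degree G v) * vv (\<psi> n) v - of_real (mu \<kappa> n) * graph_inner G len (\<psi> n) (embed (vertexU v \<kappa>)))
    \<le> (\<kappa> * eta \<kappa> + \<sigma>sum) * vertex_sum n + cmod (graph_inner G len (\<psi> n) (qmul (embed (vertexU v \<kappa>))))"
proof -
  let ?u = "embed (vertexU v \<kappa>)"
  let ?g = "dirichlet (\<psi> n) ?u + of_real (\<kappa>\<^sup>2) * graph_inner G len (\<psi> n) ?u - of_real (\<kappa> * vertex_degree G v) * vv (\<psi> n) v"
  have s: "(\<Sum>w\<in>verts G. of_real (\<sigma> w) * (vv (\<psi> n) w * cnj (vv ?u w))) = of_real (\<sigma> v) * vv (\<psi> n) v"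
  proof -
    have "(\<Sum>w\<in>verts G. of_real (\<sigma> w) * (vv (\<psi> n) w * cnj (vv ?u w))) = (\<Sum>w\<in>verts G. if w = v then of_real (\<sigma> w) * vv (\<psi> n) w else 0)"
      using vertexU_H1(2) [OF \<kappa>] by (intro sum.cong) auto
    then show ?thesis using v by simp
  qed
  have eq: "of_real (\<kappa> * vertex_degree G v) * vv (\<psi> n) v - of_real (mu \<kappa> n) * graph_inner G len (\<psi> n) ?u
      = - (?g + of_real (\<sigma> v) * vv (\<psi> n) v + graph_inner G len (\<psi> n) (qmul ?u))"
    unfolding eigen_test [OF vertexU_H1(1) [OF \<kappa>]] s by simp
  have le: "cmod (of_real (\<kappa> * vertex_degree G v) * vv (\<psi> n) v - of_real (mu \<kappa> n) * graph_inner G len (\<psi> n) ?u)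
    \<le> cmod ?g + cmod (of_real (\<sigma> v) * vv (\<psi> n) v) + cmod (graph_inner G len (\<psi> n) (qmul ?u))"
    unfolding eq norm_minus_cancel by (intro order_trans [OF norm_triangle_ineq] add_mono norm_triangle_ineq order_refl)
  have 1: "cmod ?g \<le> \<kappa> * eta \<kappa> * vertex_sum n"
    unfolding vertex_sum_def by (rule vertex_Green [OF \<kappa> psi_H1 v])
  have 2: "cmod (of_real (\<sigma> v) * vv (\<psi> n) v) \<le> \<sigma>sum * vertex_sum n"
  proof -
    have "\<bar>\<sigma> v\<bar> \<le> \<sigma>sum" unfolding \<sigma>sum_def using v by (intro member_le_sum) auto
    then show ?thesis using vv_le_vertex_sum [OF v] \<sigma>sum_nonneg by (simp add: norm_mult mult_mono)
  qed
  show ?thesis using order_trans [OF le add_right_mono [OF add_mono [OF 1 2]]] by (simp only: distrib_right)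
qed

text \<open>\<open>interiorU\<close> vanishes at the vertices, so \<open>\<sigma>\<close>
  contributes nothing; the vertices act only through the end values in
  \<open>interior_Green\<close>.\<close>

lemma interior_est:
  fixes \<kappa> :: real
  assumes e: "e \<in> arcs G" and x: "x \<in> {0<..<len e}" and \<kappa>: "0 < \<kappa>"
  shows "cmod (of_real \<kappa> * \<psi> n e x - of_real (mu \<kappa> n) * graph_inner G len (\<psi> n) (embed (interiorU e x \<kappa>)))
    \<le> \<kappa> * (hsin \<kappa> (len e) (len e - x) + hsin \<kappa> (len e) x) * vertex_sum n + cmod (graph_inner G len (\<psi> n) (qmul (embed (interiorU e x \<kappa>))))"
proof -
  let ?u = "embed (interiorU e x \<kappa>)" and ?A = "hsin \<kappa> (len e) (len e - x)" and ?B = "hsin \<kappa> (len e) x"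
  have AB: "0 \<le> ?A" "0 \<le> ?B" using x \<kappa> len_pos [OF e] by (auto intro!: hsin_bounds)
  have s: "(\<Sum>w\<in>verts G. of_real (\<sigma> w) * (vv (\<psi> n) w * cnj (vv ?u w))) = 0"
    using interiorU_vv [OF e x \<kappa>] by (intro sum.neutral) auto
  have eq: "of_real \<kappa> * \<psi> n e x - of_real (mu \<kappa> n) * graph_inner G len (\<psi> n) ?u
      = of_real (\<kappa> * ?A) * \<psi> n e 0 + of_real (\<kappa> * ?B) * \<psi> n e (len e) - graph_inner G len (\<psi> n) (qmul ?u)"
    unfolding eigen_test [OF interiorU_H1 [OF e x \<kappa>]] s interior_Green [OF e x \<kappa> psi_H1] by simp
  have le: "cmod (of_real \<kappa> * \<psi> n e x - of_real (mu \<kappa> n) * graph_inner G len (\<psi> n) ?u)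
    \<le> cmod (of_real (\<kappa> * ?A) * \<psi> n e 0) + cmod (of_real (\<kappa> * ?B) * \<psi> n e (len e)) + cmod (graph_inner G len (\<psi> n) (qmul ?u))"
    unfolding eq by (intro order_trans [OF norm_triangle_ineq4] add_mono norm_triangle_ineq order_refl)
  have 1: "cmod (of_real (\<kappa> * ?A) * \<psi> n e 0) \<le> \<kappa> * ?A * vertex_sum n"
    unfolding norm_mult norm_of_real using AB \<kappa> vv_le_vertex_sum [OF tail_in_verts [OF e], of n] vv_tail [OF H1_C [OF psi_H1] e, of n]
    by (simp add: mult_left_mono)
  have 2: "cmod (of_real (\<kappa> * ?B) * \<psi> n e (len e)) \<le> \<kappa> * ?B * vertex_sum n"
    unfolding norm_mult norm_of_real using AB \<kappa> vv_le_vertex_sum [OF head_in_verts [OF e], of n] vv_head [OF H1_C [OF psi_H1] e, of n]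
    by (simp add: mult_left_mono)
  have "\<kappa> * ?A * vertex_sum n + \<kappa> * ?B * vertex_sum n = \<kappa> * (?A + ?B) * vertex_sum n" by (simp add: algebra_simps)
  then show ?thesis using order_trans [OF le add_right_mono [OF add_mono [OF 1 2]]] by (simp only:)
qed

lemma cmod_ip_commute: "x \<in> graph_L2 G len \<Longrightarrow> y \<in> graph_L2 G len \<Longrightarrow> cmod (graph_inner G len x y) = cmod (graph_inner G len y x)"
  using ip.hermitian [of x y] by simp

lemma L2_set_ip_le:
  assumes "u \<in> graph_L2 G len"
  shows "L2_set (\<lambda>n. cmod (graph_inner G len (\<psi> n) u)) {..<N} \<le> sqrt (nrm u)"
  using cf.bessel [OF assms, of N] assms cmod_ip_commute [OF assms H1_in_L2 [OF psi_H1]]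
  unfolding L2_set_def by simp

lemma L2_set_ip_tendsto:
  assumes "u \<in> H1"
  shows "(\<lambda>N. L2_set (\<lambda>n. cmod (graph_inner G len (\<psi> n) u)) {..<N}) \<longlonglongrightarrow> sqrt (nrm u)"
  using cf.parseval [OF assms] cmod_ip_commute [OF H1_in_L2 [OF assms] H1_in_L2 [OF psi_H1]]
  unfolding L2_set_def sums_def by (auto intro!: tendsto_intros)

text \<open>
  The last condition lets the vertex terms on the right of \<open>vertex_est\<close> be absorbed into the left.
\<close>

definition admissible_kappa :: "real \<Rightarrow> bool" where
  "admissible_kappa \<kappa> \<longleftrightarrow> 0 < \<kappa> \<and> 2 * form_lb \<le> \<kappa>\<^sup>2 \<and> card (verts G) * (\<kappa> * eta \<kappa> + \<sigma>sum) \<le> \<kappa> / 2"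

lemma mu_ge:
  assumes "admissible_kappa \<kappa>"
  shows "\<kappa>\<^sup>2 / 2 \<le> mu \<kappa> n" "0 < mu \<kappa> n"
proof -
  show 1: "\<kappa>\<^sup>2 / 2 \<le> mu \<kappa> n" using assms cf.eigval_ge [of n] by (simp add: admissible_kappa_def)
  have "0 < \<kappa>\<^sup>2 / 2" using assms by (simp add: admissible_kappa_def)
  then show "0 < mu \<kappa> n" using 1 by linarith
qed

lemma eta_nonneg: "0 < \<kappa> \<Longrightarrow> 0 \<le> eta \<kappa>"
  unfolding eta_def using hcos_ge_1 len_pos by (intro sum_nonneg add_nonneg_nonneg) (auto simp: hcos_0 less_imp_le)

lemma eventually_admissible_kappa: "eventually admissible_kappa at_top"
proof -
  have 1: "\<forall>\<^sub>F \<kappa> in at_top. 2 * form_lb \<le> \<kappa>\<^sup>2"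
  proof -
    have "filterlim (\<lambda>\<kappa>::real. \<kappa>\<^sup>2) at_top at_top" by (rule filterlim_pow_at_top) (auto intro: filterlim_ident)
    then show ?thesis unfolding filterlim_at_top by blast
  qed
  have "((\<lambda>\<kappa>. card (verts G) * (eta \<kappa> + \<sigma>sum / \<kappa>)) \<longlongrightarrow> real (card (verts G)) * (0 + 0)) at_top"
    by (intro tendsto_intros tendsto_eta_graph tendsto_divide_0 [OF tendsto_const]
        filterlim_at_top_imp_at_infinity filterlim_ident)
  then have "\<forall>\<^sub>F \<kappa> in at_top. card (verts G) * (eta \<kappa> + \<sigma>sum / \<kappa>) < 1 / 2"
    by (rule order_tendstoD(2)) simp
  with 1 eventually_gt_at_top [of 0] show ?thesis
  proof eventually_elim
    case (elim \<kappa>)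
    have "card (verts G) * (\<kappa> * eta \<kappa> + \<sigma>sum) = \<kappa> * (card (verts G) * (eta \<kappa> + \<sigma>sum / \<kappa>))"
      using elim by (simp add: field_simps)
    also have "\<dots> \<le> \<kappa> * (1 / 2)" using elim by (intro mult_left_mono) auto
    finally show ?case using elim by (simp add: admissible_kappa_def)
  qed
qed

text \<open>The estimate is divided by \<open>mu \<kappa> n\<close> and summed in the Euclidean
  norm; Bessel and \<open>mu \<kappa> n \<ge> \<kappa>\<^sup>2 / 2\<close> turn the potential into
  the factor \<open>2 * qmax / \<kappa>\<^sup>2\<close>. The sums stay finite because the norm of
  the vertex sums on the right is unbounded a priori and is to be absorbed first.\<close>

lemma approx:
  assumes \<kappa>: "admissible_kappa \<kappa>" and u: "u \<in> H1" and \<alpha>: "0 \<le> \<alpha>" and t: "0 \<le> t"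
    and est: "\<And>n. cmod (of_real \<alpha> * a n - of_real (mu \<kappa> n) * graph_inner G len (\<psi> n) u)
      \<le> t * vertex_sum n + cmod (graph_inner G len (\<psi> n) (qmul u))"
  shows "\<bar>\<alpha> * L2_set (\<lambda>n. cmod (a n) / mu \<kappa> n) {..<N} - L2_set (\<lambda>n. cmod (graph_inner G len (\<psi> n) u)) {..<N}\<bar>
    \<le> t * L2_set (\<lambda>n. vertex_sum n / mu \<kappa> n) {..<N} + 2 * qmax / \<kappa>\<^sup>2 * sqrt (nrm u)"
proof -
  have \<kappa>0: "0 < \<kappa>" using \<kappa> by (simp add: admissible_kappa_def)
  have uL: "u \<in> graph_L2 G len" using u by blast
  let ?b = "\<lambda>n. t * (vertex_sum n / mu \<kappa> n) + 2 / \<kappa>\<^sup>2 * cmod (graph_inner G len (\<psi> n) (qmul u))"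
  have "\<bar>\<alpha> * (cmod (a n) / mu \<kappa> n) - cmod (graph_inner G len (\<psi> n) u)\<bar> \<le> ?b n" for n
  proof -
    have m: "0 < mu \<kappa> n" "\<kappa>\<^sup>2 / 2 \<le> mu \<kappa> n" using mu_ge [OF \<kappa>] by auto
    have "\<bar>\<alpha> * (cmod (a n) / mu \<kappa> n) - cmod (graph_inner G len (\<psi> n) u)\<bar>
        = \<bar>cmod (of_real \<alpha> * a n) - cmod (of_real (mu \<kappa> n) * graph_inner G len (\<psi> n) u)\<bar> / mu \<kappa> n"
    proof -
      have n: "cmod (of_real (mu \<kappa> n) * z) = mu \<kappa> n * cmod z" "cmod (of_real \<alpha> * z) = \<alpha> * cmod z" for z
        unfolding norm_mult norm_of_real using m(1) \<alpha> by simp_all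
      have "\<alpha> * (cmod (a n) / mu \<kappa> n) - c = (\<alpha> * cmod (a n) - mu \<kappa> n * c) / mu \<kappa> n" for c
        using m(1) by (simp add: diff_divide_distrib)
      then show ?thesis unfolding n using m(1) by (simp only: abs_divide abs_of_pos)
    qed
    also have "\<dots> \<le> (t * vertex_sum n + cmod (graph_inner G len (\<psi> n) (qmul u))) / mu \<kappa> n"
      using m(1) by (intro divide_right_mono order_trans [OF norm_triangle_ineq3 est]) auto
    also have "\<dots> = t * (vertex_sum n / mu \<kappa> n) + cmod (graph_inner G len (\<psi> n) (qmul u)) / mu \<kappa> n"
      by (simp add: add_divide_distrib)
    also have "cmod (graph_inner G len (\<psi> n) (qmul u)) / mu \<kappa> n \<le> cmod (graph_inner G len (\<psi> n) (qmul u)) / (\<kappa>\<^sup>2 / 2)"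
      using m \<kappa>0 by (intro divide_left_mono) auto
    finally show ?thesis by (simp add: mult.commute)
  qed
  then have "\<bar>L2_set (\<lambda>n. \<alpha> * (cmod (a n) / mu \<kappa> n)) {..<N} - L2_set (\<lambda>n. cmod (graph_inner G len (\<psi> n) u)) {..<N}\<bar> \<le> L2_set ?b {..<N}"
    using \<alpha> mu_ge(2) [OF \<kappa>] by (intro L2_set_diff_le) (auto intro!: mult_nonneg_nonneg divide_nonneg_pos)
  also have "L2_set (\<lambda>n. \<alpha> * (cmod (a n) / mu \<kappa> n)) {..<N} = \<alpha> * L2_set (\<lambda>n. cmod (a n) / mu \<kappa> n) {..<N}"
    using \<alpha> by (rule L2_set_right_distrib [symmetric])
  also have "L2_set ?b {..<N} \<le> L2_set (\<lambda>n. t * (vertex_sum n / mu \<kappa> n)) {..<N} + L2_set (\<lambda>n. 2 / \<kappa>\<^sup>2 * cmod (graph_inner G len (\<psi> n) (qmul u))) {..<N}"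
    by (rule L2_set_triangle_ineq)
  also have "L2_set (\<lambda>n. t * (vertex_sum n / mu \<kappa> n)) {..<N} = t * L2_set (\<lambda>n. vertex_sum n / mu \<kappa> n) {..<N}"
    using t by (rule L2_set_right_distrib [symmetric])
  also have "L2_set (\<lambda>n. 2 / \<kappa>\<^sup>2 * cmod (graph_inner G len (\<psi> n) (qmul u))) {..<N} = 2 / \<kappa>\<^sup>2 * L2_set (\<lambda>n. cmod (graph_inner G len (\<psi> n) (qmul u))) {..<N}"
    by (rule L2_set_right_distrib [symmetric]) simp
  also have "\<dots> \<le> 2 / \<kappa>\<^sup>2 * (qmax * sqrt (nrm u))"
  proof (rule mult_left_mono)
    have "L2_set (\<lambda>n. cmod (graph_inner G len (\<psi> n) (qmul u))) {..<N} \<le> sqrt (nrm (qmul u))"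
      by (intro L2_set_ip_le qmul_L2 uL)
    also have "\<dots> \<le> sqrt (qmax\<^sup>2 * nrm u)" using qmul_nrm [OF uL] by simp
    also have "\<dots> = qmax * sqrt (nrm u)" using qmax(1) by (simp add: real_sqrt_mult)
    finally show "L2_set (\<lambda>n. cmod (graph_inner G len (\<psi> n) (qmul u))) {..<N} \<le> qmax * sqrt (nrm u)" .
  qed simp
  finally show ?thesis by (simp add: mult.assoc)
qed

definition vertex_majorant :: "real \<Rightarrow> real" where
  "vertex_majorant \<kappa> = 2 / \<kappa> * (1 + 2 * qmax / \<kappa>\<^sup>2) * (\<Sum>w\<in>verts G. sqrt (nrm (embed (vertexU w \<kappa>))))"

text \<open>Absorption: \<open>approx\<close> is summed over all vertices, with degrees at least 1
  discarded on the left. For admissible \<open>\<kappa>\<close> the vertex sums reappear on the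
  right with a factor of at most \<open>\<kappa> / 2\<close> and take away half of the left-hand
  side.\<close>

lemma vertex_majorant_bound:
  assumes \<kappa>: "admissible_kappa \<kappa>"
  shows "L2_set (\<lambda>n. vertex_sum n / mu \<kappa> n) {..<N} \<le> vertex_majorant \<kappa>"
proof -
  have \<kappa>0: "0 < \<kappa>" using \<kappa> by (simp add: admissible_kappa_def)
  let ?M = "L2_set (\<lambda>n. vertex_sum n / mu \<kappa> n) {..<N}" and ?U = "\<lambda>w. sqrt (nrm (embed (vertexU w \<kappa>)))"
  let ?X = "\<lambda>w. L2_set (\<lambda>n. cmod (vv (\<psi> n) w) / mu \<kappa> n) {..<N}"
  have t: "0 \<le> \<kappa> * eta \<kappa> + \<sigma>sum" using \<kappa>0 eta_nonneg \<sigma>sum_nonneg by simp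
  have X: "\<kappa> * ?X w \<le> (1 + 2 * qmax / \<kappa>\<^sup>2) * ?U w + (\<kappa> * eta \<kappa> + \<sigma>sum) * ?M" if w: "w \<in> verts G" for w
  proof -
    have "\<bar>\<kappa> * vertex_degree G w * ?X w - L2_set (\<lambda>n. cmod (graph_inner G len (\<psi> n) (embed (vertexU w \<kappa>)))) {..<N}\<bar>
        \<le> (\<kappa> * eta \<kappa> + \<sigma>sum) * ?M + 2 * qmax / \<kappa>\<^sup>2 * ?U w"
      using \<kappa>0 by (intro approx \<kappa> vertexU_H1 t vertex_est w) auto
    moreover have "L2_set (\<lambda>n. cmod (graph_inner G len (\<psi> n) (embed (vertexU w \<kappa>)))) {..<N} \<le> ?U w"
      using vertexU_H1(1) [OF \<kappa>0] by (intro L2_set_ip_le) auto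
    moreover have "\<kappa> * ?X w \<le> \<kappa> * vertex_degree G w * ?X w"
      using degree_pos [OF w] \<kappa>0 by (intro mult_right_mono L2_set_nonneg) auto
    ultimately show ?thesis by (simp add: distrib_right)
  qed
  have "?M \<le> (\<Sum>w\<in>verts G. ?X w)"
    unfolding vertex_sum_def sum_divide_distrib by (rule L2_set_sum_le) simp
  then have "\<kappa> * ?M \<le> (\<Sum>w\<in>verts G. \<kappa> * ?X w)"
    using \<kappa>0 by (simp flip: sum_distrib_left)
  also have "\<dots> \<le> (\<Sum>w\<in>verts G. (1 + 2 * qmax / \<kappa>\<^sup>2) * ?U w + (\<kappa> * eta \<kappa> + \<sigma>sum) * ?M)"
    by (rule sum_mono) (rule X)
  also have "\<dots> = (1 + 2 * qmax / \<kappa>\<^sup>2) * (\<Sum>w\<in>verts G. ?U w) + card (verts G) * (\<kappa> * eta \<kappa> + \<sigma>sum) * ?M"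
    by (simp add: sum.distrib sum_distrib_left)
  also have "card (verts G) * (\<kappa> * eta \<kappa> + \<sigma>sum) * ?M \<le> \<kappa> / 2 * ?M"
    using \<kappa> by (intro mult_right_mono L2_set_nonneg) (simp add: admissible_kappa_def)
  finally have "\<kappa> / 2 * ?M \<le> (1 + 2 * qmax / \<kappa>\<^sup>2) * (\<Sum>w\<in>verts G. ?U w)" by simp
  then have "2 / \<kappa> * (\<kappa> / 2 * ?M) \<le> 2 / \<kappa> * ((1 + 2 * qmax / \<kappa>\<^sup>2) * (\<Sum>w\<in>verts G. ?U w))"
    using \<kappa>0 by (intro mult_left_mono) auto
  moreover have "2 / \<kappa> * (\<kappa> / 2 * ?M) = ?M" using \<kappa>0 by simp
  ultimately show ?thesis by (simp only: vertex_majorant_def mult.assoc)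
qed

definition weighted_sum :: "real \<Rightarrow> (nat \<Rightarrow> complex) \<Rightarrow> real" where
  "weighted_sum \<kappa> a = (\<Sum>n. (cmod (a n) / mu \<kappa> n)\<^sup>2)"

text \<open>Uniform bounds in \<open>N\<close> give summability. In the limit Parseval replaces the
  coefficients of \<open>u\<close> by its norm, for which \<open>u\<close> must lie in the form
  domain.\<close>

lemma approx_limit:
  assumes \<kappa>: "admissible_kappa \<kappa>" and u: "u \<in> H1" and \<alpha>: "0 < \<alpha>" and t: "0 \<le> t"
    and est: "\<And>n. cmod (of_real \<alpha> * a n - of_real (mu \<kappa> n) * graph_inner G len (\<psi> n) u)
      \<le> t * vertex_sum n + cmod (graph_inner G len (\<psi> n) (qmul u))"
  shows "summable (\<lambda>n. (cmod (a n) / mu \<kappa> n)\<^sup>2)"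
    and "\<bar>\<alpha> * sqrt (weighted_sum \<kappa> a) - sqrt (nrm u)\<bar> \<le> t * vertex_majorant \<kappa> + 2 * qmax / \<kappa>\<^sup>2 * sqrt (nrm u)"
proof -
  let ?X = "\<lambda>N. L2_set (\<lambda>n. cmod (a n) / mu \<kappa> n) {..<N}"
  let ?P = "\<lambda>N. L2_set (\<lambda>n. cmod (graph_inner G len (\<psi> n) u)) {..<N}"
  let ?R = "t * vertex_majorant \<kappa> + 2 * qmax / \<kappa>\<^sup>2 * sqrt (nrm u)"
  have le: "\<bar>\<alpha> * ?X N - ?P N\<bar> \<le> ?R" for N
    using approx [OF \<kappa> u _ t est, of N] \<alpha> mult_left_mono [OF vertex_majorant_bound [OF \<kappa>, of N] t] by linarith
  have "?X N \<le> (sqrt (nrm u) + ?R) / \<alpha>" for N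
    using le [of N] L2_set_ip_le [OF H1_in_L2 [OF u], of N] \<alpha> by (simp add: pos_le_divide_eq mult.commute)
  note summ = L2_set_bounded_summable [OF this]
  show "summable (\<lambda>n. (cmod (a n) / mu \<kappa> n)\<^sup>2)" by (rule summ)
  have lim: "?X \<longlonglongrightarrow> sqrt (weighted_sum \<kappa> a)" unfolding weighted_sum_def by (rule summ)
  have "(\<lambda>N. \<bar>\<alpha> * ?X N - ?P N\<bar>) \<longlonglongrightarrow> \<bar>\<alpha> * sqrt (weighted_sum \<kappa> a) - sqrt (nrm u)\<bar>"
    by (intro tendsto_intros lim L2_set_ip_tendsto u)
  then show "\<bar>\<alpha> * sqrt (weighted_sum \<kappa> a) - sqrt (nrm u)\<bar> \<le> ?R"
    by (rule LIMSEQ_le_const2) (use le in auto)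
qed

end

section \<open>Asymptotics for large \<open>\<kappa>\<close>\<close>

context loopfree_schroedinger
begin

definition majorant_limit :: real where
  "majorant_limit = 2 * (\<Sum>w\<in>verts G. sqrt (vertex_degree G w / 2))"

lemma inverse_square_tendsto: "((\<lambda>\<kappa>::real. c / \<kappa>\<^sup>2) \<longlongrightarrow> 0) at_top"
  by (intro tendsto_divide_0 [OF tendsto_const] filterlim_at_top_imp_at_infinity filterlim_pow_at_top filterlim_ident) auto

text \<open>The majorant has order \<open>\<kappa>^(-3/2)\<close>, just like the square roots of the
  weighted sums. It is harmless only because it enters with a factor that tends to 0:
  \<open>eta \<kappa> + \<sigma>sum / \<kappa>\<close> at a vertex, values of \<open>hsin\<close>
  inside an edge.\<close>

lemma vertex_majorant_tendsto: "((\<lambda>\<kappa>. \<kappa> * sqrt \<kappa> * vertex_majorant \<kappa>) \<longlongrightarrow> majorant_limit) at_top"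
proof (rule Lim_transform_eventually)
  have "((\<lambda>\<kappa>. 2 * (1 + 2 * qmax / \<kappa>\<^sup>2) * (\<Sum>w\<in>verts G. sqrt (\<kappa> * nrm (embed (vertexU w \<kappa>)))))
      \<longlongrightarrow> 2 * (1 + 0) * (\<Sum>w\<in>verts G. sqrt (vertex_degree G w / 2))) at_top"
    by (intro tendsto_intros inverse_square_tendsto tendsto_vertexU_nrm)
  then show "((\<lambda>\<kappa>. 2 * (1 + 2 * qmax / \<kappa>\<^sup>2) * (\<Sum>w\<in>verts G. sqrt (\<kappa> * nrm (embed (vertexU w \<kappa>))))) \<longlongrightarrow> majorant_limit) at_top"
    by (simp add: majorant_limit_def)
  show "\<forall>\<^sub>F \<kappa> in at_top. 2 * (1 + 2 * qmax / \<kappa>\<^sup>2) * (\<Sum>w\<in>verts G. sqrt (\<kappa> * nrm (embed (vertexU w \<kappa>)))) = \<kappa> * sqrt \<kappa> * vertex_majorant \<kappa>"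
    using eventually_gt_at_top [of 0]
    by eventually_elim (simp add: vertex_majorant_def real_sqrt_mult sum_distrib_left mult_ac)
qed

text \<open>If \<open>N\<close> behaves like \<open>c / \<kappa>\<close> and
  \<open>\<kappa> \<alpha> sqrt S\<close> follows \<open>sqrt N\<close> up to
  \<open>o(\<kappa>^(-1/2))\<close>, then \<open>S\<close> behaves like
  \<open>c / (\<alpha>^2 \<kappa>^3)\<close>. Here \<open>\<alpha>\<close> is the degree at a vertex
  and 1 inside an edge.\<close>

lemma squeeze_limit:
  assumes \<alpha>: "0 < \<alpha>" and R: "(R \<longlongrightarrow> 0) at_top" and N: "((\<lambda>\<kappa>. \<kappa> * N \<kappa>) \<longlongrightarrow> c) at_top"
    and S: "\<forall>\<^sub>F \<kappa> in at_top. 0 < \<kappa> \<and> 0 \<le> S \<kappa> \<and> \<bar>\<kappa> * \<alpha> * sqrt (S \<kappa>) - sqrt (N \<kappa>)\<bar> * sqrt \<kappa> \<le> R \<kappa>" and c: "0 \<le> c"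
  shows "((\<lambda>\<kappa>::real. \<kappa> ^ 3 * S \<kappa>) \<longlongrightarrow> c / \<alpha>\<^sup>2) at_top"
proof -
  define Y where "Y \<kappa> = \<kappa> * sqrt \<kappa> * sqrt (S \<kappa>)" for \<kappa>
  have "((\<lambda>\<kappa>. \<alpha> * Y \<kappa> - sqrt (\<kappa> * N \<kappa>)) \<longlongrightarrow> 0) at_top"
  proof (rule Lim_null_comparison [OF _ R])
    show "\<forall>\<^sub>F \<kappa> in at_top. norm (\<alpha> * Y \<kappa> - sqrt (\<kappa> * N \<kappa>)) \<le> R \<kappa>"
      using S
    proof eventually_elim
      case (elim \<kappa>)
      have "\<alpha> * Y \<kappa> - sqrt (\<kappa> * N \<kappa>) = (\<kappa> * \<alpha> * sqrt (S \<kappa>) - sqrt (N \<kappa>)) * sqrt \<kappa>"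
        by (simp add: Y_def real_sqrt_mult algebra_simps)
      then have "norm (\<alpha> * Y \<kappa> - sqrt (\<kappa> * N \<kappa>)) = \<bar>\<kappa> * \<alpha> * sqrt (S \<kappa>) - sqrt (N \<kappa>)\<bar> * sqrt \<kappa>"
        using elim by (simp only: real_norm_def abs_mult) simp
      then show ?case using elim by simp
    qed
  qed
  then have "((\<lambda>\<kappa>. (\<alpha> * Y \<kappa> - sqrt (\<kappa> * N \<kappa>) + sqrt (\<kappa> * N \<kappa>)) / \<alpha>) \<longlongrightarrow> (0 + sqrt c) / \<alpha>) at_top"
    using \<alpha> by (intro tendsto_intros N) auto
  then have "((\<lambda>\<kappa>. Y \<kappa>) \<longlongrightarrow> sqrt c / \<alpha>) at_top" using \<alpha> by simp
  then have "((\<lambda>\<kappa>. (Y \<kappa>)\<^sup>2) \<longlongrightarrow> (sqrt c / \<alpha>)\<^sup>2) at_top" by (rule tendsto_power)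
  then have "((\<lambda>\<kappa>. (Y \<kappa>)\<^sup>2) \<longlongrightarrow> c / \<alpha>\<^sup>2) at_top" using c by (simp add: power_divide)
  then show ?thesis
  proof (rule Lim_transform_eventually)
    show "\<forall>\<^sub>F \<kappa> in at_top. (Y \<kappa>)\<^sup>2 = \<kappa> ^ 3 * S \<kappa>"
      using S
    proof eventually_elim
      case (elim \<kappa>)
      then have "(sqrt \<kappa>)\<^sup>2 = \<kappa>" "(sqrt (S \<kappa>))\<^sup>2 = S \<kappa>" by auto
      then show ?case by (simp only: Y_def power_mult_distrib) (simp only: power2_eq_square power3_eq_cube)
    qed
  qed
qed

lemma weighted_sum_nonneg: "summable (\<lambda>n. (cmod (a n) / mu \<kappa> n)\<^sup>2) \<Longrightarrow> 0 \<le> weighted_sum \<kappa> a"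
  unfolding weighted_sum_def by (rule suminf_nonneg) auto

lemma vertex_approx:
  assumes \<kappa>: "admissible_kappa \<kappa>" and v: "v \<in> verts G"
  shows "summable (\<lambda>n. (cmod (vv (\<psi> n) v) / mu \<kappa> n)\<^sup>2)"
    "\<bar>\<kappa> * vertex_degree G v * sqrt (weighted_sum \<kappa> (\<lambda>n. vv (\<psi> n) v)) - sqrt (nrm (embed (vertexU v \<kappa>)))\<bar>
      \<le> (\<kappa> * eta \<kappa> + \<sigma>sum) * vertex_majorant \<kappa> + 2 * qmax / \<kappa>\<^sup>2 * sqrt (nrm (embed (vertexU v \<kappa>)))"
proof -
  have \<kappa>0: "0 < \<kappa>" using \<kappa> by (simp add: admissible_kappa_def)
  have \<alpha>: "0 < \<kappa> * vertex_degree G v" using \<kappa>0 degree_pos [OF v] by simp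
  have t: "0 \<le> \<kappa> * eta \<kappa> + \<sigma>sum" using \<kappa>0 eta_nonneg \<sigma>sum_nonneg by simp
  show "summable (\<lambda>n. (cmod (vv (\<psi> n) v) / mu \<kappa> n)\<^sup>2)"
    "\<bar>\<kappa> * vertex_degree G v * sqrt (weighted_sum \<kappa> (\<lambda>n. vv (\<psi> n) v)) - sqrt (nrm (embed (vertexU v \<kappa>)))\<bar>
      \<le> (\<kappa> * eta \<kappa> + \<sigma>sum) * vertex_majorant \<kappa> + 2 * qmax / \<kappa>\<^sup>2 * sqrt (nrm (embed (vertexU v \<kappa>)))"
    by (rule approx_limit [OF \<kappa> vertexU_H1(1) [OF \<kappa>0] \<alpha> t vertex_est [OF \<kappa>0 v]])+
qed

lemma interior_approx:
  assumes \<kappa>: "admissible_kappa \<kappa>" and e: "e \<in> arcs G" and x: "x \<in> {0<..<len e}"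
  shows "summable (\<lambda>n. (cmod (\<psi> n e x) / mu \<kappa> n)\<^sup>2)"
    "\<bar>\<kappa> * sqrt (weighted_sum \<kappa> (\<lambda>n. \<psi> n e x)) - sqrt (nrm (embed (interiorU e x \<kappa>)))\<bar>
      \<le> \<kappa> * (hsin \<kappa> (len e) (len e - x) + hsin \<kappa> (len e) x) * vertex_majorant \<kappa> + 2 * qmax / \<kappa>\<^sup>2 * sqrt (nrm (embed (interiorU e x \<kappa>)))"
proof -
  have \<kappa>0: "0 < \<kappa>" using \<kappa> by (simp add: admissible_kappa_def)
  have t: "0 \<le> \<kappa> * (hsin \<kappa> (len e) (len e - x) + hsin \<kappa> (len e) x)"
    using \<kappa>0 x len_pos [OF e] by (intro mult_nonneg_nonneg add_nonneg_nonneg hsin_bounds) auto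
  show "summable (\<lambda>n. (cmod (\<psi> n e x) / mu \<kappa> n)\<^sup>2)"
    "\<bar>\<kappa> * sqrt (weighted_sum \<kappa> (\<lambda>n. \<psi> n e x)) - sqrt (nrm (embed (interiorU e x \<kappa>)))\<bar>
      \<le> \<kappa> * (hsin \<kappa> (len e) (len e - x) + hsin \<kappa> (len e) x) * vertex_majorant \<kappa> + 2 * qmax / \<kappa>\<^sup>2 * sqrt (nrm (embed (interiorU e x \<kappa>)))"
    by (rule approx_limit [OF \<kappa> interiorU_H1 [OF e x \<kappa>0] \<kappa>0 t interior_est [OF e x \<kappa>0]])+
qed

lemma vertex_limit:
  assumes v: "v \<in> verts G"
  shows "((\<lambda>\<kappa>. \<kappa> ^ 3 * weighted_sum \<kappa> (\<lambda>n. vv (\<psi> n) v)) \<longlongrightarrow> 1 / (2 * vertex_degree G v)) at_top"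
proof -
  let ?d = "real (vertex_degree G v)" and ?N = "\<lambda>\<kappa>. nrm (embed (vertexU v \<kappa>))"
  have d: "0 < ?d" using degree_pos [OF v] by simp
  have "((\<lambda>\<kappa>. \<kappa> ^ 3 * weighted_sum \<kappa> (\<lambda>n. vv (\<psi> n) v)) \<longlongrightarrow> (?d / 2) / ?d\<^sup>2) at_top"
  proof (rule squeeze_limit [OF d _ tendsto_vertexU_nrm])
    have "((\<lambda>\<kappa>. (eta \<kappa> + \<sigma>sum / \<kappa>) * (\<kappa> * sqrt \<kappa> * vertex_majorant \<kappa>) + 2 * qmax / \<kappa>\<^sup>2 * sqrt (\<kappa> * ?N \<kappa>)) \<longlongrightarrow> (0 + 0) * majorant_limit + 0 * sqrt (?d / 2)) at_top"
      by (intro tendsto_intros tendsto_eta_graph vertex_majorant_tendsto tendsto_vertexU_nrm inverse_square_tendsto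
          tendsto_divide_0 [OF tendsto_const] filterlim_at_top_imp_at_infinity filterlim_ident)
    then show "((\<lambda>\<kappa>. (eta \<kappa> + \<sigma>sum / \<kappa>) * (\<kappa> * sqrt \<kappa> * vertex_majorant \<kappa>) + 2 * qmax / \<kappa>\<^sup>2 * sqrt (\<kappa> * ?N \<kappa>)) \<longlongrightarrow> 0) at_top" by simp
    show "\<forall>\<^sub>F \<kappa> in at_top. 0 < \<kappa> \<and> 0 \<le> weighted_sum \<kappa> (\<lambda>n. vv (\<psi> n) v) \<and>
        \<bar>\<kappa> * ?d * sqrt (weighted_sum \<kappa> (\<lambda>n. vv (\<psi> n) v)) - sqrt (?N \<kappa>)\<bar> * sqrt \<kappa>
        \<le> (eta \<kappa> + \<sigma>sum / \<kappa>) * (\<kappa> * sqrt \<kappa> * vertex_majorant \<kappa>) + 2 * qmax / \<kappa>\<^sup>2 * sqrt (\<kappa> * ?N \<kappa>)"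
      using eventually_admissible_kappa
    proof eventually_elim
      case (elim \<kappa>)
      then have \<kappa>0: "0 < \<kappa>" by (simp add: admissible_kappa_def)
      have "\<bar>\<kappa> * ?d * sqrt (weighted_sum \<kappa> (\<lambda>n. vv (\<psi> n) v)) - sqrt (?N \<kappa>)\<bar> * sqrt \<kappa>
          \<le> ((\<kappa> * eta \<kappa> + \<sigma>sum) * vertex_majorant \<kappa> + 2 * qmax / \<kappa>\<^sup>2 * sqrt (?N \<kappa>)) * sqrt \<kappa>"
        using vertex_approx(2) [OF elim v] \<kappa>0 by (intro mult_right_mono) auto
      also have "\<dots> = (eta \<kappa> + \<sigma>sum / \<kappa>) * (\<kappa> * sqrt \<kappa> * vertex_majorant \<kappa>) + 2 * qmax / \<kappa>\<^sup>2 * sqrt (\<kappa> * ?N \<kappa>)"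
      proof -
        have t: "(\<kappa> * eta \<kappa> + \<sigma>sum) = (eta \<kappa> + \<sigma>sum / \<kappa>) * \<kappa>" using \<kappa>0 by (simp add: field_simps)
        have "(t * \<kappa> * m + c * s) * k = t * (\<kappa> * k * m) + c * (k * s)" for t m c s k :: real
          by (simp add: algebra_simps)
        then show ?thesis unfolding real_sqrt_mult t .
      qed
      finally show ?case using \<kappa>0 weighted_sum_nonneg [OF vertex_approx(1) [OF elim v]] by blast
    qed
  qed (use d in simp)
  also have "(?d / 2) / ?d\<^sup>2 = 1 / (2 * ?d)" using d by (simp add: power2_eq_square)
  finally show ?thesis by simp
qed

lemma interior_limit:
  assumes e: "e \<in> arcs G" and x: "x \<in> {0<..<len e}"
  shows "((\<lambda>\<kappa>. \<kappa> ^ 3 * weighted_sum \<kappa> (\<lambda>n. \<psi> n e x)) \<longlongrightarrow> 1 / 4) at_top"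
proof -
  let ?N = "\<lambda>\<kappa>. nrm (embed (interiorU e x \<kappa>))" and ?A = "\<lambda>\<kappa>. hsin \<kappa> (len e) (len e - x) + hsin \<kappa> (len e) x"
  have "((\<lambda>\<kappa>. \<kappa> ^ 3 * weighted_sum \<kappa> (\<lambda>n. \<psi> n e x)) \<longlongrightarrow> (1 / 4) / 1\<^sup>2) at_top"
  proof (rule squeeze_limit [OF zero_less_one _ tendsto_interiorU_nrm [OF e x]])
    have "((\<lambda>\<kappa>. ?A \<kappa> * (\<kappa> * sqrt \<kappa> * vertex_majorant \<kappa>) + 2 * qmax / \<kappa>\<^sup>2 * sqrt (\<kappa> * ?N \<kappa>)) \<longlongrightarrow> (0 + 0) * majorant_limit + 0 * sqrt (1 / 4)) at_top"
      using x by (intro tendsto_intros tendsto_hsin vertex_majorant_tendsto tendsto_interiorU_nrm e x inverse_square_tendsto) auto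
    then show "((\<lambda>\<kappa>. ?A \<kappa> * (\<kappa> * sqrt \<kappa> * vertex_majorant \<kappa>) + 2 * qmax / \<kappa>\<^sup>2 * sqrt (\<kappa> * ?N \<kappa>)) \<longlongrightarrow> 0) at_top" by simp
    show "\<forall>\<^sub>F \<kappa> in at_top. 0 < \<kappa> \<and> 0 \<le> weighted_sum \<kappa> (\<lambda>n. \<psi> n e x) \<and>
        \<bar>\<kappa> * 1 * sqrt (weighted_sum \<kappa> (\<lambda>n. \<psi> n e x)) - sqrt (?N \<kappa>)\<bar> * sqrt \<kappa>
        \<le> ?A \<kappa> * (\<kappa> * sqrt \<kappa> * vertex_majorant \<kappa>) + 2 * qmax / \<kappa>\<^sup>2 * sqrt (\<kappa> * ?N \<kappa>)"
      using eventually_admissible_kappa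
    proof eventually_elim
      case (elim \<kappa>)
      then have \<kappa>0: "0 < \<kappa>" by (simp add: admissible_kappa_def)
      have "\<bar>\<kappa> * 1 * sqrt (weighted_sum \<kappa> (\<lambda>n. \<psi> n e x)) - sqrt (?N \<kappa>)\<bar> * sqrt \<kappa>
          \<le> (\<kappa> * ?A \<kappa> * vertex_majorant \<kappa> + 2 * qmax / \<kappa>\<^sup>2 * sqrt (?N \<kappa>)) * sqrt \<kappa>"
        unfolding mult_1_right using interior_approx(2) [OF elim e x] \<kappa>0 by (intro mult_right_mono) auto
      also have "\<dots> = ?A \<kappa> * (\<kappa> * sqrt \<kappa> * vertex_majorant \<kappa>) + 2 * qmax / \<kappa>\<^sup>2 * sqrt (\<kappa> * ?N \<kappa>)"
      proof -
        have "(\<kappa> * t * m + c * s) * k = t * (\<kappa> * k * m) + c * (k * s)" for t m c s k :: real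
          by (simp add: algebra_simps)
        then show ?thesis unfolding real_sqrt_mult .
      qed
      finally show ?case using \<kappa>0 weighted_sum_nonneg [OF interior_approx(1) [OF elim e x]] by blast
    qed
  qed simp
  then show ?thesis by simp
qed

definition interior_majorant :: "real \<Rightarrow> real" where
  "interior_majorant \<kappa> = sqrt (1 / 2) * (1 + 2 * qmax / \<kappa>\<^sup>2) + 2 * (\<kappa> * sqrt \<kappa> * vertex_majorant \<kappa>)"

lemma interior_majorant_tendsto: "(interior_majorant \<longlongrightarrow> sqrt (1 / 2) * (1 + 0) + 2 * majorant_limit) at_top"
  unfolding interior_majorant_def [abs_def] by (intro tendsto_intros vertex_majorant_tendsto inverse_square_tendsto)

lemma vertex_majorant_nonneg: "0 < \<kappa> \<Longrightarrow> 0 \<le> vertex_majorant \<kappa>"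
  unfolding vertex_majorant_def using qmax(1) nrm_nonneg by (intro mult_nonneg_nonneg sum_nonneg) auto

text \<open>The dominating function for both later passages to the limit. It is independent of the
  point: near a vertex the two \<open>hsin\<close> factors no longer decay, but each is at most
  1.\<close>

lemma interior_bound:
  assumes \<kappa>: "admissible_kappa \<kappa>" and e: "e \<in> arcs G" and x: "x \<in> {0<..<len e}"
  shows "\<kappa> ^ 3 * weighted_sum \<kappa> (\<lambda>n. \<psi> n e x) \<le> (interior_majorant \<kappa>)\<^sup>2"
proof -
  have \<kappa>0: "0 < \<kappa>" using \<kappa> by (simp add: admissible_kappa_def)
  let ?N = "nrm (embed (interiorU e x \<kappa>))" and ?A = "hsin \<kappa> (len e) (len e - x) + hsin \<kappa> (len e) x"
  let ?S = "weighted_sum \<kappa> (\<lambda>n. \<psi> n e x)"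
  have S: "0 \<le> ?S" by (rule weighted_sum_nonneg [OF interior_approx(1) [OF \<kappa> e x]])
  have A: "?A \<le> 2"
    using hsin_bounds(2) [OF \<kappa>0 len_pos [OF e], of x] hsin_bounds(2) [OF \<kappa>0 len_pos [OF e], of "len e - x"] x by auto
  have sN: "sqrt \<kappa> * sqrt ?N \<le> sqrt (1 / 2)"
    using interiorU_nrm_le [OF e x \<kappa>0] by (simp flip: real_sqrt_mult)
  have "\<kappa> * sqrt ?S \<le> sqrt ?N + (\<kappa> * ?A * vertex_majorant \<kappa> + 2 * qmax / \<kappa>\<^sup>2 * sqrt ?N)"
    using interior_approx(2) [OF \<kappa> e x] by linarith
  then have "sqrt \<kappa> * (\<kappa> * sqrt ?S) \<le> sqrt \<kappa> * (sqrt ?N + (\<kappa> * ?A * vertex_majorant \<kappa> + 2 * qmax / \<kappa>\<^sup>2 * sqrt ?N))"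
    using \<kappa>0 by (intro mult_left_mono) auto
  also have "\<dots> = (sqrt \<kappa> * sqrt ?N) * (1 + 2 * qmax / \<kappa>\<^sup>2) + ?A * (\<kappa> * sqrt \<kappa> * vertex_majorant \<kappa>)"
    by (simp add: algebra_simps)
  also have "\<dots> \<le> sqrt (1 / 2) * (1 + 2 * qmax / \<kappa>\<^sup>2) + 2 * (\<kappa> * sqrt \<kappa> * vertex_majorant \<kappa>)"
    using qmax(1) \<kappa>0 vertex_majorant_nonneg [OF \<kappa>0] by (intro add_mono mult_right_mono sN A) auto
  finally have "sqrt \<kappa> * (\<kappa> * sqrt ?S) \<le> interior_majorant \<kappa>" by (simp add: interior_majorant_def)
  then have "(sqrt \<kappa> * (\<kappa> * sqrt ?S))\<^sup>2 \<le> (interior_majorant \<kappa>)\<^sup>2"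
    using \<kappa>0 S by (intro power_mono) auto
  moreover have "(sqrt \<kappa> * (\<kappa> * sqrt ?S))\<^sup>2 = \<kappa> ^ 3 * ?S"
  proof -
    have "(sqrt \<kappa>)\<^sup>2 = \<kappa>" "(sqrt ?S)\<^sup>2 = ?S" using \<kappa>0 S by auto
    then show ?thesis by (simp only: power_mult_distrib) (simp only: power2_eq_square power3_eq_cube mult.assoc)
  qed
  ultimately show ?thesis by simp
qed

lemma potential_density:
  assumes e: "e \<in> arcs G" and f: "f \<in> L2_interval (len e)"
  shows "integrable (iv (len e)) (\<lambda>x. q e x * (cmod (f x))\<^sup>2)"
    "Re (ipI (len e) (\<lambda>x. of_real (q e x) * f x) f) = (LINT x|iv (len e). q e x * (cmod (f x))\<^sup>2)"
proof -
  have i: "integrable (iv (len e)) (\<lambda>x. (of_real (q e x) * f x) * cnj (f x))"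
    by (rule L2_product [OF L2_mult(1) [OF q_measurable [OF e] qmax(2) [OF e] f] f])
  have eq: "Re ((of_real (q e x) * f x) * cnj (f x)) = q e x * (cmod (f x))\<^sup>2" for x
    by (simp only: mult.assoc complex_norm_square [symmetric] of_real_power [symmetric] of_real_mult [symmetric] Re_complex_of_real)
  show "integrable (iv (len e)) (\<lambda>x. q e x * (cmod (f x))\<^sup>2)"
    using integrable_Re [OF i] unfolding eq .
  show "Re (ipI (len e) (\<lambda>x. of_real (q e x) * f x) f) = (LINT x|iv (len e). q e x * (cmod (f x))\<^sup>2)"
    unfolding ipI_def integral_Re [OF i, symmetric] eq ..
qed

lemma eigval_minus_dnorm:
  "cf.eigval n - dnorm (\<psi> n) = (\<Sum>e\<in>arcs G. LINT x|iv (len e). q e x * (cmod (\<psi> n e x))\<^sup>2) + (\<Sum>v\<in>verts G. \<sigma> v * (cmod (vv (\<psi> n) v))\<^sup>2)"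
proof -
  have "Re (graph_inner G len (qmul f) f) = (\<Sum>e\<in>arcs G. LINT x|iv (len e). q e x * (cmod (f e x))\<^sup>2)" if "f \<in> H1" for f
    unfolding graph_inner_ipI qmul_def Re_sum using that by (intro sum.cong refl potential_density H1_L2)
  from this [OF psi_H1] show ?thesis unfolding cf.eigval_def Re_form by simp
qed

text \<open>The weights \<open>1 / (mu \<kappa> n)\<^sup>2\<close> are positive and decreasing, so
  the Ky Fan inequalities for all partial sums combine into one; afterwards the number of summands
  tends to infinity.\<close>

lemma weighted_inequality:
  assumes trace: "\<And>k. (\<Sum>n<k. cf.eigval n) \<le> (\<Sum>n<k. dnorm (\<psi> n))" and \<kappa>: "admissible_kappa \<kappa>"
  shows "(\<Sum>e\<in>arcs G. LINT x|iv (len e). q e x * weighted_sum \<kappa> (\<lambda>n. \<psi> n e x)) + (\<Sum>v\<in>verts G. \<sigma> v * weighted_sum \<kappa> (\<lambda>n. vv (\<psi> n) v)) \<le> 0"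
proof -
  have \<kappa>0: "0 < \<kappa>" using \<kappa> by (simp add: admissible_kappa_def)
  define SN where "SN N e x = (\<Sum>n<N. (cmod (\<psi> n e x) / mu \<kappa> n)\<^sup>2)" for N e x
  define VN where "VN N v = (\<Sum>n<N. (cmod (vv (\<psi> n) v) / mu \<kappa> n)\<^sup>2)" for N v
  have fin: "(\<Sum>e\<in>arcs G. LINT x|iv (len e). q e x * SN N e x) + (\<Sum>v\<in>verts G. \<sigma> v * VN N v) \<le> 0" for N
  proof -
    define w where "w n = 1 / (mu \<kappa> n)\<^sup>2" for n
    have "(\<Sum>n<N. w n * (cf.eigval n - dnorm (\<psi> n))) \<le> 0"
    proof (rule Abel_sum_nonpos)
      fix n
      have "cf.eigval n \<le> cf.eigval (Suc n)" by (rule monoD [OF cf.eigval_mono]) simp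
      then have "(mu \<kappa> n)\<^sup>2 \<le> (mu \<kappa> (Suc n))\<^sup>2" using mu_ge(2) [OF \<kappa>, of n] by (intro power_mono) auto
      moreover have "0 < (mu \<kappa> n)\<^sup>2" using mu_ge(2) [OF \<kappa>, of n] by simp
      ultimately show "w (Suc n) \<le> w n" unfolding w_def by (intro frac_le) auto
    next
      show "(\<Sum>n<k. cf.eigval n - dnorm (\<psi> n)) \<le> 0" for k
        using trace [of k] by (simp add: sum_subtractf)
    qed (simp add: w_def)
    also have "(\<Sum>n<N. w n * (cf.eigval n - dnorm (\<psi> n))) =
        (\<Sum>n<N. \<Sum>e\<in>arcs G. w n * (LINT x|iv (len e). q e x * (cmod (\<psi> n e x))\<^sup>2)) + (\<Sum>n<N. \<Sum>v\<in>verts G. w n * (\<sigma> v * (cmod (vv (\<psi> n) v))\<^sup>2))"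
      by (simp only: eigval_minus_dnorm distrib_left sum_distrib_left sum.distrib)
    also have "(\<Sum>n<N. \<Sum>e\<in>arcs G. w n * (LINT x|iv (len e). q e x * (cmod (\<psi> n e x))\<^sup>2)) = (\<Sum>e\<in>arcs G. LINT x|iv (len e). q e x * SN N e x)"
    proof (subst sum.swap, intro sum.cong refl)
      fix e assume e: "e \<in> arcs G"
      have i: "integrable (iv (len e)) (\<lambda>x. w n * (q e x * (cmod (\<psi> n e x))\<^sup>2))" for n
        using potential_density(1) [OF e H1_L2 [OF psi_H1 e]] by simp
      have "(\<Sum>n<N. w n * (LINT x|iv (len e). q e x * (cmod (\<psi> n e x))\<^sup>2)) = (\<Sum>n<N. LINT x|iv (len e). w n * (q e x * (cmod (\<psi> n e x))\<^sup>2))"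
        by simp
      also have "\<dots> = (LINT x|iv (len e). (\<Sum>n<N. w n * (q e x * (cmod (\<psi> n e x))\<^sup>2)))"
        by (rule Bochner_Integration.integral_sum [symmetric]) (rule i)
      also have "\<dots> = (LINT x|iv (len e). q e x * SN N e x)"
        by (simp add: SN_def w_def sum_distrib_left power_divide mult_ac)
      finally show "(\<Sum>n<N. w n * (LINT x|iv (len e). q e x * (cmod (\<psi> n e x))\<^sup>2)) = (LINT x|iv (len e). q e x * SN N e x)" .
    qed
    also have "(\<Sum>n<N. \<Sum>v\<in>verts G. w n * (\<sigma> v * (cmod (vv (\<psi> n) v))\<^sup>2)) = (\<Sum>v\<in>verts G. \<sigma> v * VN N v)"
      by (subst sum.swap) (simp add: VN_def w_def sum_distrib_left power_divide mult_ac)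
    finally show ?thesis .
  qed
  \<comment> \<open>The potential has no sign, so monotone convergence cannot be used; the uniform
    interior bound dominates.\<close>
  have "(\<lambda>N. LINT x|iv (len e). q e x * SN N e x) \<longlonglongrightarrow> (LINT x|iv (len e). q e x * weighted_sum \<kappa> (\<lambda>n. \<psi> n e x))" if e: "e \<in> arcs G" for e
  proof (rule integral_dominated_convergence [where w = "\<lambda>x. qmax * ((interior_majorant \<kappa>)\<^sup>2 / \<kappa> ^ 3)"])
    have [measurable]: "\<psi> n e \<in> borel_measurable (iv (len e))" "q e \<in> borel_measurable (iv (len e))" for n
      using L2_measurable [OF H1_L2 [OF psi_H1 e]] q_measurable [OF e] by auto
    have lim: "(\<lambda>N. SN N e x) \<longlonglongrightarrow> weighted_sum \<kappa> (\<lambda>n. \<psi> n e x)" if "x \<in> {0<..<len e}" for x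
      unfolding SN_def weighted_sum_def by (rule summable_LIMSEQ [OF interior_approx(1) [OF \<kappa> e that]])
    show SNm: "(\<lambda>x. q e x * SN N e x) \<in> borel_measurable (iv (len e))" for N
      unfolding SN_def by measurable
    show "(\<lambda>x. q e x * weighted_sum \<kappa> (\<lambda>n. \<psi> n e x)) \<in> borel_measurable (iv (len e))"
      unfolding weighted_sum_def by measurable
    show "AE x in iv (len e). (\<lambda>N. q e x * SN N e x) \<longlonglongrightarrow> q e x * weighted_sum \<kappa> (\<lambda>n. \<psi> n e x)"
      by (rule AE_I2) (intro tendsto_intros lim, simp)
    have in_iv: "AE x in iv (len e). x \<in> {0<..<len e}" by (rule AE_I2) simp
    show "AE x in iv (len e). norm (q e x * SN N e x) \<le> qmax * ((interior_majorant \<kappa>)\<^sup>2 / \<kappa> ^ 3)" for N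
      using qmax(2) [OF e] in_iv
    proof eventually_elim
      case (elim x)
      have "SN N e x \<le> weighted_sum \<kappa> (\<lambda>n. \<psi> n e x)"
        unfolding SN_def weighted_sum_def by (rule sum_le_suminf [OF interior_approx(1) [OF \<kappa> e elim(2)]]) auto
      also have "\<dots> \<le> (interior_majorant \<kappa>)\<^sup>2 / \<kappa> ^ 3"
        using interior_bound [OF \<kappa> e elim(2)] \<kappa>0 by (simp add: pos_le_divide_eq mult.commute)
      finally have "SN N e x \<le> (interior_majorant \<kappa>)\<^sup>2 / \<kappa> ^ 3" .
      moreover have "0 \<le> SN N e x" unfolding SN_def by (simp add: sum_nonneg)
      ultimately show ?case
        unfolding real_norm_def abs_mult using elim(1) qmax(1) by (intro mult_mono) auto
    qed
  qed simp
  then have 1: "(\<lambda>N. \<Sum>e\<in>arcs G. LINT x|iv (len e). q e x * SN N e x) \<longlonglongrightarrow> (\<Sum>e\<in>arcs G. LINT x|iv (len e). q e x * weighted_sum \<kappa> (\<lambda>n. \<psi> n e x))"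
    by (rule tendsto_sum)
  have 2: "(\<lambda>N. \<Sum>v\<in>verts G. \<sigma> v * VN N v) \<longlonglongrightarrow> (\<Sum>v\<in>verts G. \<sigma> v * weighted_sum \<kappa> (\<lambda>n. vv (\<psi> n) v))"
    unfolding VN_def weighted_sum_def by (intro tendsto_sum tendsto_mult tendsto_const summable_LIMSEQ vertex_approx(1) \<kappa>)
  show ?thesis
    by (rule LIMSEQ_le_const2 [OF tendsto_add [OF 1 2]]) (use fin in auto)
qed

text \<open>\<open>weighted_inequality\<close> is multiplied by \<open>\<kappa>^3\<close>. In the
  limit the densities are \<open>1/4\<close> on edges and \<open>1 / (2 deg v)\<close> at vertices,
  and multiplication by 4 gives the stated constants.\<close>

theorem trace_inequality:
  assumes trace: "\<And>k. (\<Sum>n<k. cf.eigval n) \<le> (\<Sum>n<k. dnorm (\<psi> n))"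
  shows "graph_integral G len q + 2 * (\<Sum>v\<in>verts G. \<sigma> v / vertex_degree G v) \<le> 0"
proof -
  define c where "c = sqrt (1 / 2) * (1 + 0) + 2 * majorant_limit"
  \<comment> \<open>Dominated convergence needs a bound free of \<open>\<kappa>\<close>;
    \<open>c\<close> is the limit of \<open>interior_majorant\<close>, and the \<open>+ 1\<close>
    leaves room for the strict inequality.\<close>
  have majorant: "\<forall>\<^sub>F \<kappa> in at_top. (interior_majorant \<kappa>)\<^sup>2 < c\<^sup>2 + 1"
    by (rule order_tendstoD(2) [OF tendsto_power [OF interior_majorant_tendsto]]) (simp add: c_def)
  have "((\<lambda>\<kappa>. LINT x|iv (len e). q e x * (\<kappa> ^ 3 * weighted_sum \<kappa> (\<lambda>n. \<psi> n e x))) \<longlongrightarrow> (LINT x|iv (len e). q e x * (1 / 4))) at_top" if e: "e \<in> arcs G" for e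
  proof (rule integral_dominated_convergence_at_top [where w = "\<lambda>x. qmax * (c\<^sup>2 + 1)"])
    have [measurable]: "\<psi> n e \<in> borel_measurable (iv (len e))" "q e \<in> borel_measurable (iv (len e))" for n
      using L2_measurable [OF H1_L2 [OF psi_H1 e]] q_measurable [OF e] by auto
    show "(\<lambda>x. q e x * (\<kappa> ^ 3 * weighted_sum \<kappa> (\<lambda>n. \<psi> n e x))) \<in> borel_measurable (iv (len e))" for \<kappa>
      unfolding weighted_sum_def by measurable
    show "(\<lambda>x. q e x * (1 / 4)) \<in> borel_measurable (iv (len e))" by measurable
    have in_iv: "AE x in iv (len e). x \<in> {0<..<len e}" by (rule AE_I2) simp
    show "AE x in iv (len e). ((\<lambda>\<kappa>. q e x * (\<kappa> ^ 3 * weighted_sum \<kappa> (\<lambda>n. \<psi> n e x))) \<longlongrightarrow> q e x * (1 / 4)) at_top"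
      using in_iv by eventually_elim (intro tendsto_mult tendsto_const interior_limit [OF e])
    show "\<forall>\<^sub>F \<kappa> in at_top. AE x in iv (len e). norm (q e x * (\<kappa> ^ 3 * weighted_sum \<kappa> (\<lambda>n. \<psi> n e x))) \<le> qmax * (c\<^sup>2 + 1)"
      using majorant eventually_admissible_kappa
    proof eventually_elim
      case (elim \<kappa>)
      then have \<kappa>0: "0 < \<kappa>" by (simp add: admissible_kappa_def)
      show ?case
        using qmax(2) [OF e] in_iv
      proof eventually_elim
        case x: (elim x)
        have "\<kappa> ^ 3 * weighted_sum \<kappa> (\<lambda>n. \<psi> n e x) \<le> c\<^sup>2 + 1"
          using interior_bound [OF elim(2) e x(2)] elim(1) by linarith
        moreover have "0 \<le> \<kappa> ^ 3 * weighted_sum \<kappa> (\<lambda>n. \<psi> n e x)"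
          using weighted_sum_nonneg [OF interior_approx(1) [OF elim(2) e x(2)]] \<kappa>0 by simp
        ultimately show ?case
          unfolding real_norm_def abs_mult [of "q e x"] using x(1) qmax(1) by (intro mult_mono) auto
      qed
    qed
  qed simp
  then have "((\<lambda>\<kappa>. (\<Sum>e\<in>arcs G. LINT x|iv (len e). q e x * (\<kappa> ^ 3 * weighted_sum \<kappa> (\<lambda>n. \<psi> n e x)))
        + (\<Sum>v\<in>verts G. \<sigma> v * (\<kappa> ^ 3 * weighted_sum \<kappa> (\<lambda>n. vv (\<psi> n) v))))
      \<longlongrightarrow> (\<Sum>e\<in>arcs G. LINT x|iv (len e). q e x * (1 / 4)) + (\<Sum>v\<in>verts G. \<sigma> v * (1 / (2 * vertex_degree G v)))) at_top"
    by (intro tendsto_add tendsto_sum tendsto_mult tendsto_const vertex_limit)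
  moreover have "\<forall>\<^sub>F \<kappa> in at_top. (\<Sum>e\<in>arcs G. LINT x|iv (len e). q e x * (\<kappa> ^ 3 * weighted_sum \<kappa> (\<lambda>n. \<psi> n e x)))
        + (\<Sum>v\<in>verts G. \<sigma> v * (\<kappa> ^ 3 * weighted_sum \<kappa> (\<lambda>n. vv (\<psi> n) v))) \<le> 0"
    using eventually_admissible_kappa
  proof eventually_elim
    case (elim \<kappa>)
    then have \<kappa>0: "0 < \<kappa>" by (simp add: admissible_kappa_def)
    have "(\<Sum>e\<in>arcs G. LINT x|iv (len e). q e x * (\<kappa> ^ 3 * weighted_sum \<kappa> (\<lambda>n. \<psi> n e x))) + (\<Sum>v\<in>verts G. \<sigma> v * (\<kappa> ^ 3 * weighted_sum \<kappa> (\<lambda>n. vv (\<psi> n) v)))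
      = \<kappa> ^ 3 * ((\<Sum>e\<in>arcs G. LINT x|iv (len e). q e x * weighted_sum \<kappa> (\<lambda>n. \<psi> n e x)) + (\<Sum>v\<in>verts G. \<sigma> v * weighted_sum \<kappa> (\<lambda>n. vv (\<psi> n) v)))"
      by (simp add: mult.left_commute [of "q _ _"] mult.left_commute [of "\<sigma> _"] distrib_left sum_distrib_left)
    also have "\<dots> \<le> 0" using weighted_inequality [OF trace elim] \<kappa>0 by (intro mult_nonneg_nonpos) auto
    finally show ?case .
  qed
  ultimately have "(\<Sum>e\<in>arcs G. LINT x|iv (len e). q e x * (1 / 4)) + (\<Sum>v\<in>verts G. \<sigma> v * (1 / (2 * vertex_degree G v))) \<le> 0"
    by (rule tendsto_upperbound) simp
  moreover have "(\<Sum>e\<in>arcs G. LINT x|iv (len e). q e x * (1 / 4)) = graph_integral G len q / 4"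
    by (simp add: graph_integral_def sum_divide_distrib)
  moreover have "(\<Sum>v\<in>verts G. \<sigma> v * (1 / (2 * vertex_degree G v))) = (\<Sum>v\<in>verts G. \<sigma> v / vertex_degree G v) / 2"
    by (simp add: sum_divide_distrib mult.commute)
  ultimately show ?thesis by simp
qed

end

context metric_graph
begin

section \<open>The constant function as a ground state\<close>

definition one :: "'e \<Rightarrow> real \<Rightarrow> complex" where
  "one = embed (\<lambda>e y. 1)"

lemma one_H1: "one \<in> H1" and one_D: "e \<in> arcs G \<Longrightarrow> AE y in iv (len e). D one e y = 0"
  and one_vv: "v \<in> verts G \<Longrightarrow> vv one v = 1"
proof -
  have d: "((\<lambda>y::real. 1::real) has_real_derivative 0 - (if y < 0 then 0 else 0)) (at y)" for y
    by simp
  show "one \<in> H1"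
    unfolding one_def by (rule embed_H1(1) [where W = "\<lambda>_ _. 0" and ?x0.0 = "\<lambda>_. 0" and J = "\<lambda>_. 0" and z = "\<lambda>_. 1"]) auto
  have "e \<in> arcs G \<Longrightarrow> AE y in iv (len e). D one e y = complex_of_real (0 - (if y < 0 then 0 else 0))"
    unfolding one_def by (rule embed_H1(2) [where W = "\<lambda>_ _. 0" and ?x0.0 = "\<lambda>_. 0" and J = "\<lambda>_. 0" and z = "\<lambda>_. 1"]) auto
  then show "e \<in> arcs G \<Longrightarrow> AE y in iv (len e). D one e y = 0" by simp
  have "v \<in> verts G \<Longrightarrow> vv one v = of_real 1"
    unfolding one_def by (rule embed_H1(3) [where W = "\<lambda>_ _. 0" and ?x0.0 = "\<lambda>_. 0" and J = "\<lambda>_. 0" and z = "\<lambda>_. 1"]) auto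
  then show "v \<in> verts G \<Longrightarrow> vv one v = 1" by simp
qed

lemma dirichlet_one: "f \<in> H1 \<Longrightarrow> dirichlet one f = 0"
  unfolding dirichlet_def
proof (intro sum.neutral ballI)
  fix e assume f: "f \<in> H1" and e: "e \<in> arcs G"
  have "ipI (len e) (D one e) (D f e) = ipI (len e) (\<lambda>_. 0) (D f e)"
    by (rule ipI_cong_AE [OF one_D [OF e] D_L2 [OF one_H1 e] L2_const D_L2 [OF f e]])
  then show "ipI (len e) (D one e) (D f e) = 0" by (simp add: ipI_def)
qed

lemma nrm_one_pos: "0 < nrm one"
proof -
  have "one \<noteq> 0"
  proof
    assume "one = 0"
    moreover obtain e where e: "e \<in> arcs G" using arcs_nonempty by blast
    ultimately have "one e 0 = 0" by simp
    then show False using e len_pos [OF e] by (simp add: one_def embed_def)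
  qed
  then show ?thesis using nrm_definite [OF one_H1] nrm_nonneg [of one] by force
qed

lemma edge_test_function:
  fixes \<phi> :: "real \<Rightarrow> real"
  assumes \<phi>: "differentiable_times 2 \<phi>" "\<phi> 0 = 0" "\<phi> (len e) = 0"
  shows "embed (\<lambda>e' y. if e' = e then \<phi> y else 0) \<in> H1"
    "v \<in> verts G \<Longrightarrow> vv (embed (\<lambda>e' y. if e' = e then \<phi> y else 0)) v = 0"
proof -
  obtain \<phi>' \<phi>'' where D: "\<And>x. (\<phi> has_real_derivative \<phi>' x) (at x)" "\<And>x. (\<phi>' has_real_derivative \<phi>'' x) (at x)"
    using \<phi>(1) by (auto simp: numeral_2_eq_2)
  have c: "continuous_on S \<phi>" "continuous_on S \<phi>'" for S
    using D by (auto intro!: continuous_at_imp_continuous_on DERIV_isCont)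
  let ?U = "\<lambda>e' y. if e' = e then \<phi> y else 0" and ?W = "\<lambda>e' y. if e' = e then \<phi>' y else 0"
  have U: "continuous_on {0..len e'} (?U e')" "continuous_on {0..len e'} (?W e')" for e'
    using c by (cases "e' = e"; simp)+
  have U': "(?U e' has_real_derivative ?W e' y - (if y < 0 then 0 else 0)) (at y)" for e' y
    using D by (cases "e' = e") auto
  show "embed ?U \<in> H1"
    by (rule embed_H1(1) [OF U U', where z = "\<lambda>_. 0"]) (use \<phi> in auto)
  have "v \<in> verts G \<Longrightarrow> vv (embed ?U) v = of_real 0"
    by (rule embed_H1(3) [OF U U', where z = "\<lambda>_. 0"]) (use \<phi> in auto)
  then show "v \<in> verts G \<Longrightarrow> vv (embed ?U) v = 0" by simp
qed

end

section \<open>Vanishing of the potential and of the vertex couplings\<close>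

context loopfree_schroedinger
begin

lemma form_one: "Re (h one one) = graph_integral G len q + (\<Sum>v\<in>verts G. \<sigma> v)"
proof -
  have "Re (graph_inner G len (qmul f) f) = (\<Sum>e\<in>arcs G. LINT x|iv (len e). q e x * (cmod (f e x))\<^sup>2)" if "f \<in> H1" for f
    unfolding graph_inner_ipI qmul_def Re_sum using that by (intro sum.cong refl potential_density H1_L2)
  from this [OF one_H1] have "Re (graph_inner G len (qmul one) one) = (\<Sum>e\<in>arcs G. LINT x|iv (len e). q e x * (cmod (one e x))\<^sup>2)" .
  also have "\<dots> = graph_integral G len q"
    unfolding graph_integral_def by (intro sum.cong refl Bochner_Integration.integral_cong) (auto simp: one_def embed_def)
  finally show ?thesis unfolding Re_form by (simp add: dirichlet_one [OF one_H1] one_vv)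
qed

text \<open>The potential comes first: bumps inside an edge vanish at all vertices and isolate
  \<open>q\<close>. The functions that isolate a vertex spread over the adjacent edges, so they
  determine \<open>\<sigma>\<close> only once \<open>q\<close> is known to vanish there.\<close>

theorem Ambarzumian:
  assumes nonneg: "\<And>f. f \<in> H1 \<Longrightarrow> 0 \<le> Re (h f f)"
    and one: "graph_integral G len q + (\<Sum>v\<in>verts G. \<sigma> v) \<le> 0"
  shows "e \<in> arcs G \<Longrightarrow> a \<in> {0<..<len e} \<Longrightarrow> q e a = 0" "v \<in> verts G \<Longrightarrow> \<sigma> v = 0"
proof -
  have h1: "h one f = 0" if f: "f \<in> H1" for f
  proof -
    have "(cmod (h one f))\<^sup>2 \<le> Re (h one one) * Re (h f f)"
      by (rule hf.Cauchy_Schwarz [OF nonneg one_H1 f])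
    also have "\<dots> \<le> 0" using one nonneg [OF f] by (simp add: form_one mult_nonpos_nonneg)
    finally show ?thesis by simp
  qed
  have eq: "graph_inner G len (qmul one) f + (\<Sum>v\<in>verts G. of_real (\<sigma> v) * cnj (vv f v)) = 0" if f: "f \<in> H1" for f
    using h1 [OF f] unfolding form_eq by (simp add: dirichlet_one [OF f] one_vv)
  have q0: "q e a = 0" if e: "e \<in> arcs G" and a: "a \<in> {0<..<len e}" for e a
  proof -
    define u where "u x = complex_of_real (q e x)" for x
    have "(\<lambda>x. of_real (q e x) * 1) \<in> L2_interval (len e)"
      by (rule L2_mult(1) [OF q_measurable [OF e] qmax(2) [OF e] L2_const])
    then have uL: "u \<in> L2_interval (len e)" by (simp add: u_def [abs_def])
    have "smooth_on {0<..<len e} (q e)" using admissible e by (simp add: admissible_potential_def)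
    then have "q e differentiable at a" using a by (auto simp: smooth_on_def dest: spec [of _ 0])
    then have qc: "isCont (q e) a" by (rule differentiable_imp_continuous_within)
    \<comment> \<open>The identity holds for integrals against test functions; mollifiers around
      \<open>a\<close> and continuity of \<open>q\<close> inside the edge turn it into a statement
      about the value at \<open>a\<close>.\<close>
    have "cmod (u a) \<le> \<eta>" if \<eta>: "0 < \<eta>" for \<eta>
    proof -
      obtain d where d: "0 < d" "\<And>x. \<bar>x - a\<bar> < d \<Longrightarrow> \<bar>q e x - q e a\<bar> < \<eta>"
        using qc \<eta> unfolding continuous_at_eps_delta by (auto simp: dist_real_def)
      define m where "m = min d (min a (len e - a))"
      define \<epsilon> where "\<epsilon> = m / 2"
      have "0 < m" "m \<le> d" "m \<le> a" "m \<le> len e - a" using d(1) a by (auto simp: m_def)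
      then have \<epsilon>: "0 < \<epsilon>" "\<epsilon> < d" "0 < a - \<epsilon>" "a + \<epsilon> < len e" unfolding \<epsilon>_def by linarith+
      let ?f = "embed (\<lambda>e' y. if e' = e then mollifier a \<epsilon> y else 0)"
      have mz: "mollifier a \<epsilon> 0 = 0" "mollifier a \<epsilon> (len e) = 0"
        using \<epsilon> by (auto simp: mollifier_def bump_zero)
      note t = edge_test_function [OF differentiable_times_mollifier mz]
      have "graph_inner G len (qmul one) ?f = 0"
        using eq [OF t(1)] t(2) by simp
      also have "graph_inner G len (qmul one) ?f = (\<Sum>e'\<in>{e}. ipI (len e') (qmul one e') (?f e'))"
        unfolding graph_inner_ipI
      proof (intro sum.mono_neutral_right ballI)
        fix e' assume "e' \<in> arcs G - {e}"
        then have "?f e' = (\<lambda>_. 0)" by (auto simp: embed_def)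
        then show "ipI (len e') (qmul one e') (?f e') = 0" by (simp add: ipI_def)
      qed (use e in auto)
      also have "\<dots> = (LINT x|iv (len e). u x * of_real (mollifier a \<epsilon> x))"
        unfolding ipI_def using e by (simp, intro Bochner_Integration.integral_cong) (auto simp: qmul_def one_def embed_def u_def)
      finally have "(LINT x|iv (len e). u x * of_real (mollifier a \<epsilon> x)) = 0" by simp
      moreover have "cmod ((LINT x|iv (len e). u x * of_real (mollifier a \<epsilon> x)) - u a) \<le> \<eta>"
      proof (rule mollifier_concentration)
        show "integrable (iv (len e)) (\<lambda>x. u x * of_real (mollifier a \<epsilon> x))"
          by (rule mollifier_product_integrable [OF uL \<epsilon>(1)])
        show "cmod (u x - u a) \<le> \<eta>" if "\<bar>x - a\<bar> < \<epsilon>" for x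
        proof -
          have "cmod (u x - u a) = \<bar>q e x - q e a\<bar>" by (simp add: u_def flip: of_real_diff)
          then show ?thesis using d(2) [of x] that \<epsilon>(2) by simp
        qed
      qed (use \<epsilon> in auto)
      ultimately show ?thesis by simp
    qed
    then have "cmod (u a) \<le> 0" by (rule field_le_epsilon) simp
    then show ?thesis by (simp add: u_def)
  qed
  then show "e \<in> arcs G \<Longrightarrow> a \<in> {0<..<len e} \<Longrightarrow> q e a = 0" .
  show "\<sigma> v = 0" if v: "v \<in> verts G"
  proof -
    \<comment> \<open>Only the vertex values of this function matter, so the parameter 1 stands for
      any positive one.\<close>
    let ?f = "embed (vertexU v 1)"
    have "graph_inner G len (qmul one) ?f = 0"
      unfolding graph_inner_ipI ipI_def
      by (intro sum.neutral ballI trans [OF Bochner_Integration.integral_cong [OF refl] Bochner_Integration.integral_zero])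
        (simp add: qmul_def q0)
    then have "(\<Sum>w\<in>verts G. of_real (\<sigma> w) * cnj (vv ?f w)) = 0"
      using eq [OF vertexU_H1(1) [OF zero_less_one], of v] by simp
    moreover have "(\<Sum>w\<in>verts G. of_real (\<sigma> w) * cnj (vv ?f w)) = (\<Sum>w\<in>verts G. if w = v then complex_of_real (\<sigma> w) else 0)"
      using vertexU_H1(2) [OF zero_less_one] by (intro sum.cong) auto
    ultimately show ?thesis using v by simp
  qed
qed

end

section \<open>The unperturbed operator and the three sign conditions\<close>

lemma (in metric_graph) zero_schroedinger: "schroedinger G len (\<lambda>e x. 0)"
proof unfold_locales
  have "(deriv ^^ n) (\<lambda>x::real. 0::real) = (\<lambda>x. 0)" for n
    by (induction n) auto
  then show "admissible_potential G len (\<lambda>e x. 0)"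
    by (auto simp: admissible_potential_def Linf_interval_def smooth_on_def)
qed

theorem corollary4:
  fixes G :: "('v, 'e) pre_digraph" and len :: "'e \<Rightarrow> real"
    and q :: "'e \<Rightarrow> real \<Rightarrow> real" and \<sigma> :: "'v \<Rightarrow> real"
  assumes "metric_graph G len" and "loopfree_digraph G"
    and "admissible_potential G len q"
    and "\<And>n. eigenvalue G len q \<sigma> n = eigenvalue G len (\<lambda>e x. 0) (\<lambda>v. 0) n"
    and "(\<Sum>v\<in>verts G. \<sigma> v * (1 - 2 / real (vertex_degree G v))) \<le> 0
       \<or> graph_integral G len q \<ge> 0 \<and> (\<forall>v\<in>verts G. 0 \<le> \<sigma> v)
       \<or> (real (min_degree G) / 2 - 1) * graph_integral G len q \<ge> 0 \<and> (\<forall>v\<in>verts G. \<sigma> v \<le> 0)"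
  shows "(\<forall>e\<in>arcs G. \<forall>x\<in>{0<..<len e}. q e x = 0) \<and> (\<forall>v\<in>verts G. \<sigma> v = 0)"
proof -
  interpret metric_graph G len by fact
  interpret L: loopfree_digraph G by fact
  interpret S: loopfree_schroedinger G len q \<sigma>
    by unfold_locales (use assms(3) L.no_loops in auto)
  interpret Z: schroedinger G len "\<lambda>e x. 0" "\<lambda>v. 0" by (rule zero_schroedinger)
  have Z_form: "Re (Z.h f f) = dnorm f" for f
    unfolding Z.Re_form by (simp add: Z.qmul_def graph_inner_ipI ipI_def)
  have eig: "S.cf.eigval = Z.cf.eigval"
    using assms(4) unfolding S.eigenvalue_eq Z.eigenvalue_eq by blast
  \<comment> \<open>The perturbed eigenfunctions are trial functions for the unperturbed form: both
    forms have the same domain, and Ky Fan asks only for orthonormality.\<close>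
  have trace: "(\<Sum>n<k. S.cf.eigval n) \<le> (\<Sum>n<k. dnorm (S.\<psi> n))" for k
    using Z.cf.ky_fan [of k S.\<psi>] S.cf.eigvec_orthonormal unfolding eig Z_form by simp
  let ?I = "graph_integral G len q" and ?\<Sigma> = "\<Sum>v\<in>verts G. \<sigma> v"
  let ?T = "\<Sum>v\<in>verts G. \<sigma> v / vertex_degree G v"
  have T: "?I + 2 * ?T \<le> 0" by (rule S.trace_inequality [OF trace])
  have first: "Z.cf.eigval 0 = 0"
  proof (rule antisym)
    have "Z.cf.eigval 0 * nrm one \<le> 0"
      using Z.cf.eigval_0_le [OF one_H1] unfolding Z_form by (simp add: dirichlet_one [OF one_H1])
    then show "Z.cf.eigval 0 \<le> 0" using nrm_one_pos by (simp add: mult_le_0_iff)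
    show "0 \<le> Z.cf.eigval 0" unfolding Z.cf.eigval_def Z_form by (rule dnorm_nonneg)
  qed
  have nonneg: "0 \<le> Re (S.h f f)" if "f \<in> H1" for f
    using S.cf.eigval_0_le [OF that] unfolding eig first by simp
  have one: "?I + ?\<Sigma> \<le> 0"
  proof -
    \<comment> \<open>The target is the sum of the trace inequality for \<open>?I + 2 * ?T\<close>
      and of this difference \<open>?\<Sigma> - 2 * ?T\<close>, whose sign is condition (i).\<close>
    have diff: "(\<Sum>v\<in>verts G. \<sigma> v * (1 - 2 / real (vertex_degree G v))) = ?\<Sigma> - 2 * ?T"
      by (simp add: right_diff_distrib sum_subtractf sum_distrib_left mult_ac)
    consider (i) "(\<Sum>v\<in>verts G. \<sigma> v * (1 - 2 / real (vertex_degree G v))) \<le> 0"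
      | (ii) "?I \<ge> 0" "\<And>v. v \<in> verts G \<Longrightarrow> 0 \<le> \<sigma> v"
      | (iii) "(real (min_degree G) / 2 - 1) * ?I \<ge> 0" "\<And>v. v \<in> verts G \<Longrightarrow> \<sigma> v \<le> 0"
      using assms(5) by blast
    then show ?thesis
    proof cases
      case i
      then show ?thesis using T unfolding diff by linarith
    next
      case ii
      have "0 \<le> ?T" using ii by (intro sum_nonneg) auto
      \<comment> \<open>Two nonnegative quantities with a nonpositive combination; positivity of the
        degrees then removes every \<open>\<sigma> v\<close>.\<close>
      then have "?T = 0" "?I = 0" using T ii by linarith+
      then have "\<sigma> v / vertex_degree G v = 0" if "v \<in> verts G" for v
        using ii that sum_nonneg_eq_0_iff [of "verts G" "\<lambda>v. \<sigma> v / vertex_degree G v"] by simp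
      then have "\<sigma> v = 0" if "v \<in> verts G" for v
        using degree_pos [OF that] that by fastforce
      then show ?thesis using \<open>?I = 0\<close> by simp
    next
      case iii
      show ?thesis
      \<comment> \<open>With all degrees at least 2 the factors \<open>1 - 2 / deg v\<close> are
        nonnegative, and \<open>\<sigma> \<le> 0\<close> leads back to the inequality of (i).
        Otherwise the prefactor in (iii) is negative, so \<open>?I\<close> and
        \<open>?\<Sigma>\<close> are both nonpositive.\<close>
      proof (cases "2 \<le> min_degree G")
        case True
        have "\<sigma> v * (1 - 2 / real (vertex_degree G v)) \<le> 0" if v: "v \<in> verts G" for v
        proof -
          have "min_degree G \<le> vertex_degree G v" unfolding min_degree_def using v by (intro Min_le) auto
          then have "2 / real (vertex_degree G v) \<le> 1" using True by (simp add: divide_le_eq_1)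
          then show ?thesis using iii(2) [OF v] by (intro mult_nonpos_nonneg) auto
        qed
        then have "?\<Sigma> - 2 * ?T \<le> 0" unfolding diff [symmetric] by (rule sum_nonpos)
        then show ?thesis using T by linarith
      next
        case False
        then have "real (min_degree G) / 2 - 1 < 0" by simp
        then have "?I \<le> 0" using iii(1) by (simp add: zero_le_mult_iff)
        moreover have "?\<Sigma> \<le> 0" using iii(2) by (rule sum_nonpos)
        ultimately show ?thesis by linarith
      qed
    qed
  qed
  show ?thesis using S.Ambarzumian [OF nonneg one] by blast
qed

end
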